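(* Let $S\in\mathbb{R}^{d_S}$, $Y\in\mathbb{R}^{d_Y}$ and $W\in\mathbb{R}^{d}$ be random vectors such that the conditional distribution of $(S,W)$ given $Y$ is Gaussian (with mean and covariance that may depend on $Y$), and such that the conditional covariance matrix $\Sigma_S(Y)$ of $S$ given $Y$ is invertible almost surely. Let $S_Y=T(S,Y)$ be the solution of the optimal transport barycenter problem for $S\mid Y$ with quadratic cost. If $W$ is independent of $S_Y$, then $W$ is conditionally independent of $S$ given $Y$.
   Context: All random vectors are defined on a common probability space, and $S$ has finite second moment. The (Monge) optimal transport barycenter problem for $S\mid Y$ with quadratic cost is $$\min_{U}\ \mathbb{E}\big[\|S-U\|^2\big]\quad\text{over all random vectors of the form } U=\tilde T(S,Y)\in\mathbb{R}^{d_S},\ \tilde T \text{ measurable, such that } U \text{ is independent of } Y,$$ and $S_Y=T(S,Y)$ denotes its minimizer. "$W$ is conditionally independent of $S$ given $Y$" means $\mathbb{E}[g(W)h(S)\mid Y]=\mathbb{E}[g(W)\mid Y]\,\mathbb{E}[h(S)\mid Y]$ almost surely for all bounded measurable real functions $g,h$. *)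

theory Defs
  imports "HOL-Probability.Probability"
begin

definition gen_sigma :: "'w measure \<Rightarrow> ('w \<Rightarrow> 'b::topological_space) \<Rightarrow> 'w measure" where
  "gen_sigma M X = vimage_algebra (space M) X borel"

text \<open>The library's \<open>indep_var\<close> forces both variables to have the same value type, so independence
  of vectors of different dimensions is phrased through \<open>indep_set\<close> for the generated
  sigma-algebras.\<close>

definition indep_rv ::
  "'w measure \<Rightarrow> ('w \<Rightarrow> 'b::topological_space) \<Rightarrow> ('w \<Rightarrow> 'c::topological_space) \<Rightarrow> bool" where
  "indep_rv M X Y \<longleftrightarrow> prob_space.indep_set M (sets (gen_sigma M X)) (sets (gen_sigma M Y))"

definition cond_exp ::
  "'w measure \<Rightarrow> ('w \<Rightarrow> 'c::topological_space) \<Rightarrow> ('w \<Rightarrow> real) \<Rightarrow> 'w \<Rightarrow> real" where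
  "cond_exp M Y f = real_cond_exp M (gen_sigma M Y) f"

definition cond_indep_given ::
  "'w measure \<Rightarrow> ('w \<Rightarrow> 'a::topological_space) \<Rightarrow> ('w \<Rightarrow> 'b::topological_space) \<Rightarrow>
   ('w \<Rightarrow> 'c::topological_space) \<Rightarrow> bool" where
  "cond_indep_given M W S Y \<longleftrightarrow>
     (\<forall>g\<in>borel_measurable borel. \<forall>h\<in>borel_measurable borel.
        bounded (range g) \<longrightarrow> bounded (range h) \<longrightarrow>
        (AE \<omega> in M. cond_exp M Y (\<lambda>\<omega>. g (W \<omega>) * h (S \<omega>)) \<omega> =
           cond_exp M Y (\<lambda>\<omega>. g (W \<omega>)) \<omega> * cond_exp M Y (\<lambda>\<omega>. h (S \<omega>)) \<omega>))"

text \<open>Gaussian laws may be degenerate: point masses are the normal laws of variance zero.\<close>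

definition normal_law :: "real \<Rightarrow> real \<Rightarrow> real measure" where
  "normal_law \<mu> \<sigma> =
     (if \<sigma> = 0 then return borel \<mu> else density lborel (\<lambda>x. ennreal (normal_density \<mu> \<sigma> x)))"

definition gaussian_measure :: "'a::euclidean_space measure \<Rightarrow> bool" where
  "gaussian_measure N \<longleftrightarrow> prob_space N \<and> sets N = sets borel \<and>
     (\<forall>u. \<exists>\<mu> \<sigma>. \<sigma> \<ge> 0 \<and> distr N borel (\<lambda>x. u \<bullet> x) = normal_law \<mu> \<sigma>)"

definition regular_cond_distr ::
  "'w measure \<Rightarrow> ('w \<Rightarrow> 'a::topological_space) \<Rightarrow> ('w \<Rightarrow> 'c::topological_space) \<Rightarrow>
   ('c \<Rightarrow> 'a measure) \<Rightarrow> bool" where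
  "regular_cond_distr M X Y K \<longleftrightarrow> K \<in> borel \<rightarrow>\<^sub>M prob_algebra borel \<and>
     (\<forall>A\<in>sets borel. AE \<omega> in M.
        cond_exp M Y (\<lambda>\<omega>. indicator A (X \<omega>)) \<omega> = measure (K (Y \<omega>)) A)"

definition cond_gaussian ::
  "'w measure \<Rightarrow> ('w \<Rightarrow> 'a::euclidean_space) \<Rightarrow> ('w \<Rightarrow> 'c::topological_space) \<Rightarrow> bool" where
  "cond_gaussian M X Y \<longleftrightarrow>
     (\<exists>K. regular_cond_distr M X Y K \<and> (AE \<omega> in M. gaussian_measure (K (Y \<omega>))))"

definition cond_cov_matrix ::
  "'w measure \<Rightarrow> ('w \<Rightarrow> real ^ 'n) \<Rightarrow> ('w \<Rightarrow> 'c::topological_space) \<Rightarrow> 'w \<Rightarrow> real ^ 'n ^ 'n" where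
  "cond_cov_matrix M S Y \<omega> =
     (\<chi> i j. cond_exp M Y
        (\<lambda>x. (S x $ i - cond_exp M Y (\<lambda>x. S x $ i) x) *
             (S x $ j - cond_exp M Y (\<lambda>x. S x $ j) x)) \<omega>)"

definition barycenter_admissible ::
  "'w measure \<Rightarrow> ('w \<Rightarrow> real ^ 'n) \<Rightarrow> ('w \<Rightarrow> real ^ 'm) \<Rightarrow>
   ((real ^ 'n) \<times> (real ^ 'm) \<Rightarrow> real ^ 'n) \<Rightarrow> bool" where
  "barycenter_admissible M S Y T \<longleftrightarrow>
     T \<in> borel_measurable borel \<and> indep_rv M (\<lambda>\<omega>. T (S \<omega>, Y \<omega>)) Y"

text \<open>The cost is an extended nonnegative integral, because an admissible vector need not have a
  finite second moment; such a competitor has cost \<open>\<infinity>\<close>.\<close>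

definition barycenter_cost ::
  "'w measure \<Rightarrow> ('w \<Rightarrow> real ^ 'n) \<Rightarrow> ('w \<Rightarrow> real ^ 'm) \<Rightarrow>
   ((real ^ 'n) \<times> (real ^ 'm) \<Rightarrow> real ^ 'n) \<Rightarrow> ennreal" where
  "barycenter_cost M S Y T = (\<integral>\<^sup>+\<omega>. ennreal ((norm (S \<omega> - T (S \<omega>, Y \<omega>)))\<^sup>2) \<partial>M)"

definition solves_ot_barycenter ::
  "'w measure \<Rightarrow> ('w \<Rightarrow> real ^ 'n) \<Rightarrow> ('w \<Rightarrow> real ^ 'm) \<Rightarrow>
   ((real ^ 'n) \<times> (real ^ 'm) \<Rightarrow> real ^ 'n) \<Rightarrow> bool" where
  "solves_ot_barycenter M S Y T \<longleftrightarrow>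
     is_arg_min (barycenter_cost M S Y) (barycenter_admissible M S Y) T"

end

theory Submission
  imports Defs
begin

text \<open>
  Given \<open>Y = y\<close>, let \<open>S\<close> have mean \<open>m\<^sub>y\<close> and covariance \<open>\<Sigma>\<^sub>y\<close>, and let \<open>U\<close> be an optimal vector, with mean
  \<open>\<mu>\<close> and covariance \<open>\<Sigma>'\<close>. For each positive definite \<open>B\<close> there is a symmetric \<open>A\<^sub>y > 0\<close> with
  \<open>A\<^sub>y \<Sigma>\<^sub>y A\<^sub>y = B\<close>, so \<open>\<mu> + A\<^sub>Y (S - m\<^sub>Y)\<close> has conditional law \<open>N(\<mu>, B)\<close> and is a competitor. Combined
  with Young's inequality \<open>2 x \<bullet> u \<le> x \<bullet> A x + u \<bullet> A\<^sup>-\<^sup>1 u\<close>, optimality of \<open>U\<close> against \<open>B = \<Sigma>' + \<eta> I\<close> bounds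
  the mean trace of \<open>A\<^sub>Y\<^sup>-\<^sup>1\<close> uniformly in \<open>\<eta>\<close>, which forces \<open>\<Sigma>'\<close> to be invertible; for \<open>\<eta> = 0\<close> it forces
  equality in Young's inequality, that is \<open>U = \<mu> + A\<^sub>Y (S - m\<^sub>Y)\<close>.

  If \<open>W\<close> is independent of \<open>U\<close>, the joint characteristic function of \<open>u \<bullet> W\<close> and \<open>e \<bullet> U\<close> factors.
  Integrating out the conditional Gaussian law, this says that \<open>x \<mapsto> E (f\<^sub>t exp (- x t \<beta>))\<close> is constant in
  \<open>x\<close>, where \<open>\<beta>\<close> is the conditional covariance of \<open>e \<bullet> U\<close> and \<open>u \<bullet> W\<close> and \<open>f\<^sub>t \<rightarrow> 1\<close> as \<open>t \<rightarrow> 0\<close>. By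
  analyticity \<open>x\<close> may be taken imaginary; then \<open>t \<rightarrow> 0\<close> shows that \<open>\<beta>\<close> has the characteristic function
  of \<open>0\<close>. As \<open>A\<^sub>Y\<close> is invertible, the conditional cross covariance of \<open>S\<close> and \<open>W\<close> vanishes.
\<close>

section \<open>Positive semidefinite matrices\<close>

text \<open>Nothing is known in advance about the law of \<open>U\<close>, not even that its
  covariance \<open>\<Sigma>'\<close> is nonsingular. Only the independence of \<open>U\<close> and
  \<open>Y\<close> is available: it gives \<open>E ((U - \<mu>) \<bullet> A\<^sub>Y\<^sup>-\<^sup>1
  (U - \<mu>)) = E (tr (A\<^sub>Y\<^sup>-\<^sup>1 \<Sigma>'))\<close>, and since \<open>B\<close> is
  built from the same covariance, \<open>tr (A\<^sub>Y\<^sup>-\<^sup>1 \<Sigma>')\<close> equals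
  \<open>tr (A\<^sub>Y \<Sigma>\<^sub>Y)\<close> up to
  \<open>\<eta> tr (A\<^sub>Y\<^sup>-\<^sup>1)\<close>. This matching makes the cost comparison
  exact up to a multiple of \<open>\<eta>\<close>. The regularisation is there because
  \<open>A\<^sub>Y\<close> has an inverse only if \<open>B\<close> has one. For the second half,
  zero correlation of \<open>W\<close> and \<open>U\<close> would at best say that the mean of
  \<open>\<beta>\<close> is 0, although \<open>\<beta>\<close> may change sign with
  \<open>Y\<close>; moreover \<open>W\<close> is not assumed to have moments. Hence whole
  characteristic functions are compared. After the term quadratic in \<open>x\<close> is removed,
  \<open>x\<close> enters only through \<open>x t \<beta>\<close>, so an imaginary \<open>x\<close>
  of size \<open>r / t\<close> keeps the frequency \<open>r\<close> of \<open>\<beta>\<close> fixed,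
  while \<open>t \<rightarrow> 0\<close> removes the unknown conditional mean and variance of
  \<open>u \<bullet> W\<close> carried by \<open>f\<^sub>t\<close>.\<close>

definition selfadjoint :: "('a::real_inner \<Rightarrow> 'a) \<Rightarrow> bool" where
  "selfadjoint f \<longleftrightarrow> (\<forall>x y. f x \<bullet> y = x \<bullet> f y)"

lemma selfadjointD: "selfadjoint f \<Longrightarrow> f x \<bullet> y = x \<bullet> f y"
  by (simp add: selfadjoint_def)

text \<open>First-order condition at a minimum: for small \<open>t\<close> of sign opposite to
  \<open>a\<close> the linear term would beat the quadratic one.\<close>

lemma quadratic_nonneg_imp_linear_zero:
  fixes a b :: real
  assumes "\<And>t. 0 \<le> 2 * t * a + t\<^sup>2 * b"
  shows "a = 0"
proof (rule ccontr)
  assume a: "a \<noteq> 0"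
  \<comment> \<open>At \<open>t = - a / d\<close> the expression is
    \<open>a\<^sup>2 / d * (b / d - 2)\<close>, which is negative for any positive \<open>d\<close>
    with \<open>b < 2 * d\<close>.\<close>
  define d where "d = 1 + \<bar>b\<bar>"
  have d: "d > 0" "b < d" by (auto simp: d_def)
  have "2 * (- a / d) * a + (- a / d)\<^sup>2 * b = a\<^sup>2 / d * (b / d - 2)"
    using d(1) by (simp add: field_simps power2_eq_square)
  also have "\<dots> < 0"
    using a d by (intro mult_pos_neg) (auto simp: pos_divide_less_eq)
  finally show False using assms[of "- a / d"] by simp
qed

text \<open>A maximiser \<open>v\<close> of the Rayleigh quotient on the unit sphere of
  \<open>V\<close> is an eigenvector, and the maximum is its eigenvalue.\<close>

lemma selfadjoint_eigenvector_exists: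
  fixes f :: "'a::euclidean_space \<Rightarrow> 'a"
  assumes f: "linear f" "selfadjoint f" and V: "subspace V" "f ` V \<subseteq> V" "V \<noteq> {0}"
  obtains v l where "v \<in> V" "norm v = 1" "f v = l *\<^sub>R v"
proof -
  let ?K = "V \<inter> sphere 0 1"
  have "compact ?K"
    by (intro closed_Int_compact closed_subspace V compact_sphere)
  moreover obtain z where z: "z \<in> V" "z \<noteq> 0" using V subspace_0 by blast
  then have "z /\<^sub>R norm z \<in> ?K" using subspace_scale[OF V(1), of z] by auto
  then have "?K \<noteq> {}" by blast
  moreover have "continuous_on ?K (\<lambda>x. x \<bullet> f x)"
    by (intro continuous_intros linear_continuous_on linear_linear[THEN iffD2] f)
  ultimately obtain v where v: "v \<in> ?K" and max: "\<And>x. x \<in> ?K \<Longrightarrow> x \<bullet> f x \<le> v \<bullet> f v"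
    using continuous_attains_sup[of ?K "\<lambda>x. x \<bullet> f x"] by blast
  define l where "l = v \<bullet> f v"
  have fscale: "f (c *\<^sub>R x) = c *\<^sub>R f x" for c x using f(1) by (rule linear_scale)
  have fadd: "f (x + y) = f x + f y" for x y using f(1) by (rule linear_add)
  have le: "x \<bullet> f x \<le> l * (x \<bullet> x)" if "x \<in> V" for x
  proof (cases "x = 0")
    case False
    then have "x /\<^sub>R norm x \<in> ?K" using subspace_scale[OF V(1) that] by auto
    from max[OF this] have "(x \<bullet> f x) / (norm x)\<^sup>2 \<le> l"
      by (simp add: fscale l_def power2_eq_square divide_simps)
    then show ?thesis using False by (simp add: divide_simps power2_norm_eq_inner mult.commute split: if_splits)
  qed (use linear_0[OF f(1)] in simp)
  have vV: "v \<in> V" and vv: "v \<bullet> v = 1" using v by (auto simp: norm_eq_1)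
  have orth: "(l *\<^sub>R v - f v) \<bullet> y = 0" if y: "y \<in> V" for y
  \<comment> \<open>The form \<open>l * (x \<bullet> x) - x \<bullet> f x\<close> is nonnegative on
    \<open>V\<close> and vanishes at \<open>v\<close>, so its expansion along
    \<open>v + t *\<^sub>R y\<close> has no linear term.\<close>
  proof (rule quadratic_nonneg_imp_linear_zero[where b = "l * (y \<bullet> y) - y \<bullet> f y"])
    fix t :: real
    have "v + t *\<^sub>R y \<in> V" using V(1) vV y by (simp add: subspace_add subspace_scale)
    from le[OF this] show "0 \<le> 2 * t * ((l *\<^sub>R v - f v) \<bullet> y) + t\<^sup>2 * (l * (y \<bullet> y) - y \<bullet> f y)"
      using selfadjointD[OF f(2), of v y] selfadjointD[OF f(2), of y v] vv
      by (simp add: fadd fscale inner_add inner_diff inner_commute algebra_simps power2_eq_square l_def[symmetric])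
  qed
  \<comment> \<open>By invariance of \<open>V\<close> the residual is itself a test vector, hence
    orthogonal to itself.\<close>
  have "l *\<^sub>R v - f v \<in> V" using V vV by (auto intro!: subspace_diff subspace_scale)
  from orth[OF this] have "f v = l *\<^sub>R v" by simp
  with that[of v l] vV v show ?thesis by auto
qed

text \<open>Induction on the dimension: an eigenvector is split off, and by selfadjointness its
  orthogonal complement inside \<open>V\<close> is again invariant.\<close>

lemma selfadjoint_orthonormal_eigenbasis_subspace:
  fixes f :: "'a::euclidean_space \<Rightarrow> 'a"
  assumes f: "linear f" "selfadjoint f" and V: "subspace V" "f ` V \<subseteq> V"
  shows "\<exists>B. finite B \<and> B \<subseteq> V \<and> pairwise orthogonal B \<and> (\<forall>b\<in>B. norm b = 1) \<and>
    V \<subseteq> span B \<and> (\<forall>b\<in>B. \<exists>l. f b = l *\<^sub>R b)"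
  using V
proof (induction "dim V" arbitrary: V rule: less_induct)
  case less
  show ?case
  proof (cases "V = {0}")
    case True
    then show ?thesis by (intro exI[of _ "{}"]) (auto)
  next
    case False
    obtain v l where v: "v \<in> V" "norm v = 1" "f v = l *\<^sub>R v"
      using selfadjoint_eigenvector_exists[OF f less.prems False] by blast
    let ?V' = "V \<inter> {x. v \<bullet> x = 0}"
    have sub: "subspace ?V'"
      using less.prems(1) subspace_hyperplane by (rule subspace_inter)
    have "v \<notin> ?V'" using v(2) by (auto simp: norm_eq_1)
    then have "?V' \<subset> V" using v(1) by blast
    then have "dim ?V' < dim V"
      using sub less.prems(1) by (metis dim_psubset span_eq_iff)
    moreover have "f ` ?V' \<subseteq> ?V'"
      using less.prems(2) selfadjointD[OF f(2), of v, symmetric] v(3) by auto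
    ultimately obtain B where B: "finite B" "B \<subseteq> ?V'" "pairwise orthogonal B" "\<forall>b\<in>B. norm b = 1"
      "?V' \<subseteq> span B" "\<forall>b\<in>B. \<exists>l. f b = l *\<^sub>R b"
      using less.hyps[of ?V'] sub by blast
    have "V \<subseteq> span (insert v B)"
    proof
      fix x assume x: "x \<in> V"
      have "x - (v \<bullet> x) *\<^sub>R v \<in> ?V'"
        using x v less.prems(1) by (auto simp: inner_diff norm_eq_1 intro!: subspace_diff subspace_scale)
      then have "x - (v \<bullet> x) *\<^sub>R v \<in> span B" using B(5) by blast
      then show "x \<in> span (insert v B)" by (auto simp: span_insert)
    qed
    moreover have "pairwise orthogonal (insert v B)"
      using B(2,3) by (auto simp: pairwise_insert orthogonal_def inner_commute)
    ultimately show ?thesis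
      using B v by (intro exI[of _ "insert v B"]) auto
  qed
qed

text \<open>Functional calculus: \<open>h\<close> shares the orthonormal eigenbasis of
  \<open>f\<close> and takes the square roots of its eigenvalues.\<close>

lemma psd_operator_sqrt_exists:
  fixes f :: "'a::euclidean_space \<Rightarrow> 'a"
  assumes f: "linear f" "selfadjoint f" and pos: "\<And>x. 0 \<le> x \<bullet> f x"
  obtains h where "linear h" "selfadjoint h" "\<And>x. 0 \<le> x \<bullet> h x" "\<And>x. h (h x) = f x"
proof -
  obtain B where B: "finite B" "pairwise orthogonal B" "\<And>b. b \<in> B \<Longrightarrow> norm b = 1"
      "UNIV \<subseteq> span B" "\<forall>b\<in>B. \<exists>l. f b = l *\<^sub>R b"
    using selfadjoint_orthonormal_eigenbasis_subspace[OF f, of UNIV] by auto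
  then obtain l where l: "\<And>b. b \<in> B \<Longrightarrow> f b = l b *\<^sub>R b" by metis
  have l0: "0 \<le> l b" if "b \<in> B" for b
    using pos[of b] l[OF that] B(3)[OF that] by (simp add: norm_eq_1)
  have expand: "(\<Sum>b\<in>B. (x \<bullet> b) *\<^sub>R b) = x" for x
    using orthonormal_basis_expand[of B x] B by (auto simp: inner_commute)
  have delta: "b \<bullet> c = (if b = c then 1 else 0)" if "b \<in> B" "c \<in> B" for b c
    using that B(2,3) by (auto simp: norm_eq_1 pairwise_def orthogonal_def)
  define h where "h x = (\<Sum>b\<in>B. (sqrt (l b) * (x \<bullet> b)) *\<^sub>R b)" for x
  have hB: "h x \<bullet> b = sqrt (l b) * (x \<bullet> b)" if "b \<in> B" for x b
  proof -
    have "h x \<bullet> b = (\<Sum>c\<in>B. if c = b then sqrt (l c) * (x \<bullet> c) else 0)"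
      unfolding h_def inner_sum_left by (intro sum.cong) (auto simp: delta that)
    then show ?thesis using B(1) that by simp
  qed
  have lin: "linear h"
    unfolding h_def by (intro linear_compose_sum ballI linearI) (auto simp: algebra_simps inner_add_left)
  have "selfadjoint h"
    unfolding selfadjoint_def
    by (auto simp: h_def inner_sum_left inner_sum_right inner_commute mult_ac intro!: sum.cong)
  moreover have "0 \<le> x \<bullet> h x" for x
  proof -
    have "x \<bullet> h x = (\<Sum>b\<in>B. sqrt (l b) * (x \<bullet> b)\<^sup>2)"
      by (simp add: h_def inner_sum_right power2_eq_square mult_ac)
    then show ?thesis by (simp add: sum_nonneg l0)
  qed
  moreover have "h (h x) = f x" for x
  proof -
    have "h (h x) = (\<Sum>b\<in>B. (l b * (x \<bullet> b)) *\<^sub>R b)"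
      unfolding h_def[of "h x"] by (intro sum.cong refl) (use l0 in \<open>simp add: hB flip: mult.assoc\<close>)
    also have "\<dots> = (\<Sum>b\<in>B. (x \<bullet> b) *\<^sub>R f b)" by (intro sum.cong) (auto simp: l)
    also have "\<dots> = f (\<Sum>b\<in>B. (x \<bullet> b) *\<^sub>R b)"
      using f(1) by (simp add: linear_sum linear_scale)
    finally show ?thesis by (simp add: expand)
  qed
  ultimately show thesis using lin that by blast
qed

section \<open>Matrix square roots, Gaussian transport matrices and trace bounds\<close>

definition psd_matrix :: "real^'n^'n \<Rightarrow> bool" where
  "psd_matrix A \<longleftrightarrow> transpose A = A \<and> (\<forall>x. 0 \<le> x \<bullet> (A *v x))"

lemma matrix_inner_transpose: "(A *v x) \<bullet> y = x \<bullet> (transpose A *v y)" for A :: "real^'n^'m"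
  by (metis dot_lmul_matrix inner_commute transpose_transpose vector_transpose_matrix)

lemma psd_matrix_inner: "psd_matrix A \<Longrightarrow> (A *v x) \<bullet> y = x \<bullet> (A *v y)"
  by (simp add: matrix_inner_transpose psd_matrix_def)

lemma psd_matrix_nonneg: "psd_matrix A \<Longrightarrow> 0 \<le> x \<bullet> (A *v x)"
  by (simp add: psd_matrix_def)

lemma psd_matrix_sqrt_exists:
  assumes "psd_matrix (A :: real^'n^'n)"
  obtains R where "psd_matrix R" "R ** R = A"
proof -
  obtain h where h: "linear h" "selfadjoint h" "\<And>x. 0 \<le> x \<bullet> h x" "\<And>x. h (h x) = A *v x"
    using psd_operator_sqrt_exists[of "(*v) A"] assms
    by (auto simp: selfadjoint_def psd_matrix_inner psd_matrix_nonneg)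
  have mh: "matrix h *v x = h x" for x using h(1) by (simp add: matrix_works)
  have "x \<bullet> (transpose (matrix h) *v y) = x \<bullet> (matrix h *v y)" for x y
    by (metis matrix_inner_transpose mh selfadjointD[OF h(2)])
  then have "transpose (matrix h) *v y = matrix h *v y" for y
    by (metis vector_eq_rdot inner_commute)
  then have "transpose (matrix h) = matrix h" by (simp add: matrix_eq)
  then have "psd_matrix (matrix h)" using h(3) by (simp add: psd_matrix_def mh)
  moreover have "matrix h ** matrix h = A"
    by (simp add: matrix_eq mh h(4) flip: matrix_vector_mul_assoc)
  ultimately show thesis using that by blast
qed

lemma psd_matrix_conj:
  assumes "psd_matrix (A :: real^'n^'n)" "transpose R = R"
  shows "psd_matrix (R ** A ** R)"
proof -
  have "x \<bullet> ((R ** A ** R) *v x) = (R *v x) \<bullet> (A *v (R *v x))" for x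
    using assms(2) matrix_inner_transpose[of R x] by (simp flip: matrix_vector_mul_assoc)
  then show ?thesis
    using assms by (simp add: psd_matrix_def matrix_transpose_mul matrix_mul_assoc)
qed

text \<open>This is the optimal transport matrix from \<open>N(0, A)\<close> to
  \<open>N(0, B)\<close>: \<open>T = R\<^sup>-\<^sup>1 Q R\<^sup>-\<^sup>1\<close> with
  \<open>R\<close> the square root of \<open>A\<close> and \<open>Q\<close> the square root of
  \<open>R B R\<close>. Then
  \<open>T A T = R\<^sup>-\<^sup>1 (R B R) R\<^sup>-\<^sup>1 = B\<close>.\<close>

lemma gaussian_transport_matrix_exists:
  fixes A B :: "real^'n^'n"
  assumes "psd_matrix A" "invertible A" "psd_matrix B" "invertible B"
  obtains T G where "psd_matrix T" "T ** A ** T = B" "T ** G = mat 1"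
proof -
  obtain R where R: "psd_matrix R" "R ** R = A" using psd_matrix_sqrt_exists assms(1) by blast
  have "invertible R"
    using assms(2) by (metis R(2) det_mul invertible_det_nz mult_eq_0_iff)
  then obtain R' where R': "R ** R' = mat 1" "R' ** R = mat 1" unfolding invertible_def by blast
  have tR: "transpose R = R" using R(1) by (simp add: psd_matrix_def)
  have tR': "transpose R' = R'"
  proof -
    have "transpose R' ** R = mat 1"
      using R'(1) tR by (metis matrix_transpose_mul transpose_mat)
    then have "transpose R' ** (R ** R') = R'" by (metis matrix_mul_assoc matrix_mul_lid)
    then show ?thesis using R'(1) by simp
  qed
  obtain Q where Q: "psd_matrix Q" "Q ** Q = R ** B ** R"
    using psd_matrix_sqrt_exists psd_matrix_conj[OF assms(3) tR] by blast
  let ?T = "R' ** Q ** R'"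
  have "?T ** A ** ?T = R' ** Q ** (R' ** R) ** (R ** R') ** Q ** R'"
    by (simp add: R(2)[symmetric] matrix_mul_assoc)
  also have "\<dots> = R' ** (Q ** Q) ** R'" by (simp add: R' matrix_mul_assoc)
  also have "\<dots> = (R' ** R) ** B ** (R ** R')" by (simp only: Q(2) matrix_mul_assoc)
  finally have TAT: "?T ** A ** ?T = B" by (simp add: R')
  then have "det ?T \<noteq> 0" using assms(4) by (metis det_mul invertible_det_nz mult_eq_0_iff)
  then obtain G where "?T ** G = mat 1" using invertible_det_nz invertible_def by blast
  with TAT psd_matrix_conj[OF Q(1) tR'] that show thesis by blast
qed

lemma invertible_of_positive_definite:
  fixes A :: "real^'n^'n"
  assumes "\<And>x. x \<noteq> 0 \<Longrightarrow> 0 < x \<bullet> (A *v x)"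
  shows "invertible A"
  unfolding invertible_left_inverse matrix_left_invertible_ker
  using assms by (metis inner_zero_right less_irrefl)

lemma psd_matrix_square_inner:
  "psd_matrix R \<Longrightarrow> x \<bullet> ((R ** R) *v x) = (R *v x) \<bullet> (R *v x)"
  by (simp add: psd_matrix_inner flip: matrix_vector_mul_assoc)

text \<open>With \<open>R\<close> the square root, the form is the squared norm of
  \<open>R *v x\<close>. This later upgrades a vanishing Young defect to a vector identity.\<close>

lemma psd_matrix_eq_0:
  assumes "psd_matrix A" "x \<bullet> (A *v x) = 0"
  shows "A *v x = 0"
proof -
  obtain R where R: "psd_matrix R" "R ** R = A" using psd_matrix_sqrt_exists assms(1) by blast
  then have "x \<bullet> (A *v x) = (R *v x) \<bullet> (R *v x)"
    using psd_matrix_square_inner by metis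
  then have "R *v x = 0" using assms(2) by simp
  then show ?thesis using R(2) by (metis matrix_vector_mul_assoc matrix_vector_mult_0_right)
qed

lemma psd_matrix_inverse:
  assumes "psd_matrix A" "A ** G = mat 1"
  shows "psd_matrix G" "G ** A = mat 1"
proof -
  show GA: "G ** A = mat 1" using assms(2) by (simp add: matrix_left_right_inverse)
  have "transpose G ** A = mat 1"
    using assms by (metis matrix_transpose_mul psd_matrix_def transpose_mat)
  then have "transpose G = G"
    by (metis GA assms(2) matrix_mul_assoc matrix_mul_lid matrix_mul_rid)
  moreover have "x \<bullet> (G *v x) = (G *v x) \<bullet> (A *v (G *v x))" for x
    using assms(2) by (simp add: matrix_vector_mul_assoc inner_commute)
  ultimately show "psd_matrix G" using psd_matrix_nonneg[OF assms(1)] by (simp add: psd_matrix_def)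
qed

text \<open>Write \<open>G\<close> as \<open>R ** transpose R\<close>: Cauchy-Schwarz is applied to
  each row of \<open>R\<close>, and the squared row norms add up to the trace.\<close>

lemma psd_matrix_le_trace:
  assumes "psd_matrix (G :: real^'n^'n)"
  shows "v \<bullet> (G *v v) \<le> trace G * (v \<bullet> v)"
proof -
  obtain R where R: "psd_matrix R" "R ** R = G" using psd_matrix_sqrt_exists assms(1) by blast
  have "v \<bullet> (G *v v) = (R *v v) \<bullet> (R *v v)"
    using R psd_matrix_square_inner by metis
  also have "\<dots> = (\<Sum>i\<in>UNIV. (R $ i \<bullet> v)\<^sup>2)"
    by (simp add: inner_vec_def matrix_vector_mult_def power2_eq_square)
  also have "\<dots> \<le> (\<Sum>i\<in>UNIV. (R $ i \<bullet> R $ i) * (v \<bullet> v))"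
    by (intro sum_mono Cauchy_Schwarz_ineq)
  also have "\<dots> = trace (R ** transpose R) * (v \<bullet> v)"
    by (simp add: trace_def matrix_matrix_mult_def transpose_def inner_vec_def sum_distrib_right)
  finally show ?thesis using R by (simp add: psd_matrix_def)
qed

lemma psd_matrix_trace_nonneg:
  assumes "psd_matrix (G :: real^'n^'n)"
  shows "0 \<le> trace G"
proof -
  have "0 \<le> G $ i $ i" for i
    using psd_matrix_nonneg[OF assms, of "axis i 1"]
    by (simp add: inner_axis' matrix_vector_mul_component inner_axis)
  then show ?thesis by (simp add: trace_def sum_nonneg)
qed

text \<open>If \<open>B\<close> is almost degenerate in the direction \<open>v\<close>, then
  \<open>T\<close> is small at \<open>v\<close> and its inverse \<open>G\<close> is large. The
  constant is a norm bound for \<open>R'\<close>, the inverse square root of \<open>A\<close>, so it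
  serves all \<open>T\<close>, \<open>B\<close> and \<open>e\<close> at once; this is needed when
  \<open>e\<close> tends to 0 over a fixed value of \<open>Y\<close>.\<close>

lemma transport_inverse_trace_lower_bound:
  fixes A :: "real^'n^'n"
  assumes "psd_matrix A" "invertible A"
  obtains c where "c > 0" "\<And>T G B v e. psd_matrix T \<Longrightarrow> T ** A ** T = B \<Longrightarrow> T ** G = mat 1 \<Longrightarrow>
    norm v = 1 \<Longrightarrow> v \<bullet> (B *v v) \<le> e\<^sup>2 \<Longrightarrow> e > 0 \<Longrightarrow> 1 / (c * e) \<le> trace G"
proof -
  obtain R where R: "psd_matrix R" "R ** R = A" using psd_matrix_sqrt_exists assms(1) by blast
  have "invertible R" using assms(2) by (metis R(2) det_mul invertible_det_nz mult_eq_0_iff)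
  then obtain R' where R': "R' ** R = mat 1" unfolding invertible_def by blast
  obtain c where c: "c > 0" "\<And>x. norm (R' *v x) \<le> c * norm x"
    using linear_bounded_pos[of "(*v) R'"] by auto
  show thesis
  proof (rule that[OF c(1)])
    fix T G B :: "real^'n^'n" and v :: "real^'n" and e :: real
    assume T: "psd_matrix T" "T ** A ** T = B" and G: "T ** G = mat 1"
      and v: "norm v = 1" "v \<bullet> (B *v v) \<le> e\<^sup>2" and e: "e > 0"
    let ?x = "T *v v" and ?t = "c * e"
    have "(norm (R *v ?x))\<^sup>2 = v \<bullet> (B *v v)"
    proof -
      have "(norm (R *v ?x))\<^sup>2 = ?x \<bullet> (A *v ?x)"
        using psd_matrix_square_inner[OF R(1), of ?x] by (simp add: R(2) power2_norm_eq_inner)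
      also have "\<dots> = v \<bullet> (B *v v)"
        unfolding T(2)[symmetric] by (simp add: psd_matrix_inner[OF T(1)] flip: matrix_vector_mul_assoc)
      finally show ?thesis .
    qed
    then have "norm (R *v ?x) \<le> e" using v(2) e by (metis abs_of_pos abs_norm_cancel abs_le_square_iff)
    then have "norm ?x \<le> ?t"
      using c(2)[of "R *v ?x"] c(1) R'
      by (simp add: matrix_vector_mul_assoc matrix_mul_assoc) (metis (no_types, lifting) order_trans mult_left_mono less_imp_le)
    then have a: "v \<bullet> ?x \<le> ?t"
      using norm_cauchy_schwarz[of v ?x] v(1) by simp
    have TG: "T *v (G *v v) = v" using G by (simp add: matrix_vector_mul_assoc)
    \<comment> \<open>Since \<open>v \<bullet> T v \<le> t\<close>, the expansion leaves
      \<open>t \<le> t\<^sup>2 (v \<bullet> G v)\<close>, a form of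
      \<open>1 / (v \<bullet> T v) \<le> v \<bullet> T\<^sup>-\<^sup>1 v\<close> for unit
      vectors.\<close>
    have "0 \<le> (v - ?t *\<^sub>R (G *v v)) \<bullet> (T *v (v - ?t *\<^sub>R (G *v v)))"
      by (rule psd_matrix_nonneg[OF T(1)])
    also have "\<dots> = v \<bullet> ?x - 2 * ?t * (v \<bullet> v) + ?t\<^sup>2 * (v \<bullet> (G *v v))"
      using psd_matrix_inner[OF T(1), of "G *v v" v] TG
      by (simp add: matrix_vector_mult_diff_distrib matrix_vector_mult_scaleR inner_diff inner_commute power2_eq_square algebra_simps)
    finally have "?t \<le> ?t\<^sup>2 * (v \<bullet> (G *v v))" using a v(1) by (simp add: norm_eq_1)
    moreover have "v \<bullet> (G *v v) \<le> trace G"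
      using psd_matrix_le_trace[OF psd_matrix_inverse(1)[OF T(1) G], of v] v(1) by (simp add: norm_eq_1)
    ultimately have "?t \<le> ?t\<^sup>2 * trace G" by (meson mult_left_mono order_trans zero_le_power2)
    moreover have "?t > 0" using c(1) e by simp
    ultimately have "1 \<le> ?t * trace G"
      using mult_le_cancel_left_pos[of ?t 1 "?t * trace G"] by (simp add: power2_eq_square mult_ac)
    then show "1 / ?t \<le> trace G" using \<open>?t > 0\<close> by (simp add: pos_divide_le_eq mult.commute)
  qed
qed

lemma matrix_scaleR_right: "A ** (c *\<^sub>R B) = c *\<^sub>R (A ** B)" for A :: "real^'n^'m"
  by (simp add: vec_eq_iff matrix_matrix_mult_def sum_distrib_left mult_ac)

lemma trace_add: "trace (A + B) = trace A + trace (B :: real^'n^'n)"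
  by (simp add: trace_def sum.distrib)

lemma trace_scaleR: "trace (c *\<^sub>R A) = c * trace (A :: real^'n^'n)"
  by (simp add: trace_def sum_distrib_left)

lemma trace_mat_1: "trace (mat 1 :: real^'n^'n) = real CARD('n)"
  by (simp add: trace_def mat_def)

section \<open>Measurable selection of transport matrices\<close>

lemma dense_sequence_exists:
  obtains q :: "nat \<Rightarrow> 'b::euclidean_space" where "\<And>x e. e > 0 \<Longrightarrow> \<exists>k. dist x (q k) < e"
proof -
  obtain D :: "'b set" where D: "countable D" "\<And>X. open X \<Longrightarrow> X \<noteq> {} \<Longrightarrow> \<exists>d\<in>D. d \<in> X"
    using countable_dense_exists by metis
  have "D \<noteq> {}" using D(2)[of UNIV] by auto
  then have q: "range (from_nat_into D) = D" using D(1) by (rule range_from_nat_into)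
  show thesis
  proof (rule that[of "from_nat_into D"])
    fix x :: 'b and e :: real assume "e > 0"
    then have "ball x e \<noteq> {}" by simp
    then obtain d where "d \<in> D" "dist x d < e" using D(2)[of "ball x e"] by auto
    then show "\<exists>k. dist x (from_nat_into D k) < e" using q by (metis rangeE)
  qed
qed

text \<open>The approximating sequences of indices are recorded as lists, so that all choices are made
  by measurable functions into a countable space.\<close>

theorem closed_relation_borel_selection:
  fixes C :: "('a::euclidean_space \<times> 'b::euclidean_space) set"
  assumes C: "closed C"
  obtains g where "g \<in> borel_measurable borel" "\<And>x z. (x, z) \<in> C \<Longrightarrow> (x, g x) \<in> C"
proof -
  obtain q :: "nat \<Rightarrow> 'b" where q: "\<And>x e. e > 0 \<Longrightarrow> \<exists>k. dist x (q k) < e"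
    by (rule dense_sequence_exists) blast
  define r :: "nat \<Rightarrow> real" where "r n = (1/2) ^ n" for n
  have r0: "r n > 0" for n by (simp add: r_def)
  \<comment> \<open>A list codes successive approximations: entry \<open>i\<close> puts the point
    within \<open>r i\<close> of \<open>q (l ! i)\<close>. The empty list imposes nothing.\<close>
  define K where "K l = (\<Inter>i<length l. cball (q (l ! i)) (r i))" for l :: "nat list"
  define P where "P l x \<longleftrightarrow> (\<exists>z\<in>K l. (x, z) \<in> C)" for l x
  have K_snoc: "K (l @ [k]) = K l \<inter> cball (q k) (r (length l))" for l k
  proof -
    have "K (l @ [k]) = (\<Inter>i\<in>insert (length l) {..<length l}. cball (q ((l @ [k]) ! i)) (r i))"
      by (simp add: K_def lessThan_Suc)
    then show ?thesis by (auto simp: K_def nth_append)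
  qed
  have compactK: "compact (K (l @ [k]))" for l k
    unfolding K_snoc by (intro closed_Int_compact compact_cball) (auto simp: K_def)
  \<comment> \<open>The projection of a closed set along a compact factor is closed.
    \<open>K []\<close> is the whole space and not compact, hence the restriction to nonempty
    lists.\<close>
  have Pmeas: "{x. P (l @ [k]) x} \<in> sets borel" for l k
  proof -
    have "closed (prod.swap -` C)"
      by (intro closed_vimage C continuous_intros)
    from closed_compact_projection[OF compactK this, of l k]
    have "closed {x. P (l @ [k]) x}" by (auto simp: P_def Bex_def)
    then show ?thesis by (rule borel_closed)
  qed
  \<comment> \<open>Greedy choice of the least index that keeps the section of \<open>C\<close>
    nonempty. Over points with an empty section \<open>LEAST\<close> is arbitrary, without harm to
    measurability.\<close>
  define s where "s x n = rec_nat [] (\<lambda>_ l. l @ [LEAST k. P (l @ [k]) x]) n" for x n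
  have s0: "s x 0 = []" and sSuc: "s x (Suc n) = s x n @ [LEAST k. P (s x n @ [k]) x]" for x n
    by (simp_all add: s_def)
  have len: "length (s x n) = n" for x n by (induction n) (auto simp: s0 sSuc)
  have smeas: "(\<lambda>x. s x n) \<in> borel \<rightarrow>\<^sub>M count_space UNIV" for n
  proof (induction n)
    case (Suc n)
    have [measurable]: "(\<lambda>x. LEAST k. P (l @ [k]) x) \<in> borel \<rightarrow>\<^sub>M count_space UNIV" for l
      using Pmeas by (intro measurable_Least) (auto simp: pred_def)
    show ?case unfolding sSuc
      by (rule measurable_compose_countable[OF _ Suc, where f = "\<lambda>l x. l @ [LEAST k. P (l @ [k]) x]"])
         measurable
  qed (simp add: s0)
  have step: "P (s x n) x" if "(x, z) \<in> C" for x z n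
  proof (induction n)
    case 0 then show ?case using that by (auto simp: P_def s0 K_def)
  next
    case (Suc n)
    then obtain w where w: "w \<in> K (s x n)" "(x, w) \<in> C" by (auto simp: P_def)
    obtain k where "dist w (q k) < r n" using q r0 by blast
    then have "P (s x n @ [k]) x" using w by (auto simp: P_def K_snoc len dist_commute intro!: bexI[of _ w])
    then show ?case unfolding sSuc by (rule LeastI)
  qed
  define c where "c n x = q (last (s x (Suc n)))" for n x
  have cmeas: "c n \<in> borel_measurable borel" for n
    unfolding c_def by (rule measurable_compose[OF smeas]) simp
  have nth: "s x n ! i = last (s x (Suc i))" if "i < n" for x n i
    using that by (induction n) (auto simp: sSuc nth_append len less_Suc_eq)
  have Kc: "dist (c i x) z \<le> r i" if "z \<in> K (s x n)" "i < n" for x z i n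
    using that by (auto simp: K_def len nth c_def)
  have conv: "convergent (\<lambda>n. c n x) \<and> (x, lim (\<lambda>n. c n x)) \<in> C" if x: "(x, z) \<in> C" for x z
  proof -
    have "\<forall>n. \<exists>w. w \<in> K (s x (Suc n)) \<and> (x, w) \<in> C"
      using step[OF x] unfolding P_def by blast
    from choice[OF this] obtain w where w: "\<And>n. w n \<in> K (s x (Suc n))" "\<And>n. (x, w n) \<in> C"
      by blast
    \<comment> \<open>The point \<open>w n\<close> lies in the \<open>n\<close>-th ball and in all
      earlier ones, so it is close to both centres.\<close>
    have "dist (c m x) (c n x) \<le> 2 * r m" if "m \<le> n" for m n
    proof -
      have "dist (c m x) (w n) \<le> r m" "dist (c n x) (w n) \<le> r n"
        using that by (auto intro!: Kc[OF w(1)])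
      moreover have "r n \<le> r m" using that by (simp add: r_def power_decreasing)
      ultimately show ?thesis using dist_triangle2[of "c m x" "c n x" "w n"] by simp
    qed
    moreover have r_lim: "r \<longlonglongrightarrow> 0" unfolding r_def by (intro LIMSEQ_power_zero) auto
    ultimately have "Cauchy (\<lambda>n. c n x)"
      unfolding Cauchy_altdef
    proof safe
      fix e :: real assume "e > 0"
      then obtain M where "\<And>n. n \<ge> M \<Longrightarrow> \<bar>r n\<bar> < e / 2"
        using r_lim by (force simp: LIMSEQ_iff dest: spec[of _ "e/2"])
      with \<open>\<And>m n. m \<le> n \<Longrightarrow> dist (c m x) (c n x) \<le> 2 * r m\<close>
      show "\<exists>M. \<forall>m\<ge>M. \<forall>n>m. dist (c m x) (c n x) < e"
        by (intro exI[of _ M]) (smt (verit) field_sum_of_halves less_imp_le_nat)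
    qed
    then have cv: "convergent (\<lambda>n. c n x)" by (simp add: Cauchy_convergent_iff)
    then have lim: "(\<lambda>n. c n x) \<longlonglongrightarrow> lim (\<lambda>n. c n x)" by (simp add: convergent_LIMSEQ_iff)
    have "(\<lambda>n. dist (c n x) (w n)) \<longlonglongrightarrow> 0"
      by (rule tendsto_sandwich[OF _ _ tendsto_const r_lim])
         (auto intro!: always_eventually Kc[OF w(1)])
    then have "w \<longlonglongrightarrow> lim (\<lambda>n. c n x)"
      using lim Lim_transform2[of "\<lambda>n. c n x" "lim (\<lambda>n. c n x)" sequentially w]
      by (simp add: dist_norm tendsto_norm_zero_iff)
    then have "(\<lambda>n. (x, w n)) \<longlonglongrightarrow> (x, lim (\<lambda>n. c n x))" by (intro tendsto_intros)
    with C w(2) have "(x, lim (\<lambda>n. c n x)) \<in> C" by (metis closed_sequentially)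
    with cv show ?thesis by blast
  qed
  show thesis
  proof (rule that[of "\<lambda>x. lim (\<lambda>n. c n x)"])
    show "(\<lambda>x. lim (\<lambda>n. c n x)) \<in> borel_measurable borel"
      using cmeas by (rule borel_measurable_lim_metric)
    show "\<And>x z. (x, z) \<in> C \<Longrightarrow> (x, lim (\<lambda>n. c n x)) \<in> C" using conv by blast
  qed
qed

section \<open>Continuity and measurability of matrix operations\<close>

lemma borel_measurable_vecI:
  fixes f :: "'a \<Rightarrow> ('b::euclidean_space) ^ 'n"
  assumes "\<And>i. (\<lambda>x. f x $ i) \<in> borel_measurable M"
  shows "f \<in> borel_measurable M"
proof -
  have "(\<lambda>x. f x \<bullet> axis i b) \<in> borel_measurable M" for i and b :: 'b
    using assms by (simp add: inner_axis)
  then show ?thesis by (subst borel_measurable_euclidean_space) (auto simp: Basis_vec_def)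
qed

lemma continuous_on_matrix_vector_mult[continuous_intros]:
  fixes f :: "'a::topological_space \<Rightarrow> real^'n^'m"
  assumes "continuous_on S f" "continuous_on S g"
  shows "continuous_on S (\<lambda>x. f x *v g x)"
  unfolding matrix_vector_mult_def by (intro continuous_intros assms)

lemma continuous_on_matrix_matrix_mult[continuous_intros]:
  fixes f :: "'a::topological_space \<Rightarrow> real^'n^'m" and g :: "'a \<Rightarrow> real^'k^'n"
  assumes "continuous_on S f" "continuous_on S g"
  shows "continuous_on S (\<lambda>x. f x ** g x)"
  unfolding matrix_matrix_mult_def by (intro continuous_intros assms)

lemma continuous_on_transpose[continuous_intros]:
  fixes f :: "'a::topological_space \<Rightarrow> real^'n^'m"
  assumes "continuous_on S f"
  shows "continuous_on S (\<lambda>x. transpose (f x))"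
  unfolding transpose_def by (intro continuous_intros assms)

lemma borel_measurable_matrix_vector_mult[measurable (raw)]:
  fixes f :: "'a \<Rightarrow> real^'n^'m"
  assumes "f \<in> borel_measurable M" "g \<in> borel_measurable M"
  shows "(\<lambda>x. f x *v g x) \<in> borel_measurable M"
  by (rule borel_measurable_continuous_Pair[OF assms]) (intro continuous_intros)

lemma borel_measurable_vec_nth[measurable (raw)]:
  fixes f :: "'a \<Rightarrow> real^'n"
  assumes "f \<in> borel_measurable M"
  shows "(\<lambda>x. f x $ i) \<in> borel_measurable M"
  by (rule borel_measurable_continuous_on[OF _ assms]) (intro continuous_intros)

lemma borel_measurable_matrix_matrix_mult[measurable (raw)]:
  fixes f :: "'a \<Rightarrow> real^'n^'m" and g :: "'a \<Rightarrow> real^'k^'n"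
  assumes "f \<in> borel_measurable M" "g \<in> borel_measurable M"
  shows "(\<lambda>x. f x ** g x) \<in> borel_measurable M"
  by (rule borel_measurable_continuous_Pair[OF assms]) (intro continuous_intros)

lemma borel_measurable_trace[measurable (raw)]:
  fixes f :: "'a \<Rightarrow> real^'n^'n"
  assumes "f \<in> borel_measurable M"
  shows "(\<lambda>x. trace (f x)) \<in> borel_measurable M"
proof -
  have "continuous_on UNIV (trace :: real^'n^'n \<Rightarrow> real)"
    unfolding trace_def by (intro continuous_intros)
  then show ?thesis by (rule borel_measurable_continuous_on[OF _ assms])
qed

text \<open>Invertibility of \<open>T\<close> is not a closed condition, but
  \<open>T ** G = mat 1\<close> is. Carrying the inverse \<open>G\<close> as a second unknown
  therefore makes the whole relation closed, and selection yields \<open>T\<close> and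
  \<open>G\<close> together.\<close>

lemma borel_transport_selection:
  fixes B :: "real^'n^'n"
  assumes B: "psd_matrix B" "invertible B"
  obtains T G :: "real^'n^'n \<Rightarrow> real^'n^'n"
  where "T \<in> borel_measurable borel" "G \<in> borel_measurable borel"
    "\<And>A. psd_matrix A \<Longrightarrow> invertible A \<Longrightarrow> psd_matrix (T A) \<and> T A ** A ** T A = B \<and> T A ** G A = mat 1"
proof -
  let ?C = "{(A, T, G). psd_matrix T \<and> T ** A ** T = B \<and> T ** G = mat 1} :: ((real^'n^'n) \<times> (real^'n^'n) \<times> (real^'n^'n)) set"
  have "closed ?C"
    unfolding psd_matrix_def case_prod_beta
    by (intro closed_Collect_conj closed_Collect_all closed_Collect_eq closed_Collect_le continuous_intros)
  then obtain g where g: "g \<in> borel_measurable borel" "\<And>x z. (x, z) \<in> ?C \<Longrightarrow> (x, g x) \<in> ?C"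
    using closed_relation_borel_selection by blast
  show thesis
  proof (rule that[of "\<lambda>A. fst (g A)" "\<lambda>A. snd (g A)"])
    show "(\<lambda>A. fst (g A)) \<in> borel_measurable borel" "(\<lambda>A. snd (g A)) \<in> borel_measurable borel"
      using g(1) by (auto simp: borel_prod[symmetric] intro: measurable_compose[OF _ measurable_fst] measurable_compose[OF _ measurable_snd])
    fix A :: "real^'n^'n" assume A: "psd_matrix A" "invertible A"
    obtain T G where "psd_matrix T" "T ** A ** T = B" "T ** G = mat 1"
      using gaussian_transport_matrix_exists[OF A B] by blast
    then have "(A, (T, G)) \<in> ?C" by simp
    from g(2)[OF this] show "psd_matrix (fst (g A)) \<and> fst (g A) ** A ** fst (g A) = B \<and> fst (g A) ** snd (g A) = mat 1"
      by (auto simp: case_prod_beta)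
  qed
qed

section \<open>Characteristic functions\<close>

lemma (in finite_measure) integrable_iexp_real:
  assumes [measurable]: "f \<in> borel_measurable M"
  shows "integrable M (\<lambda>x. iexp (f x))"
  by (rule integrable_const_bound[where B = 1]) auto

text \<open>Levy's uniqueness theorem after division by the total mass, which is the transform at 0.
  Finite rather than probability measures are needed for the weighted measures used below.\<close>

lemma finite_real_measure_eqI_char:
  fixes M N :: "real measure"
  assumes M: "finite_measure M" "sets M = sets borel" and N: "finite_measure N" "sets N = sets borel"
    and eq: "\<And>t. (CLINT x|M. iexp (t * x)) = (CLINT x|N. iexp (t * x))"
  shows "M = N"
proof -
  interpret M: finite_measure M by fact
  interpret N: finite_measure N by fact
  have sp: "space M = UNIV" "space N = UNIV"
    using M(2) N(2) by (auto dest: sets_eq_imp_space_eq)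
  define c where "c = measure M UNIV"
  have c: "c = measure N UNIV"
    using eq[of 0] sp by (simp add: c_def)
  have eM: "emeasure M UNIV = c" and eN: "emeasure N UNIV = c"
    by (simp_all add: c_def M.emeasure_eq_measure N.emeasure_eq_measure flip: c)
  show ?thesis
  proof (cases "c = 0")
    case True
    have "emeasure M A = 0" "emeasure N A = 0" for A
      using emeasure_space[of M A] emeasure_space[of N A] sp eM eN True by auto
    then show ?thesis using M N by (intro measure_eqI) auto
  next
    case False
    then have cpos: "c > 0" by (metis c_def measure_nonneg less_le)
    let ?s = "\<lambda>L. density L (\<lambda>_. ennreal (1/c))"
    have rd: "real_distribution (?s M)" "real_distribution (?s N)"
      using M(2) N(2) cpos eM eN sp
      by (auto simp: real_distribution_def real_distribution_axioms_def emeasure_density_const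
          simp flip: ennreal_mult intro!: prob_spaceI)
    have "char (?s M) = char (?s N)"
      unfolding char_def using eq cpos M(2) N(2)
      by (intro ext) (simp add: integral_density cong: measurable_cong_sets)
    with Levy_uniqueness[OF rd] have s: "?s M = ?s N" .
    show ?thesis
    proof (rule measure_eqI)
      fix A assume A: "A \<in> sets M"
      have "ennreal c * emeasure (?s M) A = ennreal c * emeasure (?s N) A" using s by simp
      then show "emeasure M A = emeasure N A"
        using cpos A M(2) N(2) by (simp add: emeasure_density_const flip: mult.assoc ennreal_mult)
    qed (simp add: M N)
  qed
qed

text \<open>The weights \<open>1 + cos\<close> and \<open>1 + sin\<close> are nonnegative, hence
  usable as densities, and Euler's formulas express their effect through frequency shifts by
  \<open>g\<close> and \<open>- g\<close>.\<close>

lemma integral_iexp_mult_one_plus: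
  fixes f g :: "'w \<Rightarrow> real"
  assumes "finite_measure M" and [measurable]: "f \<in> borel_measurable M" "g \<in> borel_measurable M"
  shows "(CLINT x|M. (1 + complex_of_real (cos (g x))) * iexp (f x)) =
      (CLINT x|M. iexp (f x)) + ((CLINT x|M. iexp (f x + g x)) + (CLINT x|M. iexp (f x - g x))) / 2"
    and "(CLINT x|M. (1 + complex_of_real (sin (g x))) * iexp (f x)) =
      (CLINT x|M. iexp (f x)) + ((CLINT x|M. iexp (f x + g x)) - (CLINT x|M. iexp (f x - g x))) / (2 * \<i>)"
proof -
  interpret finite_measure M by fact
  have i: "integrable M (\<lambda>x. iexp (f x))" "integrable M (\<lambda>x. iexp (f x + g x))"
    "integrable M (\<lambda>x. iexp (f x - g x))" by (rule integrable_iexp_real; simp)+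
  have c: "(1 + complex_of_real (cos (g x))) * iexp (f x) =
      iexp (f x) + (iexp (f x + g x) + iexp (f x - g x)) / 2" for x
    unfolding cos_of_real[symmetric] cos_exp_eq
    by (simp add: exp_add[symmetric] algebra_simps add_divide_distrib)
  have s: "(1 + complex_of_real (sin (g x))) * iexp (f x) =
      iexp (f x) + (iexp (f x + g x) - iexp (f x - g x)) / (2 * \<i>)" for x
    unfolding sin_of_real[symmetric] sin_exp_eq
    by (simp add: exp_add[symmetric] algebra_simps add_divide_distrib diff_divide_distrib)
  show "(CLINT x|M. (1 + complex_of_real (cos (g x))) * iexp (f x)) =
      (CLINT x|M. iexp (f x)) + ((CLINT x|M. iexp (f x + g x)) + (CLINT x|M. iexp (f x - g x))) / 2"
    unfolding c using i by simp
  show "(CLINT x|M. (1 + complex_of_real (sin (g x))) * iexp (f x)) =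
      (CLINT x|M. iexp (f x)) + ((CLINT x|M. iexp (f x + g x)) - (CLINT x|M. iexp (f x - g x))) / (2 * \<i>)"
    unfolding s using i by simp
qed

text \<open>With \<open>w\<close> taken as a density, the hypothesis equates the transforms of two
  image measures on the line; one-dimensional uniqueness then allows the event
  \<open>X \<in> A\<close> to be tested.\<close>

lemma weighted_indicator_integral_eq:
  fixes X w :: "'w \<Rightarrow> real"
  assumes M: "finite_measure M" and N: "finite_measure N" and sets: "sets N = sets M"
    and X[measurable]: "X \<in> borel_measurable M" and w[measurable]: "w \<in> borel_measurable M"
    and w_bound: "\<And>x. 0 \<le> w x" "\<And>x. w x \<le> 2" and A[measurable]: "A \<in> sets borel"
    and eq: "\<And>s. (CLINT x|M. complex_of_real (w x) * iexp (s * X x)) =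
      (CLINT x|N. complex_of_real (w x) * iexp (s * X x))"
  shows "(CLINT x|M. complex_of_real (indicator A (X x) * w x)) =
    (CLINT x|N. complex_of_real (indicator A (X x) * w x))"
proof -
  note [measurable_cong] = sets
  have fin: "finite_measure (distr (density L (\<lambda>x. ennreal (w x))) borel X)"
    if "finite_measure L" "sets L = sets M" for L
  proof -
    interpret L: finite_measure L by fact
    note [measurable_cong] = that(2)
    have "(\<integral>\<^sup>+x. ennreal (w x) \<partial>L) \<le> (\<integral>\<^sup>+x. ennreal 2 \<partial>L)"
      by (intro nn_integral_mono ennreal_leI w_bound)
    also have "\<dots> < \<infinity>" by (simp add: L.emeasure_eq_measure ennreal_mult_less_top)
    finally have "finite_measure (density L (\<lambda>x. ennreal (w x)))"
      by (intro finite_measureI) (auto simp: emeasure_density cong: nn_integral_cong_simp)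
    then show ?thesis by (rule finite_measure.finite_measure_distr) simp
  qed
  have "distr (density M (\<lambda>x. ennreal (w x))) borel X = distr (density N (\<lambda>x. ennreal (w x))) borel X"
    using eq w_bound by (intro finite_real_measure_eqI_char fin M N sets refl)
      (auto simp: integral_distr integral_density scaleR_conv_of_real)
  moreover have "(\<integral>x. indicator A x \<partial>distr (density L (\<lambda>x. ennreal (w x))) borel X) =
      (\<integral>x. indicator A (X x) * w x \<partial>L)" if "sets L = sets M" for L
  proof -
    note [measurable_cong] = that
    have "(\<integral>x. indicator A x \<partial>distr (density L (\<lambda>x. ennreal (w x))) borel X) =
        (\<integral>x. indicator A (X x) \<partial>density L (\<lambda>x. ennreal (w x)) :: real)"
      by (rule integral_distr) auto
    also have "\<dots> = (\<integral>x. w x *\<^sub>R indicator A (X x) \<partial>L)"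
      using w_bound by (intro integral_density) auto
    finally show ?thesis by (simp add: mult.commute)
  qed
  ultimately have "(\<integral>x. indicator A (X x) * w x \<partial>M) = (\<integral>x. indicator A (X x) * w x \<partial>N)"
    using sets by metis
  then show ?thesis by (simp only: integral_complex_of_real)
qed

text \<open>Recovers the oscillating factor from nonnegative weights, by
  \<open>iexp x = (1 + cos x) + \<i> (1 + sin x) - (1 + \<i>)\<close>.\<close>

lemma integral_iexp_density_split:
  fixes f g :: "'w \<Rightarrow> real"
  assumes "finite_measure M" and [measurable]: "f \<in> borel_measurable M" "g \<in> borel_measurable M"
    and f: "\<And>x. 0 \<le> f x" "\<And>x. f x \<le> 1"
  shows "(CLINT x|density M (\<lambda>x. ennreal (f x)). iexp (g x)) =
    (CLINT x|M. complex_of_real (f x * (1 + cos (g x)))) +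
    \<i> * (CLINT x|M. complex_of_real (f x * (1 + sin (g x)))) -
    (1 + \<i>) * (CLINT x|M. complex_of_real (f x * 1))"
proof -
  interpret finite_measure M by fact
  have i: "integrable M (\<lambda>x. complex_of_real (f x * h x))"
    if [measurable]: "h \<in> borel_measurable M" and "\<And>x. 0 \<le> h x" "\<And>x. h x \<le> 2" for h
  proof (rule integrable_const_bound[where B = 2])
    have "f x * h x \<le> 1 * 2" for x by (intro mult_mono f that) simp
    then show "AE x in M. norm (complex_of_real (f x * h x)) \<le> 2"
      using f that by (simp add: norm_mult)
  qed simp
  have "1 + cos x \<ge> 0" "1 + cos x \<le> 2" "1 + sin x \<ge> 0" "1 + sin x \<le> 2" for x :: real
    using abs_cos_le_one[of x] abs_sin_le_one[of x] by linarith+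
  then have I: "integrable M (\<lambda>x. complex_of_real (f x * (1 + cos (g x))))"
    "integrable M (\<lambda>x. complex_of_real (f x * (1 + sin (g x))))"
    "integrable M (\<lambda>x. complex_of_real (f x * 1))"
    by (intro i; simp)+
  have "(CLINT x|density M (\<lambda>x. ennreal (f x)). iexp (g x)) = (CLINT x|M. f x *\<^sub>R iexp (g x))"
    using f by (intro integral_density) auto
  also have "\<dots> = (CLINT x|M. complex_of_real (f x * (1 + cos (g x))) +
    \<i> * complex_of_real (f x * (1 + sin (g x))) - (1 + \<i>) * complex_of_real (f x * 1))"
    by (intro Bochner_Integration.integral_cong refl)
       (simp add: scaleR_conv_of_real exp_Euler cos_of_real sin_of_real algebra_simps)
  finally show ?thesis using I by (simp del: of_real_mult of_real_add of_real_1 mult_1_right)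
qed

text \<open>Induction on the number of coordinates, with the measures generalized: both are
  restricted to \<open>X j \<in> A j\<close>, and the restricted measures still have equal
  transforms in the remaining coordinates. In this way one-dimensional uniqueness suffices.\<close>

lemma emeasure_eq_joint_char:
  fixes X :: "'i \<Rightarrow> 'w \<Rightarrow> real"
  assumes "finite I" "finite_measure M" "finite_measure N" "sets N = sets M"
    and "\<And>i. X i \<in> borel_measurable M" "\<And>i. A i \<in> sets borel"
    and "\<And>t. (CLINT x|M. iexp (\<Sum>i\<in>I. t i * X i x)) = (CLINT x|N. iexp (\<Sum>i\<in>I. t i * X i x))"
  shows "emeasure M {x\<in>space M. \<forall>i\<in>I. X i x \<in> A i} = emeasure N {x\<in>space M. \<forall>i\<in>I. X i x \<in> A i}"
  using assms
proof (induction I arbitrary: M N rule: finite_induct)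
  case empty
  interpret M: finite_measure M by fact
  interpret N: finite_measure N by fact
  have "space N = space M" using empty(3) by (rule sets_eq_imp_space_eq)
  then show ?case using empty(6) by (simp add: M.emeasure_eq_measure N.emeasure_eq_measure)
next
  case (insert j I)
  note X[measurable] = insert.prems(4) and A[measurable] = insert.prems(5)
  note [measurable_cong] = insert.prems(3)
  interpret M: finite_measure M by fact
  interpret N: finite_measure N by fact
  have sp: "space N = space M" using insert.prems(3) by (rule sets_eq_imp_space_eq)
  let ?f = "\<lambda>x. indicator (A j) (X j x) :: real"
  let ?d = "\<lambda>L. density L (\<lambda>x. ennreal (?f x))"
  let ?\<theta> = "\<lambda>t x. \<Sum>i\<in>I. t i * X i x"
  have fin: "finite_measure (?d M)" "finite_measure (?d N)"
    by (intro finite_measureI; simp add: emeasure_density ennreal_mult_less_top M.emeasure_eq_measure N.emeasure_eq_measure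
        flip: ennreal_indicator, subst nn_integral_cong[of _ _ "indicator (X j -` A j \<inter> space M)"],
        auto simp: indicator_def sp M.emeasure_eq_measure N.emeasure_eq_measure)+
  \<comment> \<open>Here \<open>s\<close> is the frequency of coordinate \<open>j\<close> and
    \<open>r\<close> scales the others; \<open>r\<close> equal to 0, 1 and -1 gives the unshifted
    and the two shifted transforms demanded by the weights.\<close>
  have key: "(CLINT x|M. iexp (s * X j x + r * ?\<theta> t x)) = (CLINT x|N. iexp (s * X j x + r * ?\<theta> t x))" for s r t
  proof -
    have "(\<Sum>i\<in>insert j I. (if i = j then s else r * t i) * X i x) = s * X j x + r * ?\<theta> t x" for x
      using insert.hyps by (auto simp: sum_distrib_left mult_ac intro!: sum.cong)
    then show ?thesis using insert.prems(6)[of "\<lambda>i. if i = j then s else r * t i"] by simp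
  qed
  have char: "(CLINT x|?d M. iexp (?\<theta> t x)) = (CLINT x|?d N. iexp (?\<theta> t x))" for t
  proof -
    have e: "(CLINT x|M. complex_of_real (?f x * w x)) = (CLINT x|N. complex_of_real (?f x * w x))"
      if "w \<in> {\<lambda>x. 1, \<lambda>x. 1 + cos (?\<theta> t x), \<lambda>x. 1 + sin (?\<theta> t x)}" for w
    proof (rule weighted_indicator_integral_eq)
      show "w \<in> borel_measurable M" using that by auto
      show "0 \<le> w x" "w x \<le> 2" for x
        using that abs_cos_le_one[of "?\<theta> t x"] abs_sin_le_one[of "?\<theta> t x"]
        by (auto simp only: insert_iff empty_iff abs_le_iff)
      fix s
      define th where "th = ?\<theta> t"
      define f where "f = (\<lambda>x. s * X j x)"
      have [measurable]: "th \<in> borel_measurable M" "f \<in> borel_measurable M"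
        by (simp_all add: th_def f_def)
      have k: "(CLINT x|M. iexp (f x)) = (CLINT x|N. iexp (f x))"
        "(CLINT x|M. iexp (f x + th x)) = (CLINT x|N. iexp (f x + th x))"
        "(CLINT x|M. iexp (f x - th x)) = (CLINT x|N. iexp (f x - th x))"
        using key[of s 0 t] key[of s 1 t] key[of s "-1" t] by (simp_all add: th_def f_def)
      note eqs = integral_iexp_mult_one_plus[of _ f th]
      have "w \<in> {\<lambda>x. 1, \<lambda>x. 1 + cos (th x), \<lambda>x. 1 + sin (th x)}"
        using that by (simp add: th_def)
      then have "(CLINT x|M. complex_of_real (w x) * iexp (f x)) = (CLINT x|N. complex_of_real (w x) * iexp (f x))" (is ?goal)
      proof (elim insertE emptyE)
        assume w: "w = (\<lambda>x. 1 + cos (th x))"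
        show ?goal unfolding w using k
          by (simp add: eqs(1)[OF M.finite_measure_axioms] eqs(1)[OF N.finite_measure_axioms] del: of_real_mult)
      next
        assume w: "w = (\<lambda>x. 1 + sin (th x))"
        show ?goal unfolding w using k
          by (simp add: eqs(2)[OF M.finite_measure_axioms] eqs(2)[OF N.finite_measure_axioms] del: of_real_mult)
      qed (use k in simp)
      then show "(CLINT x|M. complex_of_real (w x) * iexp (s * X j x)) =
        (CLINT x|N. complex_of_real (w x) * iexp (s * X j x))" by (simp add: f_def)
    qed (use insert.prems in auto)
    have "(CLINT x|?d L. iexp (?\<theta> t x)) = (CLINT x|L. complex_of_real (?f x * (1 + cos (?\<theta> t x))))
        + \<i> * (CLINT x|L. complex_of_real (?f x * (1 + sin (?\<theta> t x)))) - (1 + \<i>) * (CLINT x|L. complex_of_real (?f x * 1))"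
      if L: "finite_measure L" "sets L = sets M" for L
    proof (rule integral_iexp_density_split[OF L(1)])
      note [measurable_cong] = L(2)
      show "?f \<in> borel_measurable L" "?\<theta> t \<in> borel_measurable L" by measurable
    qed (simp_all add: indicator_def)
    note split = this[OF M.finite_measure_axioms refl] this[OF N.finite_measure_axioms insert.prems(3)]
    show ?thesis unfolding split
      using e[of "\<lambda>x. 1"] e[of "\<lambda>x. 1 + cos (?\<theta> t x)"] e[of "\<lambda>x. 1 + sin (?\<theta> t x)"]
      by (simp del: of_real_mult of_real_add)
  qed
  have IH: "emeasure (?d M) {x\<in>space M. \<forall>i\<in>I. X i x \<in> A i} = emeasure (?d N) {x\<in>space M. \<forall>i\<in>I. X i x \<in> A i}"
    using insert.IH[of "?d M" "?d N"] fin insert.prems(3) char by simp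
  have S[measurable]: "{x\<in>space M. \<forall>i\<in>I. X i x \<in> A i} \<in> sets M"
    using insert.hyps(1) by measurable
  have "emeasure (?d L) {x\<in>space M. \<forall>i\<in>I. X i x \<in> A i} = emeasure L {x\<in>space M. \<forall>i\<in>insert j I. X i x \<in> A i}"
    if "sets L = sets M" for L
  proof -
    note [measurable_cong] = that
    have T: "{x\<in>space M. \<forall>i\<in>insert j I. X i x \<in> A i} \<in> sets L"
    proof -
      have "{x\<in>space M. \<forall>i\<in>insert j I. X i x \<in> A i} =
        {x\<in>space M. \<forall>i\<in>I. X i x \<in> A i} \<inter> (X j -` A j \<inter> space M)" by auto
      then show ?thesis unfolding that using S X A by (auto intro!: sets.Int measurable_sets)
    qed
    have "emeasure (?d L) {x\<in>space M. \<forall>i\<in>I. X i x \<in> A i} =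
      (\<integral>\<^sup>+x. ennreal (?f x) * indicator {x\<in>space M. \<forall>i\<in>I. X i x \<in> A i} x \<partial>L)"
      using S by (intro emeasure_density) (auto simp: that)
    also have "\<dots> = (\<integral>\<^sup>+x. indicator {x\<in>space M. \<forall>i\<in>insert j I. X i x \<in> A i} x \<partial>L)"
      by (intro nn_integral_cong) (auto simp: indicator_def)
    finally show ?thesis using T by simp
  qed
  then show ?case using IH insert.prems(3) by simp
qed

text \<open>Open boxes form an intersection-stable generator, and membership in a box is a condition
  on each coordinate separately.\<close>

theorem finite_measure_eqI_char:
  fixes M N :: "'a::euclidean_space measure"
  assumes M: "finite_measure M" "sets M = sets borel" and N: "finite_measure N" "sets N = sets borel"
    and eq: "\<And>u. (CLINT x|M. iexp (u \<bullet> x)) = (CLINT x|N. iexp (u \<bullet> x))"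
  shows "M = N"
proof (rule measure_eqI_generator_eq[where \<Omega> = UNIV and E = "range (\<lambda>(a, b). box a b)"
      and A = "\<lambda>n. box (- (real n *\<^sub>R One)) (real n *\<^sub>R One)"])
  interpret M: finite_measure M by fact
  show "Int_stable (range (\<lambda>(a, b::'a). box a b))"
    by (auto simp: Int_stable_def Int_interval(1) box_Int_box)
  show "emeasure M X = emeasure N X" if X: "X \<in> range (\<lambda>(a, b). box a b)" for X
  proof -
    from X obtain a b where X: "X = box a b" by auto
    have sp: "space M = UNIV" using M(2) by (auto dest: sets_eq_imp_space_eq)
    have "emeasure M {x\<in>space M. \<forall>i\<in>Basis. x \<bullet> i \<in> {a \<bullet> i<..<b \<bullet> i}} =
          emeasure N {x\<in>space M. \<forall>i\<in>Basis. x \<bullet> i \<in> {a \<bullet> i<..<b \<bullet> i}}"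
    proof (rule emeasure_eq_joint_char)
      fix t :: "'a \<Rightarrow> real"
      have "(\<Sum>i\<in>Basis. t i *\<^sub>R i) \<bullet> x = (\<Sum>i\<in>Basis. t i * (x \<bullet> i))" for x
        by (simp add: inner_sum_left inner_commute[of x])
      then show "(CLINT x|M. iexp (\<Sum>i\<in>Basis. t i * (x \<bullet> i))) = (CLINT x|N. iexp (\<Sum>i\<in>Basis. t i * (x \<bullet> i)))"
        using eq[of "\<Sum>i\<in>Basis. t i *\<^sub>R i"] by simp
    qed (use M N in \<open>auto cong: measurable_cong_sets\<close>)
    moreover have "{x\<in>space M. \<forall>i\<in>Basis. x \<bullet> i \<in> {a \<bullet> i<..<b \<bullet> i}} = X"
      by (auto simp: X sp box_def)
    ultimately show ?thesis by simp
  qed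
  show "sets M = sigma_sets UNIV (range (\<lambda>(a, b). box a b))"
       "sets N = sigma_sets UNIV (range (\<lambda>(a, b). box a b))"
    by (simp_all add: M N borel_eq_box)
  show "(\<Union>i. box (- (real i *\<^sub>R One)) (real i *\<^sub>R One)) = (UNIV :: 'a set)"
    by (rule UN_box_eq_UNIV)
qed (use finite_measure.emeasure_finite[OF M(1)] in auto)

lemma (in prob_space) AE_eq_0_of_char:
  fixes f :: "'a \<Rightarrow> real"
  assumes f[measurable]: "f \<in> borel_measurable M" and char: "\<And>r. (CLINT x|M. iexp (r * f x)) = 1"
  shows "AE x in M. f x = 0"
proof -
  have eq: "distr M borel f = return borel 0"
  proof (rule finite_real_measure_eqI_char)
    show "finite_measure (distr M borel f)" by (rule finite_measure_distr) simp
    show "finite_measure (return borel (0::real))"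
      by (intro prob_space.finite_measure prob_space_return) simp
    show "(CLINT x|distr M borel f. iexp (t * x)) = (CLINT x|return borel 0. iexp (t * x))" for t
      using char[of t] by (simp add: integral_distr integral_return)
  qed simp_all
  have "AE x in return borel (0::real). x = 0" by (subst AE_return) auto
  then have "AE x in distr M borel f. x = 0" by (simp only: eq)
  then show ?thesis by (subst (asm) AE_distr_iff) auto
qed

text \<open>By induction the lower coefficients vanish; division by \<open>x ^ n\<close> leaves a
  series that is 0 away from the origin and tends to \<open>a n\<close> at the origin.\<close>

lemma real_power_series_eq_zero:
  fixes a :: "nat \<Rightarrow> real"
  assumes "\<And>x. (\<lambda>n. a n * x ^ n) sums 0"
  shows "a n = 0"
proof (induction n rule: less_induct)
  case (less n)
  have s: "(\<lambda>m. a (m + n) * x ^ m) sums 0" if "x \<noteq> 0" for x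
  proof -
    have "(\<lambda>m. a (m + n) * x ^ (m + n)) sums (0 - (\<Sum>i<n. a i * x ^ i))"
      using assms by (rule sums_split_initial_segment)
    then have "(\<lambda>m. a (m + n) * x ^ (m + n)) sums 0" using less.IH by simp
    then have "(\<lambda>m. a (m + n) * x ^ (m + n) / x ^ n) sums (0 / x ^ n)" by (rule sums_divide)
    then show ?thesis using that by (simp add: power_add)
  qed
  have "((\<lambda>_. 0) \<longlongrightarrow> a (0 + n)) (at (0::real))"
    by (rule powser_limit_0_strong[of 1 "\<lambda>m. a (m + n)"]) (use s in auto)
  then show ?case by (simp add: tendsto_const_iff)
qed

text \<open>The function \<open>z \<mapsto> \<integral> f exp (z b)\<close> is entire, so if it is constant on the real axis it is
  constant on the imaginary axis.\<close>

lemma integral_exp_constant_imaginary: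
  fixes f :: "'w \<Rightarrow> complex" and b :: "'w \<Rightarrow> real"
  assumes [measurable]: "f \<in> borel_measurable M" "b \<in> borel_measurable M"
    and int: "\<And>x. integrable M (\<lambda>\<omega>. f \<omega> * of_real (exp (x * b \<omega>)))"
    and const: "\<And>x. (\<integral>\<omega>. f \<omega> * of_real (exp (x * b \<omega>)) \<partial>M) = c"
  shows "(\<integral>\<omega>. f \<omega> * iexp (x * b \<omega>) \<partial>M) = c"
proof -
  let ?t = "\<lambda>z n \<omega>. f \<omega> * (z * of_real (b \<omega>)) ^ n / fact n"
  \<comment> \<open>Integrability at \<open>R\<close> and at \<open>- R\<close> together controls
    \<open>exp (R * \<bar>b \<omega>\<bar>)\<close>, hence every term of the exponential series at
    any \<open>z\<close> of modulus \<open>R\<close>.\<close>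
  have dom: "integrable M (\<lambda>\<omega>. norm (f \<omega>) * exp (R * \<bar>b \<omega>\<bar>))" for R
  proof (rule Bochner_Integration.integrable_bound)
    show "integrable M (\<lambda>\<omega>. norm (f \<omega> * of_real (exp (R * b \<omega>))) + norm (f \<omega> * of_real (exp (- R * b \<omega>))))"
      by (intro Bochner_Integration.integrable_add integrable_norm int)
    show "AE \<omega> in M. norm (norm (f \<omega>) * exp (R * \<bar>b \<omega>\<bar>))
        \<le> norm (norm (f \<omega> * of_real (exp (R * b \<omega>))) + norm (f \<omega> * of_real (exp (- R * b \<omega>))))"
    proof (intro AE_I2)
      fix \<omega>
      have "exp (R * \<bar>b \<omega>\<bar>) \<le> exp (R * b \<omega>) + exp (- R * b \<omega>)"
        by (cases "b \<omega> \<ge> 0") (auto simp: add_increasing add_increasing2)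
      from mult_left_mono[OF this norm_ge_zero[of "f \<omega>"]]
      show "norm (norm (f \<omega>) * exp (R * \<bar>b \<omega>\<bar>))
        \<le> norm (norm (f \<omega> * of_real (exp (R * b \<omega>))) + norm (f \<omega> * of_real (exp (- R * b \<omega>))))"
        by (simp add: norm_mult distrib_left)
    qed
  qed simp
  have term_le: "norm (?t z n \<omega>) = norm (f \<omega>) * ((norm z * \<bar>b \<omega>\<bar>) ^ n / fact n)" for z n \<omega>
    by (simp add: norm_mult norm_power norm_divide)
  have exp_sums: "(\<lambda>n. x ^ n / fact n) sums exp x" for x :: "'x::{real_normed_field,banach}"
    using exp_converges[of x] by (simp add: scaleR_conv_of_real divide_inverse mult.commute)
  have partial_le: "(\<Sum>i<n. x ^ i / fact i) \<le> exp x" if "x \<ge> 0" for x :: real and n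
  proof -
    have "(\<Sum>i<n. x ^ i / fact i) \<le> (\<Sum>i. x ^ i / fact i)"
      using that by (intro sum_le_suminf sums_summable[OF exp_sums]) auto
    then show ?thesis using sums_unique[OF exp_sums[of x]] by simp
  qed
  have int_t: "integrable M (?t z n)" for z n
  proof (rule Bochner_Integration.integrable_bound[OF dom[of "norm z"]])
    show "AE \<omega> in M. norm (?t z n \<omega>) \<le> norm (norm (f \<omega>) * exp (norm z * \<bar>b \<omega>\<bar>))"
    proof (intro AE_I2)
      fix \<omega>
      have "(norm z * \<bar>b \<omega>\<bar>) ^ n / fact n \<le> (\<Sum>i<Suc n. (norm z * \<bar>b \<omega>\<bar>) ^ i / fact i)"
        by (simp add: sum_nonneg)
      also have "\<dots> \<le> exp (norm z * \<bar>b \<omega>\<bar>)" by (rule partial_le) simp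
      finally have "(norm z * \<bar>b \<omega>\<bar>) ^ n / fact n \<le> exp (norm z * \<bar>b \<omega>\<bar>)" .
      from mult_left_mono[OF this norm_ge_zero[of "f \<omega>"]]
      show "norm (?t z n \<omega>) \<le> norm (norm (f \<omega>) * exp (norm z * \<bar>b \<omega>\<bar>))"
        unfolding term_le by (simp add: abs_mult)
    qed
  qed simp
  define A where "A n = (\<integral>\<omega>. f \<omega> * of_real (b \<omega>) ^ n / fact n \<partial>M)" for n
  \<comment> \<open>Integration term by term: the norms of the terms sum to at most the integrable
    function \<open>norm (f \<omega>) * exp (norm z * \<bar>b \<omega>\<bar>)\<close>.\<close>
  have series: "(\<lambda>n. A n * z ^ n) sums (\<integral>\<omega>. f \<omega> * exp (z * of_real (b \<omega>)) \<partial>M)" for z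
  proof -
    have "(\<lambda>n. \<integral>\<omega>. ?t z n \<omega> \<partial>M) sums (\<integral>\<omega>. (\<Sum>n. ?t z n \<omega>) \<partial>M)"
    proof (rule sums_integral[OF int_t])
      show "AE \<omega> in M. summable (\<lambda>n. norm (?t z n \<omega>))"
        unfolding term_le by (intro AE_I2 summable_mult sums_summable[OF exp_sums])
      show "summable (\<lambda>n. \<integral>\<omega>. norm (?t z n \<omega>) \<partial>M)"
      proof (rule summableI_nonneg_bounded)
        fix n
        have "(\<Sum>i<n. \<integral>\<omega>. norm (?t z i \<omega>) \<partial>M) = (\<integral>\<omega>. (\<Sum>i<n. norm (?t z i \<omega>)) \<partial>M)"
          by (rule Bochner_Integration.integral_sum[symmetric]) (intro integrable_norm int_t)
        also have "\<dots> \<le> (\<integral>\<omega>. norm (f \<omega>) * exp (norm z * \<bar>b \<omega>\<bar>) \<partial>M)"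
        proof (rule integral_mono[OF _ dom])
          show "integrable M (\<lambda>\<omega>. \<Sum>i<n. norm (?t z i \<omega>))"
            by (intro Bochner_Integration.integrable_sum integrable_norm int_t)
          show "(\<Sum>i<n. norm (?t z i \<omega>)) \<le> norm (f \<omega>) * exp (norm z * \<bar>b \<omega>\<bar>)" for \<omega>
            unfolding term_le sum_distrib_left[symmetric] by (intro mult_left_mono partial_le) auto
        qed
        finally show "(\<Sum>i<n. \<integral>\<omega>. norm (?t z i \<omega>) \<partial>M) \<le> (\<integral>\<omega>. norm (f \<omega>) * exp (norm z * \<bar>b \<omega>\<bar>) \<partial>M)" .
      qed simp
    qed
    moreover have "(\<Sum>n. ?t z n \<omega>) = f \<omega> * exp (z * of_real (b \<omega>))" for \<omega>
      using sums_mult[OF exp_sums[of "z * of_real (b \<omega>)"], of "f \<omega>"] by (simp add: sums_iff)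
    moreover have "(\<integral>\<omega>. ?t z n \<omega> \<partial>M) = A n * z ^ n" for n
    proof -
      have "(\<integral>\<omega>. ?t z n \<omega> \<partial>M) = (\<integral>\<omega>. (f \<omega> * of_real (b \<omega>) ^ n / fact n) * z ^ n \<partial>M)"
        by (intro Bochner_Integration.integral_cong refl) (simp add: power_mult_distrib)
      then show ?thesis by (simp only: A_def integral_mult_left_zero)
    qed
    ultimately show ?thesis by simp
  qed
  \<comment> \<open>On the real axis the series sums to \<open>c\<close>; uniqueness of real power
    series, applied to real and imaginary parts, leaves \<open>A 0 = c\<close> and no other
    coefficient.\<close>
  have zero: "A n = (if n = 0 then c else 0)" for n
  proof -
    have "(\<lambda>n. (A n - (if n = 0 then c else 0)) * complex_of_real x ^ n) sums 0" for x
    proof -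
      have "(\<lambda>n. A n * complex_of_real x ^ n) sums c"
        using series[of "of_real x"] const[of x] by (simp flip: of_real_mult exp_of_real)
      moreover have "(\<lambda>n. (if n = 0 then c else 0) * complex_of_real x ^ n) sums c"
        using sums_finite[of "{0}" "\<lambda>n. (if n = 0 then c else 0) * complex_of_real x ^ n"] by simp
      ultimately have "(\<lambda>n. A n * complex_of_real x ^ n - (if n = 0 then c else 0) * complex_of_real x ^ n) sums (c - c)"
        by (rule sums_diff)
      then show ?thesis by (simp add: left_diff_distrib)
    qed
    then have "(\<lambda>n. Re (A n - (if n = 0 then c else 0)) * x ^ n) sums 0"
      "(\<lambda>n. Im (A n - (if n = 0 then c else 0)) * x ^ n) sums 0" for x
      unfolding sums_complex_iff by (simp_all flip: of_real_power)
    then have "Re (A n - (if n = 0 then c else 0)) = 0" "Im (A n - (if n = 0 then c else 0)) = 0"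
      by (intro real_power_series_eq_zero; blast)+
    then show ?thesis by (simp add: complex_eq_iff)
  qed
  have "(\<lambda>n. A n * (\<i> * of_real x) ^ n) sums (A 0 * (\<i> * of_real x) ^ 0)"
    by (rule sums_finite[of "{0}", simplified]) (simp add: zero)
  with series[of "\<i> * of_real x"] have "(\<integral>\<omega>. f \<omega> * exp (\<i> * of_real x * of_real (b \<omega>)) \<partial>M) = A 0"
    by (simp add: sums_iff)
  then show ?thesis by (simp add: zero mult.assoc)
qed

section \<open>Gaussian measures\<close>

lemma has_bochner_integral_return_borel:
  fixes f :: "real \<Rightarrow> real"
  assumes "f \<in> borel_measurable borel"
  shows "has_bochner_integral (return borel x) f (f x)"
proof -
  have "(\<integral>\<^sup>+y. ennreal (norm (f y)) \<partial>return borel x) = ennreal (norm (f x))"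
    using assms by (intro nn_integral_return) auto
  then have "integrable (return borel x) f" using assms by (simp add: integrable_iff_bounded)
  moreover have "(\<integral>y. f y \<partial>return borel x) = f x" using assms by (intro integral_return) auto
  ultimately show ?thesis by (simp add: has_bochner_integral_iff)
qed

lemma normal_law_moments:
  assumes "\<sigma> \<ge> 0"
  shows "has_bochner_integral (normal_law \<mu> \<sigma>) (\<lambda>x. x) \<mu>"
    and "has_bochner_integral (normal_law \<mu> \<sigma>) (\<lambda>x. (x - \<mu>)\<^sup>2) (\<sigma>\<^sup>2)"
proof -
  have "has_bochner_integral lborel (\<lambda>x. normal_density \<mu> \<sigma> x *\<^sub>R x) \<mu>"
    "has_bochner_integral lborel (\<lambda>x. normal_density \<mu> \<sigma> x *\<^sub>R (x - \<mu>)\<^sup>2) (\<sigma>\<^sup>2)" if "\<sigma> > 0"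
    using that normal_moment_nz_1[of \<sigma> \<mu>] normal_moment_even[of \<sigma> \<mu> 1] by simp_all
  note density = this
  show "has_bochner_integral (normal_law \<mu> \<sigma>) (\<lambda>x. x) \<mu>"
  proof (cases "\<sigma> = 0")
    case True
    then show ?thesis
      unfolding normal_law_def using has_bochner_integral_return_borel[of "\<lambda>x. x" \<mu>] by simp
  next
    case False
    then show ?thesis
      unfolding normal_law_def if_not_P[OF False] using density(1) assms
      by (intro has_bochner_integral_density) auto
  qed
  show "has_bochner_integral (normal_law \<mu> \<sigma>) (\<lambda>x. (x - \<mu>)\<^sup>2) (\<sigma>\<^sup>2)"
  proof (cases "\<sigma> = 0")
    case True
    then show ?thesis
      unfolding normal_law_def using has_bochner_integral_return_borel[of "\<lambda>x. (x - \<mu>)\<^sup>2" \<mu>] by simp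
  next
    case False
    then show ?thesis
      unfolding normal_law_def if_not_P[OF False] using density(2) assms
      by (intro has_bochner_integral_density) auto
  qed
qed

lemma normal_law_char:
  assumes "\<sigma> \<ge> 0"
  shows "(CLINT x|normal_law \<mu> \<sigma>. iexp (t * x)) = exp (\<i> * (t * \<mu>) - (t * \<sigma>)\<^sup>2 / 2)"
proof (cases "\<sigma> = 0")
  case True
  then show ?thesis by (simp add: normal_law_def integral_return)
next
  case False
  then have s: "\<sigma> > 0" using assms by simp
  let ?N = "density lborel (\<lambda>x. ennreal (normal_density \<mu> \<sigma> x))"
  interpret N: prob_space ?N by (rule prob_space_normal_density[OF s])
  have "distributed ?N lborel (\<lambda>x. x) (\<lambda>x. ennreal (normal_density \<mu> \<sigma> x))"
    by (auto simp: distributed_def intro!: measure_eqI simp: emeasure_distr)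
  then have "distributed ?N lborel (\<lambda>x. (x - \<mu>) / \<sigma>) (\<lambda>x. ennreal (std_normal_density x))"
    using N.normal_standard_normal_convert[OF s, of "\<lambda>x. x" \<mu>] by simp
  then have D: "distr ?N lborel (\<lambda>x. (x - \<mu>) / \<sigma>) = std_normal_distribution"
    by (rule distributed_distr_eq_density)
  have "(CLINT x|?N. iexp (t * x)) = (CLINT x|?N. iexp (t * \<mu>) * iexp (t * \<sigma> * ((x - \<mu>) / \<sigma>)))"
  proof (intro Bochner_Integration.integral_cong refl)
    fix x
    have "t * x = t * \<mu> + t * \<sigma> * ((x - \<mu>) / \<sigma>)" using s by (simp add: field_simps)
    then show "iexp (t * x) = iexp (t * \<mu>) * iexp (t * \<sigma> * ((x - \<mu>) / \<sigma>))"
      by (simp only: of_real_add distrib_left exp_add)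
  qed
  also have "\<dots> = iexp (t * \<mu>) * (CLINT x|?N. iexp (t * \<sigma> * ((x - \<mu>) / \<sigma>)))" by simp
  also have "(CLINT x|?N. iexp (t * \<sigma> * ((x - \<mu>) / \<sigma>))) = char std_normal_distribution (t * \<sigma>)"
    unfolding char_def D[symmetric] by (subst integral_distr) auto
  also have "\<dots> = exp (- ((t * \<sigma>)\<^sup>2) / 2)"
    by (simp add: char_std_normal_distribution)
  finally show ?thesis using s
    by (simp add: normal_law_def exp_add[symmetric] exp_of_real[symmetric] algebra_simps)
qed

text \<open>Covariance as a form on functionals: the blocks for a pair of vectors are obtained by
  inserting \<open>(p, 0)\<close> and \<open>(0, q)\<close>, without block matrices.\<close>

definition functional_cov :: "'a::real_inner measure \<Rightarrow> 'a \<Rightarrow> 'a \<Rightarrow> real" where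
  "functional_cov N p q = (\<integral>x. (p \<bullet> x - (\<integral>z. p \<bullet> z \<partial>N)) * (q \<bullet> x - (\<integral>z. q \<bullet> z \<partial>N)) \<partial>N)"

lemma functional_cov_commute: "functional_cov N p q = functional_cov N q p"
  by (simp add: functional_cov_def mult.commute)

lemma functional_cov_nonneg: "0 \<le> functional_cov N p p"
  by (simp add: functional_cov_def)

locale gaussian =
  fixes N :: "'a::euclidean_space measure"
  assumes gaussian: "gaussian_measure N"
begin

sublocale prob_space N using gaussian by (simp add: gaussian_measure_def)

lemma sets_N[simp, measurable_cong]: "sets N = sets borel"
  using gaussian by (simp add: gaussian_measure_def)

lemma space_N[simp]: "space N = UNIV"
  using sets_eq_imp_space_eq[OF sets_N] by simp

lemma normal_projection:
  obtains \<mu> \<sigma> where "\<sigma> \<ge> 0" "distr N borel (\<lambda>x. p \<bullet> x) = normal_law \<mu> \<sigma>"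
  using gaussian unfolding gaussian_measure_def by metis

lemma integrable_inner: "integrable N (\<lambda>x. p \<bullet> x)"
proof -
  obtain \<mu> \<sigma> where n: "\<sigma> \<ge> 0" "distr N borel (\<lambda>x. p \<bullet> x) = normal_law \<mu> \<sigma>" by (rule normal_projection)
  have "integrable (distr N borel (\<lambda>x. p \<bullet> x)) (\<lambda>x. x)" using normal_law_moments[OF n(1)] n(2)
    by (simp add: has_bochner_integral_iff)
  then show ?thesis by (subst (asm) integrable_distr_eq) auto
qed

lemma integrable_inner_diff_sq: "integrable N (\<lambda>x. (p \<bullet> x - c)\<^sup>2)"
proof -
  obtain \<mu> \<sigma> where n: "\<sigma> \<ge> 0" "distr N borel (\<lambda>x. p \<bullet> x) = normal_law \<mu> \<sigma>" by (rule normal_projection)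
  have "integrable (distr N borel (\<lambda>x. p \<bullet> x)) (\<lambda>x. (x - \<mu>)\<^sup>2)" using normal_law_moments[OF n(1)] n(2)
    by (simp add: has_bochner_integral_iff)
  then have "integrable N (\<lambda>x. (p \<bullet> x - \<mu>)\<^sup>2)" by (subst (asm) integrable_distr_eq) auto
  then have "integrable N (\<lambda>x. (p \<bullet> x - \<mu>)\<^sup>2 + (2 * (\<mu> - c)) * (p \<bullet> x) + (c\<^sup>2 - \<mu>\<^sup>2))"
    using integrable_inner by auto
  then show ?thesis by (simp add: power2_eq_square algebra_simps)
qed

text \<open>Polarisation: a Gaussian measure is described by one linear functional at a time, so
  products are reached through squares of sums and differences.\<close>

lemma integrable_inner_mult: "integrable N (\<lambda>x. (p \<bullet> x - c) * (q \<bullet> x - d))"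
proof -
  have "integrable N (\<lambda>x. (((p + q) \<bullet> x - (c + d))\<^sup>2 - ((p - q) \<bullet> x - (c - d))\<^sup>2) / 4)"
    using integrable_inner_diff_sq by auto
  moreover have "(((p + q) \<bullet> x - (c + d))\<^sup>2 - ((p - q) \<bullet> x - (c - d))\<^sup>2) / 4 = (p \<bullet> x - c) * (q \<bullet> x - d)" for x
    by (simp add: power2_eq_square inner_add_left inner_diff_left field_simps)
  ultimately show ?thesis by simp
qed

lemma functional_cov_add_left: "functional_cov N (p + p') q = functional_cov N p q + functional_cov N p' q"
proof -
  have "(\<integral>z. (p + p') \<bullet> z \<partial>N) = (\<integral>z. p \<bullet> z \<partial>N) + (\<integral>z. p' \<bullet> z \<partial>N)"
    by (simp add: inner_add_left integrable_inner)
  note sum = this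
  have "functional_cov N (p + p') q = (\<integral>x. (p \<bullet> x - (\<integral>z. p \<bullet> z \<partial>N)) * (q \<bullet> x - (\<integral>z. q \<bullet> z \<partial>N)) +
    (p' \<bullet> x - (\<integral>z. p' \<bullet> z \<partial>N)) * (q \<bullet> x - (\<integral>z. q \<bullet> z \<partial>N)) \<partial>N)"
    unfolding functional_cov_def
    by (intro Bochner_Integration.integral_cong refl)
      (simp only: sum inner_add_left, simp add: algebra_simps)
  then show ?thesis using integrable_inner_mult by (simp add: functional_cov_def)
qed

lemma functional_cov_scale_left: "functional_cov N (c *\<^sub>R p) q = c * functional_cov N p q"
proof -
  have scale: "(\<integral>z. (c *\<^sub>R p) \<bullet> z \<partial>N) = c * (\<integral>z. p \<bullet> z \<partial>N)" by simp
  have "functional_cov N (c *\<^sub>R p) q = (\<integral>x. c * ((p \<bullet> x - (\<integral>z. p \<bullet> z \<partial>N)) * (q \<bullet> x - (\<integral>z. q \<bullet> z \<partial>N))) \<partial>N)"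
    unfolding functional_cov_def
    by (intro Bochner_Integration.integral_cong refl) (simp only: scale, simp add: algebra_simps)
  then show ?thesis by (simp add: functional_cov_def)
qed

lemma functional_cov_add_right: "functional_cov N q (p + p') = functional_cov N q p + functional_cov N q p'"
  by (simp add: functional_cov_commute[of N q] functional_cov_add_left)

lemma functional_cov_scale_right: "functional_cov N q (c *\<^sub>R p) = c * functional_cov N q p"
  by (simp add: functional_cov_commute[of N q] functional_cov_scale_left)

text \<open>The multivariate transform at \<open>p\<close> is that of the normal projection along
  \<open>p\<close>, taken at frequency 1.\<close>

lemma char_eq: "(CLINT x|N. iexp (p \<bullet> x)) = exp (\<i> * (\<integral>x. p \<bullet> x \<partial>N) - functional_cov N p p / 2)"
proof -
  obtain \<mu> \<sigma> where n: "\<sigma> \<ge> 0" "distr N borel (\<lambda>x. p \<bullet> x) = normal_law \<mu> \<sigma>" by (rule normal_projection)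
  have m: "(\<integral>x. p \<bullet> x \<partial>N) = \<mu>"
    using normal_law_moments(1)[OF n(1), of \<mu>, THEN has_bochner_integral_integral_eq, unfolded n(2)[symmetric]]
    by (subst (asm) integral_distr) auto
  have v: "functional_cov N p p = \<sigma>\<^sup>2"
    using normal_law_moments(2)[OF n(1), of \<mu>, THEN has_bochner_integral_integral_eq, unfolded n(2)[symmetric]]
    by (subst (asm) integral_distr) (auto simp: functional_cov_def m power2_eq_square)
  have "(CLINT x|N. iexp (p \<bullet> x)) = (CLINT x|normal_law \<mu> \<sigma>. iexp (1 * x))"
    unfolding n(2)[symmetric] by (subst integral_distr) auto
  then show ?thesis unfolding normal_law_char[OF n(1)] by (simp add: m v)
qed

end

section \<open>Independence and disintegration\<close>

text \<open>The dependence of the integrand on \<open>y\<close> is moved into the measure: the image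
  of \<open>K y\<close> under \<open>Pair y\<close> varies measurably, and the integrand becomes the
  fixed function \<open>f\<close>.\<close>

lemma kernel_integral_measurable:
  fixes f :: "'c \<times> 'a \<Rightarrow> 'b::{banach, second_countable_topology}"
  assumes K: "K \<in> A \<rightarrow>\<^sub>M prob_algebra B" and [measurable]: "f \<in> borel_measurable (A \<Otimes>\<^sub>M B)"
  shows "(\<lambda>y. \<integral>x. f (y, x) \<partial>K y) \<in> borel_measurable A"
proof -
  have [measurable]: "K \<in> A \<rightarrow>\<^sub>M subprob_algebra B" by (rule measurable_prob_algebraD[OF K])
  have "(\<lambda>y. \<integral>z. f z \<partial>distr (K y) (A \<Otimes>\<^sub>M B) (Pair y)) \<in> borel_measurable A"
  proof (rule measurable_compose[OF _ integral_measurable_subprob_algebra])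
    show "(\<lambda>y. distr (K y) (A \<Otimes>\<^sub>M B) (Pair y)) \<in> A \<rightarrow>\<^sub>M subprob_algebra (A \<Otimes>\<^sub>M B)"
      by (rule measurable_distr2[where M = B]) auto
  qed simp
  moreover have "(\<integral>z. f z \<partial>distr (K y) (A \<Otimes>\<^sub>M B) (Pair y)) = (\<integral>x. f (y, x) \<partial>K y)"
    if "y \<in> space A" for y
  proof (rule integral_distr)
    have "sets (K y) = sets B" by (rule sets_kernel[OF _ that]) measurable
    then show "Pair y \<in> K y \<rightarrow>\<^sub>M A \<Otimes>\<^sub>M B" using that by (simp cong: measurable_cong_sets)
  qed simp
  ultimately show ?thesis by (subst measurable_cong) auto
qed

lemma subalgebra_gen_sigma: "Y \<in> borel_measurable M \<Longrightarrow> subalgebra M (gen_sigma M Y)"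
  unfolding subalgebra_def gen_sigma_def by (auto simp: sets_vimage_algebra2)

lemma sets_gen_sigma: "sets (gen_sigma M Y) = {Y -` A \<inter> space M | A. A \<in> sets borel}"
  by (simp add: gen_sigma_def sets_vimage_algebra2)

lemma measurable_gen_sigma: "f \<in> borel_measurable borel \<Longrightarrow> (\<lambda>\<omega>. f (Y \<omega>)) \<in> borel_measurable (gen_sigma M Y)"
  unfolding gen_sigma_def by (rule measurable_compose[OF measurable_vimage_algebra1]) auto

section \<open>Disintegration along a regular conditional distribution\<close>

locale cond_law = prob_space M for M :: "'w measure" +
  fixes X :: "'w \<Rightarrow> 'a::euclidean_space" and Y :: "'w \<Rightarrow> 'c::euclidean_space"
    and K :: "'c \<Rightarrow> 'a measure"
  assumes X[measurable]: "X \<in> borel_measurable M" and Y[measurable]: "Y \<in> borel_measurable M"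
    and K: "regular_cond_distr M X Y K"
begin

lemma K_prob_algebra[measurable]: "K \<in> borel \<rightarrow>\<^sub>M prob_algebra borel"
  using K by (simp add: regular_cond_distr_def)

lemma K_subprob_algebra[measurable]: "K \<in> borel \<rightarrow>\<^sub>M subprob_algebra borel"
  by (rule measurable_prob_algebraD) simp

lemma sets_K[simp, measurable_cong]: "sets (K y) = sets borel"
  by (rule sets_kernel[OF K_subprob_algebra]) simp

lemma space_K[simp]: "space (K y) = UNIV"
  using sets_eq_imp_space_eq[OF sets_K] by simp

lemma prob_space_K: "prob_space (K y)"
  using measurable_space[OF K_prob_algebra, of y] by (simp add: space_prob_algebra)

sublocale gen: sigma_finite_subalgebra M "gen_sigma M Y"
  by (intro finite_measure_subalgebra_is_sigma_finite[of M "gen_sigma M Y"]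
      finite_measure_subalgebra.intro finite_measure_axioms finite_measure_subalgebra_axioms.intro subalgebra_gen_sigma Y)

text \<open>The defining identity of the kernel, valid almost everywhere for fixed \<open>A\<close>,
  is integrated against the \<open>Y\<close>-measurable factor
  \<open>indicator C (Y \<omega>)\<close>.\<close>

lemma emeasure_K_rectangle:
  assumes [measurable]: "C \<in> sets borel" "A \<in> sets borel"
  shows "emeasure M {\<omega>\<in>space M. Y \<omega> \<in> C \<and> X \<omega> \<in> A} =
    (\<integral>\<^sup>+\<omega>. indicator C (Y \<omega>) * emeasure (K (Y \<omega>)) A \<partial>M)"
proof -
  have "AE \<omega> in M. cond_exp M Y (\<lambda>\<omega>. indicator A (X \<omega>)) \<omega> = measure (K (Y \<omega>)) A"
    using K by (simp add: regular_cond_distr_def)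
  note ae = this[unfolded cond_exp_def]
  have [measurable]: "(\<lambda>\<omega>. measure (K (Y \<omega>)) A) \<in> borel_measurable M"
    by (rule measurable_compose[OF Y], rule measure_measurable_prob_algebra2[where N=borel]) auto
  have iA: "integrable M (\<lambda>\<omega>. indicator C (Y \<omega>) * indicator A (X \<omega>) :: real)"
    by (rule integrable_const_bound[where B=1]) (auto simp: indicator_def)
  have iK: "integrable M (\<lambda>\<omega>. indicator C (Y \<omega>) * measure (K (Y \<omega>)) A :: real)"
    using prob_space.prob_le_1[OF prob_space_K]
    by (intro integrable_const_bound[where B=1]) (auto simp: indicator_def)
  have "measure M {\<omega>\<in>space M. Y \<omega> \<in> C \<and> X \<omega> \<in> A} = (\<integral>\<omega>. indicator {\<omega>\<in>space M. Y \<omega> \<in> C \<and> X \<omega> \<in> A} \<omega> \<partial>M)"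
    by simp
  also have "\<dots> = (\<integral>\<omega>. indicator C (Y \<omega>) * indicator A (X \<omega>) \<partial>M)"
    by (intro Bochner_Integration.integral_cong) (auto simp: indicator_def)
  also have "\<dots> = (\<integral>\<omega>. indicator C (Y \<omega>) * real_cond_exp M (gen_sigma M Y) (\<lambda>\<omega>. indicator A (X \<omega>)) \<omega> \<partial>M)"
    by (rule gen.real_cond_exp_intg(2)[symmetric, OF iA]) (auto intro!: measurable_gen_sigma)
  also have "\<dots> = (\<integral>\<omega>. indicator C (Y \<omega>) * measure (K (Y \<omega>)) A \<partial>M)"
    using ae by (intro integral_cong_AE) auto
  finally have "emeasure M {\<omega>\<in>space M. Y \<omega> \<in> C \<and> X \<omega> \<in> A} = ennreal (\<integral>\<omega>. indicator C (Y \<omega>) * measure (K (Y \<omega>)) A \<partial>M)"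
    by (simp add: emeasure_eq_measure)
  also have "\<dots> = (\<integral>\<^sup>+\<omega>. ennreal (indicator C (Y \<omega>) * measure (K (Y \<omega>)) A) \<partial>M)"
    by (rule nn_integral_eq_integral[symmetric, OF iK]) auto
  also have "\<dots> = (\<integral>\<^sup>+\<omega>. indicator C (Y \<omega>) * emeasure (K (Y \<omega>)) A \<partial>M)"
    by (intro nn_integral_cong)
      (auto simp: indicator_def finite_measure.emeasure_eq_measure[OF prob_space.finite_measure[OF prob_space_K]])
  finally show ?thesis .
qed

lemma kernel_measurable: "(\<lambda>\<omega>. distr (K (Y \<omega>)) (borel \<Otimes>\<^sub>M borel) (Pair (Y \<omega>))) \<in> M \<rightarrow>\<^sub>M subprob_algebra (borel \<Otimes>\<^sub>M borel)"
  by (rule measurable_distr2) (auto intro: measurable_compose[OF Y K_subprob_algebra])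

text \<open>Rectangles are intersection-stable and generate the product sigma-algebra, so the
  rectangle formula determines the joint law as a mixture of fibre laws.\<close>

lemma distr_eq_bind:
  "distr M (borel \<Otimes>\<^sub>M borel) (\<lambda>\<omega>. (Y \<omega>, X \<omega>)) =
    M \<bind> (\<lambda>\<omega>. distr (K (Y \<omega>)) (borel \<Otimes>\<^sub>M borel) (Pair (Y \<omega>)))" (is "?L = ?R")
proof (rule measure_eqI_generator_eq[where \<Omega> = UNIV and E = "{C \<times> A | C A. C \<in> sets borel \<and> A \<in> sets borel}"
      and A = "\<lambda>_. UNIV"])
  show "Int_stable {C \<times> A | C A. C \<in> sets borel \<and> A \<in> sets (borel :: 'a measure)}"
    using Int_stable_pair_measure_generator by auto
  have sR: "sets ?R = sets (borel \<Otimes>\<^sub>M borel)"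
    by (rule sets_bind[OF sets_kernel[OF kernel_measurable] not_empty])
  show "sets ?L = sigma_sets UNIV {C \<times> A | C A. C \<in> sets borel \<and> A \<in> sets borel}"
    "sets ?R = sigma_sets UNIV {C \<times> A | C A. C \<in> sets borel \<and> A \<in> sets borel}"
    by (simp_all add: sR sets_pair_measure)
  show "emeasure ?L Z = emeasure ?R Z" if "Z \<in> {C \<times> A | C A. C \<in> sets borel \<and> A \<in> sets borel}" for Z
  proof -
    from that obtain C A where Z: "Z = C \<times> A" and [measurable]: "C \<in> sets borel" "A \<in> sets borel" by auto
    have "emeasure ?R Z = (\<integral>\<^sup>+\<omega>. emeasure (distr (K (Y \<omega>)) (borel \<Otimes>\<^sub>M borel) (Pair (Y \<omega>))) Z \<partial>M)"
      by (rule emeasure_bind[OF not_empty kernel_measurable]) (simp add: Z)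
    also have "\<dots> = (\<integral>\<^sup>+\<omega>. indicator C (Y \<omega>) * emeasure (K (Y \<omega>)) A \<partial>M)"
      by (intro nn_integral_cong) (auto simp: Z emeasure_distr indicator_def vimage_def)
    also have "\<dots> = emeasure ?L Z"
      unfolding emeasure_K_rectangle[symmetric, OF \<open>C \<in> sets borel\<close> \<open>A \<in> sets borel\<close>]
      by (subst emeasure_distr) (auto simp: Z intro!: arg_cong[where f="emeasure M"])
    finally show ?thesis by simp
  qed
  show "emeasure ?L UNIV \<noteq> \<infinity>" 
    unfolding infinity_ennreal_def by (rule finite_measure.emeasure_finite[OF finite_measure_distr]) simp
qed (auto intro!: exI[of _ UNIV])

theorem nn_integral_disintegration:
  assumes [measurable]: "f \<in> borel_measurable (borel \<Otimes>\<^sub>M borel)"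
  shows "(\<integral>\<^sup>+\<omega>. f (Y \<omega>, X \<omega>) \<partial>M) = (\<integral>\<^sup>+\<omega>. (\<integral>\<^sup>+x. f (Y \<omega>, x) \<partial>K (Y \<omega>)) \<partial>M)"
proof -
  have "(\<integral>\<^sup>+\<omega>. f (Y \<omega>, X \<omega>) \<partial>M) = (\<integral>\<^sup>+z. f z \<partial>distr M (borel \<Otimes>\<^sub>M borel) (\<lambda>\<omega>. (Y \<omega>, X \<omega>)))"
    by (simp add: nn_integral_distr)
  also have "\<dots> = (\<integral>\<^sup>+\<omega>. (\<integral>\<^sup>+z. f z \<partial>distr (K (Y \<omega>)) (borel \<Otimes>\<^sub>M borel) (Pair (Y \<omega>))) \<partial>M)"
    unfolding distr_eq_bind by (rule nn_integral_bind[OF _ kernel_measurable]) simp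
  finally show ?thesis by (simp add: nn_integral_distr)
qed

lemma kernel_nn_integral_measurable[measurable]:
  assumes "f \<in> borel_measurable (borel \<Otimes>\<^sub>M borel)"
  shows "(\<lambda>y. \<integral>\<^sup>+x. f (y, x) \<partial>K y) \<in> borel_measurable borel"
  using nn_integral_measurable_subprob_algebra2[of "\<lambda>y x. f (y, x)" borel borel K] assms by simp

lemma kernel_integral_borel[measurable]:
  fixes f :: "'c \<times> 'a \<Rightarrow> 'b::{banach, second_countable_topology}"
  assumes "f \<in> borel_measurable (borel \<Otimes>\<^sub>M borel)"
  shows "(\<lambda>y. \<integral>x. f (y, x) \<partial>K y) \<in> borel_measurable borel"
  by (rule kernel_integral_measurable[OF K_prob_algebra assms])

theorem integral_disintegration:
  fixes f :: "'c \<times> 'a \<Rightarrow> real"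
  assumes f[measurable]: "f \<in> borel_measurable (borel \<Otimes>\<^sub>M borel)" and int: "integrable M (\<lambda>\<omega>. f (Y \<omega>, X \<omega>))"
  shows "AE \<omega> in M. integrable (K (Y \<omega>)) (\<lambda>x. f (Y \<omega>, x))"
    and "integrable M (\<lambda>\<omega>. \<integral>x. f (Y \<omega>, x) \<partial>K (Y \<omega>))"
    and "(\<integral>\<omega>. f (Y \<omega>, X \<omega>) \<partial>M) = (\<integral>\<omega>. (\<integral>x. f (Y \<omega>, x) \<partial>K (Y \<omega>)) \<partial>M)"
proof -
  have m: "(\<lambda>x. g (y, x)) \<in> borel_measurable (K y)" if "g \<in> borel_measurable (borel \<Otimes>\<^sub>M borel)" for g y
    using that by (simp cong: measurable_cong_sets)
  define a where "a y = (\<integral>\<^sup>+x. ennreal (norm (f (y, x))) \<partial>K y)" for y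
  have [measurable]: "a \<in> borel_measurable borel"
    unfolding a_def by (rule kernel_nn_integral_measurable[of "\<lambda>z. ennreal (norm (f z))"]) simp
  have afin: "(\<integral>\<^sup>+\<omega>. a (Y \<omega>) \<partial>M) < \<infinity>"
    using int unfolding a_def integrable_iff_bounded
    by (subst nn_integral_disintegration[symmetric, of "\<lambda>z. ennreal (norm (f z))"]) auto
  then have aae: "AE \<omega> in M. a (Y \<omega>) \<noteq> \<infinity>" by (intro nn_integral_PInf_AE) auto
  then show ae: "AE \<omega> in M. integrable (K (Y \<omega>)) (\<lambda>x. f (Y \<omega>, x))"
    by eventually_elim (auto simp: integrable_iff_bounded a_def less_top m)
  have [measurable]: "(\<lambda>y. \<integral>x. f (y, x) \<partial>K y) \<in> borel_measurable borel" by measurable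
  have "ennreal (norm (\<integral>x. f (y, x) \<partial>K y)) \<le> a y" for y
  \<comment> \<open>In a fibre where \<open>f\<close> is not integrable the Bochner integral is 0 by
    convention, so the bound holds for every \<open>y\<close>.\<close>
  proof (cases "integrable (K y) (\<lambda>x. f (y, x))")
    case True then show ?thesis unfolding a_def by (rule integral_norm_bound_ennreal)
  qed (simp add: not_integrable_integral_eq)
  then have "(\<integral>\<^sup>+\<omega>. ennreal (norm (\<integral>x. f (Y \<omega>, x) \<partial>K (Y \<omega>))) \<partial>M) \<le> (\<integral>\<^sup>+\<omega>. a (Y \<omega>) \<partial>M)"
    by (intro nn_integral_mono)
  with afin show "integrable M (\<lambda>\<omega>. \<integral>x. f (Y \<omega>, x) \<partial>K (Y \<omega>))"
    by (intro integrableI_bounded) auto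
  \<comment> \<open>The function \<open>h\<close> stands for the positive or the negative part; both
    are reached through the disintegration of nonnegative integrals.\<close>
  have part: "(\<integral>\<omega>. h (f (Y \<omega>, X \<omega>)) \<partial>M) = (\<integral>\<omega>. (\<integral>x. h (f (Y \<omega>, x)) \<partial>K (Y \<omega>)) \<partial>M) \<and>
      integrable M (\<lambda>\<omega>. \<integral>x. h (f (Y \<omega>, x)) \<partial>K (Y \<omega>))"
    if h[measurable]: "h \<in> borel_measurable borel" and h0: "\<And>r. 0 \<le> h r" and hle: "\<And>r. h r \<le> \<bar>r\<bar>" for h :: "real \<Rightarrow> real"
  proof -
    have i: "AE \<omega> in M. integrable (K (Y \<omega>)) (\<lambda>x. h (f (Y \<omega>, x)))"
      using ae
    proof eventually_elim
      case (elim \<omega>)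
      then show ?case
        by (rule Bochner_Integration.integrable_bound) (use h0 hle in \<open>auto intro!: m[of "\<lambda>z. h (f z)"]\<close>)
    qed
    have ih: "integrable M (\<lambda>\<omega>. h (f (Y \<omega>, X \<omega>)))"
      using int by (rule Bochner_Integration.integrable_bound) (use h0 hle in auto)
    have "ennreal (\<integral>\<omega>. h (f (Y \<omega>, X \<omega>)) \<partial>M) = (\<integral>\<^sup>+\<omega>. (\<integral>\<^sup>+x. ennreal (h (f (Y \<omega>, x))) \<partial>K (Y \<omega>)) \<partial>M)"
      using nn_integral_disintegration[of "\<lambda>z. ennreal (h (f z))"] nn_integral_eq_integral[OF ih] h0 by simp
    also have "\<dots> = (\<integral>\<^sup>+\<omega>. ennreal (\<integral>x. h (f (Y \<omega>, x)) \<partial>K (Y \<omega>)) \<partial>M)"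
      using i by (intro nn_integral_cong_AE, eventually_elim) (auto intro!: nn_integral_eq_integral h0)
    finally have e: "(\<integral>\<^sup>+\<omega>. ennreal (\<integral>x. h (f (Y \<omega>, x)) \<partial>K (Y \<omega>)) \<partial>M) = ennreal (\<integral>\<omega>. h (f (Y \<omega>, X \<omega>)) \<partial>M)" ..
    have [measurable]: "(\<lambda>y. \<integral>x. h (f (y, x)) \<partial>K y) \<in> borel_measurable borel"
      by (rule kernel_integral_borel[of "\<lambda>z. h (f z)"]) simp
    have "has_bochner_integral M (\<lambda>\<omega>. \<integral>x. h (f (Y \<omega>, x)) \<partial>K (Y \<omega>)) (\<integral>\<omega>. h (f (Y \<omega>, X \<omega>)) \<partial>M)"
      by (rule has_bochner_integral_nn_integral[OF _ _ _ e]) (auto intro!: AE_I2 Bochner_Integration.integral_nonneg h0)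
    then show ?thesis by (simp add: has_bochner_integral_iff)
  qed
  note p = part[of "\<lambda>r. max 0 r"] and n = part[of "\<lambda>r. max 0 (- r)"]
  have max: "r = max 0 r - max 0 (- r)" for r :: real by simp
  have "(\<integral>\<omega>. f (Y \<omega>, X \<omega>) \<partial>M) = (\<integral>\<omega>. max 0 (f (Y \<omega>, X \<omega>)) \<partial>M) - (\<integral>\<omega>. max 0 (- f (Y \<omega>, X \<omega>)) \<partial>M)"
    using int by (subst Bochner_Integration.integral_diff[symmetric]) (auto simp flip: max)
  also have "\<dots> = (\<integral>\<omega>. (\<integral>x. max 0 (f (Y \<omega>, x)) \<partial>K (Y \<omega>)) - (\<integral>x. max 0 (- f (Y \<omega>, x)) \<partial>K (Y \<omega>)) \<partial>M)"
    using p n by (subst Bochner_Integration.integral_diff) auto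
  also have "\<dots> = (\<integral>\<omega>. (\<integral>x. f (Y \<omega>, x) \<partial>K (Y \<omega>)) \<partial>M)"
  proof (rule integral_cong_AE)
    show "AE \<omega> in M. (\<integral>x. max 0 (f (Y \<omega>, x)) \<partial>K (Y \<omega>)) - (\<integral>x. max 0 (- f (Y \<omega>, x)) \<partial>K (Y \<omega>)) =
      (\<integral>x. f (Y \<omega>, x) \<partial>K (Y \<omega>))"
      using ae by eventually_elim (subst Bochner_Integration.integral_diff[symmetric], auto simp flip: max)
  qed (use p n in auto)
  finally show "(\<integral>\<omega>. f (Y \<omega>, X \<omega>) \<partial>M) = (\<integral>\<omega>. (\<integral>x. f (Y \<omega>, x) \<partial>K (Y \<omega>)) \<partial>M)" .
qed

text \<open>The sets of the generated sigma-algebra are the events \<open>Y \<in> C\<close>, and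
  restriction to such an event commutes with integration over the fibre.\<close>

theorem cond_exp_eq_kernel_integral:
  fixes f :: "'c \<times> 'a \<Rightarrow> real"
  assumes f[measurable]: "f \<in> borel_measurable (borel \<Otimes>\<^sub>M borel)" and int: "integrable M (\<lambda>\<omega>. f (Y \<omega>, X \<omega>))"
  shows "AE \<omega> in M. cond_exp M Y (\<lambda>\<omega>. f (Y \<omega>, X \<omega>)) \<omega> = (\<integral>x. f (Y \<omega>, x) \<partial>K (Y \<omega>))"
  unfolding cond_exp_def
proof (rule gen.real_cond_exp_charact)
  fix A assume "A \<in> sets (gen_sigma M Y)"
  then obtain C where A: "A = Y -` C \<inter> space M" and [measurable]: "C \<in> sets borel"
    by (auto simp: sets_gen_sigma)
  have "integrable M (\<lambda>\<omega>. indicator C (Y \<omega>) *\<^sub>R f (Y \<omega>, X \<omega>))"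
    by (intro Bochner_Integration.integrable_bound[OF int]) (auto simp: indicator_def)
  then have "(\<integral>\<omega>. indicator C (Y \<omega>) * f (Y \<omega>, X \<omega>) \<partial>M) =
      (\<integral>\<omega>. (\<integral>x. indicator C (Y \<omega>) * f (Y \<omega>, x) \<partial>K (Y \<omega>)) \<partial>M)"
    using integral_disintegration(3)[of "\<lambda>z. indicator C (fst z) * f z"] by simp
  also have "\<dots> = (\<integral>\<omega>. indicator C (Y \<omega>) * (\<integral>x. f (Y \<omega>, x) \<partial>K (Y \<omega>)) \<partial>M)" by simp
  finally have "(\<integral>\<omega>. indicator C (Y \<omega>) * f (Y \<omega>, X \<omega>) \<partial>M) = \<dots>" .
  moreover have "(\<integral>\<omega>\<in>A. g \<omega> \<partial>M) = (\<integral>\<omega>. indicator C (Y \<omega>) * g \<omega> \<partial>M)" for g :: "'w \<Rightarrow> real"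
    unfolding set_lebesgue_integral_def A
    by (intro Bochner_Integration.integral_cong) (auto simp: indicator_def)
  ultimately show "(\<integral>\<omega>\<in>A. f (Y \<omega>, X \<omega>) \<partial>M) = (\<integral>\<omega>\<in>A. (\<integral>x. f (Y \<omega>, x) \<partial>K (Y \<omega>)) \<partial>M)" by simp
next
  show "(\<lambda>\<omega>. \<integral>x. f (Y \<omega>, x) \<partial>K (Y \<omega>)) \<in> borel_measurable (gen_sigma M Y)"
    by (rule measurable_gen_sigma) measurable
qed (use int integral_disintegration(2)[OF f int] in auto)

end

section \<open>Product integrals and independence of random vectors\<close>

lemma integral_pair_measure_mult:
  fixes f :: "'a \<Rightarrow> 'c::{real_normed_field, banach, second_countable_topology}" and g :: "'b \<Rightarrow> 'c"
  assumes "prob_space M" "prob_space N" and f[measurable]: "integrable M f" and g[measurable]: "integrable N g"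
  shows "integrable (M \<Otimes>\<^sub>M N) (\<lambda>z. f (fst z) * g (snd z))"
    and "(\<integral>z. f (fst z) * g (snd z) \<partial>(M \<Otimes>\<^sub>M N)) = (\<integral>x. f x \<partial>M) * (\<integral>y. g y \<partial>N)"
proof -
  interpret M: prob_space M by fact
  interpret N: prob_space N by fact
  interpret pair_sigma_finite M N ..
  show i: "integrable (M \<Otimes>\<^sub>M N) (\<lambda>z. f (fst z) * g (snd z))"
    using f g by (intro Fubini_integrable) (auto simp: norm_mult)
  show "(\<integral>z. f (fst z) * g (snd z) \<partial>(M \<Otimes>\<^sub>M N)) = (\<integral>x. f x \<partial>M) * (\<integral>y. g y \<partial>N)"
    using i by (subst integral_fst'[symmetric]) auto
qed

lemma indep_rv_iff_prob:
  assumes "prob_space M" and X: "X \<in> borel_measurable M" and Y: "Y \<in> borel_measurable M"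
  shows "indep_rv M X Y \<longleftrightarrow> (\<forall>A\<in>sets borel. \<forall>B\<in>sets borel.
    measure M {\<omega>\<in>space M. X \<omega> \<in> A \<and> Y \<omega> \<in> B} =
    measure M {\<omega>\<in>space M. X \<omega> \<in> A} * measure M {\<omega>\<in>space M. Y \<omega> \<in> B})"
proof -
  interpret prob_space M by fact
  let ?X = "\<lambda>A. X -` A \<inter> space M" and ?Y = "\<lambda>A. Y -` A \<inter> space M"
  have ev: "{?X A |A. A \<in> sets borel} \<subseteq> events" "{?Y A |A. A \<in> sets borel} \<subseteq> events"
    using measurable_sets[OF X] measurable_sets[OF Y] by blast+
  have eq: "{\<omega>\<in>space M. X \<omega> \<in> A \<and> Y \<omega> \<in> B} = ?X A \<inter> ?Y B"
    "{\<omega>\<in>space M. X \<omega> \<in> A} = ?X A" "{\<omega>\<in>space M. Y \<omega> \<in> B} = ?Y B" for A B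
    by blast+
  show ?thesis
    unfolding indep_rv_def indep_sets2_eq sets_gen_sigma eq using ev by blast
qed

lemma indep_rv_distr_pair:
  fixes X :: "'w \<Rightarrow> 'a::euclidean_space" and Y :: "'w \<Rightarrow> 'c::euclidean_space"
  assumes M: "prob_space M" and X[measurable]: "X \<in> borel_measurable M" and Y[measurable]: "Y \<in> borel_measurable M"
    and ind: "indep_rv M X Y"
  shows "distr M (borel \<Otimes>\<^sub>M borel) (\<lambda>\<omega>. (X \<omega>, Y \<omega>)) = distr M borel X \<Otimes>\<^sub>M distr M borel Y"
proof -
  interpret prob_space M by fact
  interpret DX: prob_space "distr M borel X" by (rule prob_space_distr) simp
  interpret DY: prob_space "distr M borel Y" by (rule prob_space_distr) simp
  interpret pair_sigma_finite "distr M borel X" "distr M borel Y" ..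
  show ?thesis
  proof (rule sym, rule pair_measure_eqI)
    fix A B assume "A \<in> sets (distr M borel X)" "B \<in> sets (distr M borel Y)"
    then have [measurable]: "A \<in> sets borel" "B \<in> sets borel" by auto
    have "emeasure (distr M borel X) A = measure M {\<omega>\<in>space M. X \<omega> \<in> A}"
      "emeasure (distr M borel Y) B = measure M {\<omega>\<in>space M. Y \<omega> \<in> B}"
      "emeasure (distr M (borel \<Otimes>\<^sub>M borel) (\<lambda>\<omega>. (X \<omega>, Y \<omega>))) (A \<times> B) =
        measure M {\<omega>\<in>space M. X \<omega> \<in> A \<and> Y \<omega> \<in> B}"
      by (simp_all add: emeasure_distr emeasure_eq_measure vimage_def Int_def conj_commute)
    then show "emeasure (distr M borel X) A * emeasure (distr M borel Y) B =
      emeasure (distr M (borel \<Otimes>\<^sub>M borel) (\<lambda>\<omega>. (X \<omega>, Y \<omega>))) (A \<times> B)"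
      using ind by (simp add: indep_rv_iff_prob[OF M X Y] ennreal_mult)
  qed (auto intro: DX.sigma_finite_measure_axioms DY.sigma_finite_measure_axioms)
qed

text \<open>\<open>Y\<close> is frozen while \<open>X\<close> is averaged as an independent copy.
  Nonnegative integrands are the right setting because, for the quadratic form it is applied to,
  integrability is a conclusion.\<close>

lemma indep_rv_nn_integral:
  fixes X :: "'w \<Rightarrow> 'a::euclidean_space" and Y :: "'w \<Rightarrow> 'c::euclidean_space"
  assumes M: "prob_space M" and X[measurable]: "X \<in> borel_measurable M" and Y[measurable]: "Y \<in> borel_measurable M"
    and ind: "indep_rv M X Y" and [measurable]: "f \<in> borel_measurable (borel \<Otimes>\<^sub>M borel)"
  shows "(\<integral>\<^sup>+\<omega>. f (X \<omega>, Y \<omega>) \<partial>M) = (\<integral>\<^sup>+\<omega>. (\<integral>\<^sup>+\<omega>'. f (X \<omega>', Y \<omega>) \<partial>M) \<partial>M)"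
proof -
  interpret prob_space M by fact
  interpret DX: prob_space "distr M borel X" by (rule prob_space_distr) simp
  interpret DY: prob_space "distr M borel Y" by (rule prob_space_distr) simp
  interpret pair_sigma_finite "distr M borel X" "distr M borel Y" ..
  have "(\<integral>\<^sup>+\<omega>. f (X \<omega>, Y \<omega>) \<partial>M) = (\<integral>\<^sup>+z. f z \<partial>distr M (borel \<Otimes>\<^sub>M borel) (\<lambda>\<omega>. (X \<omega>, Y \<omega>)))"
    by (subst nn_integral_distr) auto
  also have "\<dots> = (\<integral>\<^sup>+y. (\<integral>\<^sup>+x. f (x, y) \<partial>distr M borel X) \<partial>distr M borel Y)"
    unfolding indep_rv_distr_pair[OF M X Y ind] by (subst nn_integral_snd) auto
  also have "\<dots> = (\<integral>\<^sup>+\<omega>. (\<integral>\<^sup>+\<omega>'. f (X \<omega>', Y \<omega>) \<partial>M) \<partial>M)"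
    by (simp add: nn_integral_distr)
  finally show ?thesis .
qed

lemma indep_rv_integral_mult:
  fixes X :: "'w \<Rightarrow> 'a::euclidean_space" and Y :: "'w \<Rightarrow> 'c::euclidean_space"
    and f :: "'a \<Rightarrow> 'b::{real_normed_field, banach, second_countable_topology}"
  assumes M: "prob_space M" and X[measurable]: "X \<in> borel_measurable M" and Y[measurable]: "Y \<in> borel_measurable M"
    and ind: "indep_rv M X Y"
    and f[measurable]: "f \<in> borel_measurable borel" "integrable M (\<lambda>\<omega>. f (X \<omega>))"
    and g[measurable]: "g \<in> borel_measurable borel" "integrable M (\<lambda>\<omega>. g (Y \<omega>))"
  shows "integrable M (\<lambda>\<omega>. f (X \<omega>) * g (Y \<omega>))"
    and "(\<integral>\<omega>. f (X \<omega>) * g (Y \<omega>) \<partial>M) = (\<integral>\<omega>. f (X \<omega>) \<partial>M) * (\<integral>\<omega>. g (Y \<omega>) \<partial>M)"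
proof -
  interpret prob_space M by fact
  interpret DX: prob_space "distr M borel X" by (rule prob_space_distr) simp
  interpret DY: prob_space "distr M borel Y" by (rule prob_space_distr) simp
  note D = indep_rv_distr_pair[OF M X Y ind]
  have iif: "integrable (distr M borel X) f" and ig: "integrable (distr M borel Y) g"
    using f g by (simp_all add: integrable_distr_eq)
  note mult = integral_pair_measure_mult[OF DX.prob_space_axioms DY.prob_space_axioms iif ig]
  have "integrable (distr M (borel \<Otimes>\<^sub>M borel) (\<lambda>\<omega>. (X \<omega>, Y \<omega>))) (\<lambda>z. f (fst z) * g (snd z))"
    unfolding D by (rule mult(1))
  then show "integrable M (\<lambda>\<omega>. f (X \<omega>) * g (Y \<omega>))"
    by (subst (asm) integrable_distr_eq) auto
  have "(\<integral>\<omega>. f (X \<omega>) * g (Y \<omega>) \<partial>M) =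
    (\<integral>z. f (fst z) * g (snd z) \<partial>distr M (borel \<Otimes>\<^sub>M borel) (\<lambda>\<omega>. (X \<omega>, Y \<omega>)))"
    by (subst integral_distr) auto
  also have "\<dots> = (\<integral>\<omega>. f (X \<omega>) \<partial>M) * (\<integral>\<omega>. g (Y \<omega>) \<partial>M)"
    unfolding D mult(2) by (simp add: integral_distr)
  finally show "(\<integral>\<omega>. f (X \<omega>) * g (Y \<omega>) \<partial>M) = (\<integral>\<omega>. f (X \<omega>) \<partial>M) * (\<integral>\<omega>. g (Y \<omega>) \<partial>M)" .
qed

lemma borel_measurable_fst_snd:
  fixes f :: "'w \<Rightarrow> 'a::second_countable_topology \<times> 'b::second_countable_topology"
  assumes "f \<in> borel_measurable M"
  shows "(\<lambda>x. fst (f x)) \<in> borel_measurable M" "(\<lambda>x. snd (f x)) \<in> borel_measurable M"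
  using assms unfolding borel_prod[symmetric] by auto

section \<open>Means and covariances of Gaussian measures on product spaces\<close>

definition mean_vec :: "'a::euclidean_space measure \<Rightarrow> 'a" where
  "mean_vec N = (\<Sum>b\<in>Basis. (\<integral>x. b \<bullet> x \<partial>N) *\<^sub>R b)"

definition cov_fst :: "((real^'n) \<times> 'b::real_inner) measure \<Rightarrow> real^'n^'n" where
  "cov_fst N = (\<chi> i j. functional_cov N (axis i 1, 0) (axis j 1, 0))"

context gaussian
begin

lemma inner_mean_vec: "p \<bullet> mean_vec N = (\<integral>x. p \<bullet> x \<partial>N)"
proof -
  have "p \<bullet> mean_vec N = (\<Sum>b\<in>Basis. (\<integral>x. (p \<bullet> b) * (b \<bullet> x) \<partial>N))"
    by (simp add: mean_vec_def inner_sum_right mult.commute)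
  also have "\<dots> = (\<integral>x. (\<Sum>b\<in>Basis. (p \<bullet> b) * (b \<bullet> x)) \<partial>N)"
    by (rule Bochner_Integration.integral_sum[symmetric]) (simp add: integrable_inner)
  also have "\<dots> = (\<integral>x. p \<bullet> x \<partial>N)"
    by (intro Bochner_Integration.integral_cong refl) (metis (no_types, lifting) euclidean_inner inner_commute sum.cong)
  finally show ?thesis .
qed

lemma functional_cov_mean_vec:
  "functional_cov N p q = (\<integral>x. (p \<bullet> (x - mean_vec N)) * (q \<bullet> (x - mean_vec N)) \<partial>N)"
  by (simp add: functional_cov_def inner_diff_right inner_mean_vec)

lemma integrable_centered_mult: "integrable N (\<lambda>x. (p \<bullet> (x - mean_vec N)) * (q \<bullet> (x - mean_vec N)))"
  using integrable_inner_mult by (simp add: inner_diff_right)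

lemma integrable_centered: "integrable N (\<lambda>x. p \<bullet> (x - mean_vec N))"
  by (simp add: inner_diff_right integrable_inner)

lemma integral_centered: "(\<integral>x. p \<bullet> (x - mean_vec N) \<partial>N) = 0"
  using prob_space[unfolded space_N] by (simp add: inner_diff_right integrable_inner inner_mean_vec)

lemma char_centered: "(CLINT x|N. iexp (p \<bullet> (x - mean_vec N))) = exp (- of_real (functional_cov N p p / 2))"
proof -
  have "(CLINT x|N. iexp (p \<bullet> (x - mean_vec N))) = (CLINT x|N. iexp (- (p \<bullet> mean_vec N)) * iexp (p \<bullet> x))"
    by (intro Bochner_Integration.integral_cong refl)
      (simp only: inner_diff_right exp_add[symmetric] of_real_diff of_real_minus, simp add: algebra_simps)
  also have "\<dots> = iexp (- (p \<bullet> mean_vec N)) * exp (\<i> * (p \<bullet> mean_vec N) - functional_cov N p p / 2)"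
    by (simp only: integral_mult_right_zero char_eq inner_mean_vec)
  also have "\<dots> = exp (- of_real (functional_cov N p p / 2))"
    by (simp add: exp_add[symmetric])
  finally show ?thesis .
qed

lemma functional_cov_scaled_pair:
  "functional_cov N (x *\<^sub>R p + t *\<^sub>R q) (x *\<^sub>R p + t *\<^sub>R q) =
    x\<^sup>2 * functional_cov N p p + 2 * x * t * functional_cov N p q + t\<^sup>2 * functional_cov N q q"
  by (simp add: functional_cov_add_left functional_cov_add_right functional_cov_scale_left
      functional_cov_scale_right functional_cov_commute[of N q p] power2_eq_square algebra_simps)

lemma functional_cov_zero_left: "functional_cov N 0 q = 0"
  by (simp add: functional_cov_def)

lemma functional_cov_sum_left:
  "finite I \<Longrightarrow> functional_cov N (\<Sum>i\<in>I. c i *\<^sub>R p i) q = (\<Sum>i\<in>I. c i * functional_cov N (p i) q)"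
  by (induction I rule: finite_induct)
    (simp_all add: functional_cov_zero_left functional_cov_add_left functional_cov_scale_left)

lemma functional_cov_sum_right:
  "finite I \<Longrightarrow> functional_cov N q (\<Sum>i\<in>I. c i *\<^sub>R p i) = (\<Sum>i\<in>I. c i * functional_cov N q (p i))"
  by (simp add: functional_cov_commute[of N q] functional_cov_sum_left)

end

lemma Pair_0_expansion: "(p, 0) = (\<Sum>i\<in>UNIV. p $ i *\<^sub>R (axis i 1, 0))" for p :: "real^'n"
proof -
  have "(\<Sum>i\<in>UNIV. p $ i *\<^sub>R (axis i 1, 0::'b::real_vector)) = (\<Sum>i\<in>UNIV. p $ i *\<^sub>R axis i 1, 0)"
    by (simp add: prod_eq_iff fst_sum snd_sum)
  also have "(\<Sum>i\<in>UNIV. p $ i *\<^sub>R axis i 1) = p"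
    using basis_expansion[of p] by (simp add: scalar_mult_eq_scaleR)
  finally show ?thesis by (rule sym)
qed

lemma cov_fst_inner:
  fixes N :: "((real^'n) \<times> 'b::euclidean_space) measure"
  assumes "gaussian_measure N"
  shows "p \<bullet> (cov_fst N *v q) = functional_cov N (p, 0) (q, 0)"
proof -
  interpret gaussian N by unfold_locales fact
  show ?thesis
    unfolding Pair_0_expansion[of p] Pair_0_expansion[of q]
      functional_cov_sum_left[OF finite] functional_cov_sum_right[OF finite]
    by (simp add: inner_vec_def matrix_vector_mult_def cov_fst_def sum_distrib_left mult_ac)
      (rule sum.swap)
qed

lemma psd_cov_fst:
  fixes N :: "((real^'n) \<times> 'b::euclidean_space) measure"
  assumes "gaussian_measure N"
  shows "psd_matrix (cov_fst N)"
proof -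
  have "transpose (cov_fst N) = cov_fst N"
    by (auto simp: cov_fst_def transpose_def vec_eq_iff intro: functional_cov_commute)
  then show ?thesis by (simp add: psd_matrix_def cov_fst_inner[OF assms] functional_cov_nonneg)
qed

text \<open>Uncorrelated blocks of a Gaussian law are independent: without the cross term the
  variance of \<open>(p, q) \<bullet> z\<close> splits, so the characteristic function factors into
  those of the marginals.\<close>

lemma gaussian_decoupled_product:
  fixes N :: "('a::euclidean_space \<times> 'b::euclidean_space) measure"
  assumes gN: "gaussian_measure N" and dec: "\<And>p q. functional_cov N (p, 0) (0, q) = 0"
  shows "N = distr N borel fst \<Otimes>\<^sub>M distr N borel snd"
proof -
  interpret gaussian N by unfold_locales fact
  have fst_snd[measurable]: "fst \<in> borel_measurable N" "snd \<in> borel_measurable N"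
    using borel_measurable_fst_snd[of "\<lambda>z. z" N] by (simp_all cong: measurable_cong_sets)
  interpret D1: prob_space "distr N borel fst" by (rule prob_space_distr) simp
  interpret D2: prob_space "distr N borel snd" by (rule prob_space_distr) simp
  interpret P: pair_prob_space "distr N borel fst" "distr N borel snd" ..
  show ?thesis
  proof (rule finite_measure_eqI_char)
    fix u :: "'a \<times> 'b"
    obtain p q where u: "u = (p, q)" by (cases u)
    have split: "u \<bullet> z = p \<bullet> fst z + q \<bullet> snd z" for z by (simp add: u inner_prod_def)
    have sum: "u = (p, 0) + (0, q)" by (simp add: u)
    have "functional_cov N u u = functional_cov N (p, 0) (p, 0) + functional_cov N (0, q) (0, q)"
      unfolding sum functional_cov_add_left functional_cov_add_right
      using dec[of p q] functional_cov_commute[of N "(0, q)" "(p, 0)"] by simp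
    moreover have "(\<integral>z. u \<bullet> z \<partial>N) = (\<integral>z. (p, 0) \<bullet> z \<partial>N) + (\<integral>z. (0, q) \<bullet> z \<partial>N)"
      unfolding sum inner_add_left by (simp only: Bochner_Integration.integral_add integrable_inner)
    ultimately have "(CLINT z|N. iexp (u \<bullet> z)) = (CLINT z|N. iexp ((p, 0) \<bullet> z)) * (CLINT z|N. iexp ((0, q) \<bullet> z))"
      unfolding char_eq exp_add[symmetric] by (simp add: algebra_simps add_divide_distrib)
    also have "(CLINT z|N. iexp ((p, 0) \<bullet> z)) = (CLINT x|distr N borel fst. iexp (p \<bullet> x))"
      by (subst integral_distr) (auto simp: inner_prod_def)
    also have "(CLINT z|N. iexp ((0, q) \<bullet> z)) = (CLINT x|distr N borel snd. iexp (q \<bullet> x))"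
      by (subst integral_distr) (auto simp: inner_prod_def)
    also have "(CLINT x|distr N borel fst. iexp (p \<bullet> x)) * (CLINT x|distr N borel snd. iexp (q \<bullet> x)) =
      (CLINT z|distr N borel fst \<Otimes>\<^sub>M distr N borel snd. iexp (p \<bullet> fst z) * iexp (q \<bullet> snd z))"
      by (rule integral_pair_measure_mult(2)[symmetric])
        (auto intro!: D1.prob_space_axioms D2.prob_space_axioms D1.integrable_iexp_real D2.integrable_iexp_real)
    finally show "(CLINT z|N. iexp (u \<bullet> z)) =
      (CLINT z|distr N borel fst \<Otimes>\<^sub>M distr N borel snd. iexp (u \<bullet> z))"
      unfolding split by (simp only: of_real_add distrib_left exp_add)
  next
    show "sets (distr N borel fst \<Otimes>\<^sub>M distr N borel snd) = sets (borel :: ('a \<times> 'b) measure)"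
      unfolding borel_prod[symmetric] by (rule sets_pair_measure_cong) simp_all
  qed (auto intro: finite_measure_axioms P.finite_measure_axioms)
qed

lemma (in cond_law) functional_cov_K_measurable[measurable]:
  "(\<lambda>y. functional_cov (K y) p q) \<in> borel_measurable borel"
proof -
  have [measurable]: "(\<lambda>y. \<integral>x. r \<bullet> x \<partial>K y) \<in> borel_measurable borel" for r
    using kernel_integral_borel[of "\<lambda>z. r \<bullet> snd z"] by simp
  have "(\<lambda>y. \<integral>x. (\<lambda>(y, x). (p \<bullet> x - (\<integral>z. p \<bullet> z \<partial>K y)) * (q \<bullet> x - (\<integral>z. q \<bullet> z \<partial>K y))) (y, x) \<partial>K y) \<in> borel_measurable borel"
    by (rule kernel_integral_borel) measurable
  then show ?thesis by (simp add: functional_cov_def)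
qed

lemma (in cond_law) mean_vec_K_measurable[measurable]: "(\<lambda>y. mean_vec (K y)) \<in> borel_measurable borel"
proof -
  have [measurable]: "(\<lambda>y. \<integral>x. r \<bullet> x \<partial>K y) \<in> borel_measurable borel" for r
    using kernel_integral_borel[of "\<lambda>z. r \<bullet> snd z"] by simp
  show ?thesis unfolding mean_vec_def by measurable
qed

text \<open>Turns a computation inside single fibres into independence of \<open>Y\<close>; this is
  how the transported vector is seen to be admissible.\<close>

lemma (in cond_law) indep_rv_of_constant_kernel_law:
  fixes H :: "'c \<times> 'a \<Rightarrow> 'b::euclidean_space"
  assumes H[measurable]: "H \<in> borel_measurable (borel \<Otimes>\<^sub>M borel)"
    and law: "AE \<omega> in M. distr (K (Y \<omega>)) borel (\<lambda>x. H (Y \<omega>, x)) = \<nu>"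
  shows "indep_rv M (\<lambda>\<omega>. H (Y \<omega>, X \<omega>)) Y"
proof -
  have joint: "emeasure M {\<omega>\<in>space M. H (Y \<omega>, X \<omega>) \<in> A \<and> Y \<omega> \<in> B} =
      emeasure \<nu> A * emeasure M {\<omega>\<in>space M. Y \<omega> \<in> B}"
    if [measurable]: "A \<in> sets borel" "B \<in> sets borel" for A B
  proof -
    have mH: "(\<lambda>x. H (y, x)) \<in> borel_measurable (K y)" for y
      using H by (simp cong: measurable_cong_sets)
    have "emeasure M {\<omega>\<in>space M. H (Y \<omega>, X \<omega>) \<in> A \<and> Y \<omega> \<in> B} =
      (\<integral>\<^sup>+\<omega>. indicator B (Y \<omega>) * indicator A (H (Y \<omega>, X \<omega>)) \<partial>M)"
    proof -
      have "emeasure M {\<omega>\<in>space M. H (Y \<omega>, X \<omega>) \<in> A \<and> Y \<omega> \<in> B} =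
        (\<integral>\<^sup>+\<omega>. indicator {\<omega>\<in>space M. H (Y \<omega>, X \<omega>) \<in> A \<and> Y \<omega> \<in> B} \<omega> \<partial>M)"
        by (rule nn_integral_indicator[symmetric]) measurable
      also have "\<dots> = (\<integral>\<^sup>+\<omega>. indicator B (Y \<omega>) * indicator A (H (Y \<omega>, X \<omega>)) \<partial>M)"
        by (intro nn_integral_cong) (auto simp: indicator_def)
      finally show ?thesis .
    qed
    also have "\<dots> = (\<integral>\<^sup>+\<omega>. (\<integral>\<^sup>+x. indicator B (Y \<omega>) * indicator A (H (Y \<omega>, x)) \<partial>K (Y \<omega>)) \<partial>M)"
      using nn_integral_disintegration[of "\<lambda>z. indicator B (fst z) * indicator A (H z)"] by simp
    also have "\<dots> = (\<integral>\<^sup>+\<omega>. indicator B (Y \<omega>) * emeasure \<nu> A \<partial>M)"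
    proof (rule nn_integral_cong_AE)
      show "AE \<omega> in M. (\<integral>\<^sup>+x. indicator B (Y \<omega>) * indicator A (H (Y \<omega>, x)) \<partial>K (Y \<omega>)) =
        indicator B (Y \<omega>) * emeasure \<nu> A"
        using law
      proof eventually_elim
        case (elim \<omega>)
        have "(\<integral>\<^sup>+x. indicator A (H (Y \<omega>, x)) \<partial>K (Y \<omega>)) = (\<integral>\<^sup>+x. indicator A x \<partial>\<nu>)"
          unfolding elim[symmetric] by (rule nn_integral_distr[symmetric, OF mH]) simp
        moreover have "sets \<nu> = sets borel" unfolding elim[symmetric] by simp
        ultimately show ?case using mH by (subst nn_integral_cmult) auto
      qed
    qed
    also have "\<dots> = emeasure \<nu> A * emeasure M {\<omega>\<in>space M. Y \<omega> \<in> B}"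
    proof -
      have "(\<integral>\<^sup>+\<omega>. indicator B (Y \<omega>) \<partial>M) = (\<integral>\<^sup>+\<omega>. indicator {\<omega>\<in>space M. Y \<omega> \<in> B} \<omega> \<partial>M)"
        by (intro nn_integral_cong) (auto simp: indicator_def)
      also have "\<dots> = emeasure M {\<omega>\<in>space M. Y \<omega> \<in> B}"
        by (rule nn_integral_indicator) measurable
      finally show ?thesis by (subst nn_integral_multc) (simp_all add: mult.commute)
    qed
    finally show ?thesis .
  qed
  \<comment> \<open>Taking \<open>B = UNIV\<close> identifies \<open>\<nu>\<close> as the
    unconditional law of \<open>H (Y, X)\<close>.\<close>
  have "emeasure M {\<omega>\<in>space M. H (Y \<omega>, X \<omega>) \<in> A} = emeasure \<nu> A" if "A \<in> sets borel" for A
    using joint[OF that, of UNIV] by (simp add: emeasure_space_1)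
  with joint have "measure M {\<omega>\<in>space M. H (Y \<omega>, X \<omega>) \<in> A \<and> Y \<omega> \<in> B} =
    measure M {\<omega>\<in>space M. H (Y \<omega>, X \<omega>) \<in> A} * measure M {\<omega>\<in>space M. Y \<omega> \<in> B}"
    if "A \<in> sets borel" "B \<in> sets borel" for A B
    using that by (simp add: measure_def enn2real_mult)
  then show ?thesis
    by (subst indep_rv_iff_prob[OF prob_space_axioms]) auto
qed

lemma (in cond_law) bounded_integral_disintegration_complex:
  fixes f :: "'c \<times> 'a \<Rightarrow> complex"
  assumes f[measurable]: "f \<in> borel_measurable (borel \<Otimes>\<^sub>M borel)" and bound: "\<And>z. norm (f z) \<le> C"
  shows "integrable M (\<lambda>\<omega>. \<integral>x. f (Y \<omega>, x) \<partial>K (Y \<omega>))"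
    and "(\<integral>\<omega>. f (Y \<omega>, X \<omega>) \<partial>M) = (\<integral>\<omega>. (\<integral>x. f (Y \<omega>, x) \<partial>K (Y \<omega>)) \<partial>M)"
proof -
  have iK: "integrable (K y) (\<lambda>x. f (y, x))" for y
    by (rule finite_measure.integrable_const_bound[where B = C, OF prob_space.finite_measure[OF prob_space_K]])
       (use bound f in \<open>auto cong: measurable_cong_sets\<close>)
  have i: "integrable M (\<lambda>\<omega>. f (Y \<omega>, X \<omega>))"
    by (rule integrable_const_bound[where B = C]) (use bound in auto)
  have [measurable]: "(\<lambda>y. \<integral>x. f (y, x) \<partial>K y) \<in> borel_measurable borel" by measurable
  have "norm (\<integral>x. f (y, x) \<partial>K y) \<le> C" for y
  proof -
    interpret Ky: prob_space "K y" by (rule prob_space_K)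
    have "norm (\<integral>x. f (y, x) \<partial>K y) \<le> (\<integral>x. norm (f (y, x)) \<partial>K y)" by (rule integral_norm_bound)
    also have "\<dots> \<le> (\<integral>x. C \<partial>K y)" using iK bound by (intro integral_mono) auto
    finally show ?thesis using Ky.prob_space[unfolded space_K] by simp
  qed
  then show ii: "integrable M (\<lambda>\<omega>. \<integral>x. f (Y \<omega>, x) \<partial>K (Y \<omega>))"
    by (intro integrable_const_bound[where B = C]) auto
  have "(\<integral>\<omega>. Re (f (Y \<omega>, X \<omega>)) \<partial>M) = (\<integral>\<omega>. (\<integral>x. Re (f (Y \<omega>, x)) \<partial>K (Y \<omega>)) \<partial>M)"
    using integral_disintegration(3)[of "\<lambda>z. Re (f z)"] i by simp
  moreover have "(\<integral>\<omega>. Im (f (Y \<omega>, X \<omega>)) \<partial>M) = (\<integral>\<omega>. (\<integral>x. Im (f (Y \<omega>, x)) \<partial>K (Y \<omega>)) \<partial>M)"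
    using integral_disintegration(3)[of "\<lambda>z. Im (f z)"] i by simp
  ultimately show "(\<integral>\<omega>. f (Y \<omega>, X \<omega>) \<partial>M) = (\<integral>\<omega>. (\<integral>x. f (Y \<omega>, x) \<partial>K (Y \<omega>)) \<partial>M)"
    by (simp add: complex_eq_iff i ii iK)
qed

section \<open>Square-integrable vectors and their quadratic forms\<close>

lemma integrable_inner_L2:
  fixes f g :: "'w \<Rightarrow> 'a::euclidean_space"
  assumes [measurable]: "f \<in> borel_measurable M" "g \<in> borel_measurable M"
    and "integrable M (\<lambda>x. (norm (f x))\<^sup>2)" "integrable M (\<lambda>x. (norm (g x))\<^sup>2)"
  shows "integrable M (\<lambda>x. f x \<bullet> g x)"
proof (rule Bochner_Integration.integrable_bound)
  show "integrable M (\<lambda>x. (norm (f x))\<^sup>2 + (norm (g x))\<^sup>2)" using assms by simp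
  have "\<bar>a \<bullet> b\<bar> \<le> (norm a)\<^sup>2 + (norm b)\<^sup>2" for a b :: 'a
  proof -
    have "\<bar>a \<bullet> b\<bar> \<le> norm a * norm b" by (rule Cauchy_Schwarz_ineq2)
    also have "\<dots> \<le> (norm a)\<^sup>2 + (norm b)\<^sup>2"
    proof -
      have "0 \<le> norm a * norm b" by simp
      then show ?thesis using sum_squares_bound[of "norm a" "norm b"] by linarith
    qed
    finally show ?thesis .
  qed
  then show "AE x in M. norm (f x \<bullet> g x) \<le> norm ((norm (f x))\<^sup>2 + (norm (g x))\<^sup>2)" by simp
qed simp

lemma integrable_norm_sq_diff:
  fixes f g :: "'w \<Rightarrow> 'a::euclidean_space"
  assumes "f \<in> borel_measurable M" "g \<in> borel_measurable M"
    and "integrable M (\<lambda>x. (norm (f x))\<^sup>2)" "integrable M (\<lambda>x. (norm (g x))\<^sup>2)"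
  shows "integrable M (\<lambda>x. (norm (f x - g x))\<^sup>2)"
proof -
  have "(norm (f x - g x))\<^sup>2 = (norm (f x))\<^sup>2 + (norm (g x))\<^sup>2 - 2 * (f x \<bullet> g x)" for x
    by (simp add: power2_norm_eq_inner inner_diff inner_commute)
  then show ?thesis using assms integrable_inner_L2[OF assms] by simp
qed

lemma (in finite_measure) integrable_L2_imp_L1:
  fixes f :: "'a \<Rightarrow> 'b::euclidean_space"
  assumes [measurable]: "f \<in> borel_measurable M" and "integrable M (\<lambda>x. (norm (f x))\<^sup>2)"
  shows "integrable M f"
proof (rule Bochner_Integration.integrable_bound)
  show "integrable M (\<lambda>x. 1 + (norm (f x))\<^sup>2)" using assms by simp
  have "norm y \<le> 1 + (norm y)\<^sup>2" for y :: 'b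
    using sum_squares_bound[of 1 "norm y"] norm_ge_zero[of y] by (simp only: power_one mult_1_right)
  then show "AE x in M. norm (f x) \<le> norm (1 + (norm (f x))\<^sup>2)" by simp
qed simp

lemma integral_quadratic_form:
  fixes f :: "'w \<Rightarrow> real^'n"
  assumes "\<And>i j. integrable M (\<lambda>x. f x $ i * f x $ j)"
  shows "integrable M (\<lambda>x. f x \<bullet> (P *v f x))"
    and "(\<integral>x. f x \<bullet> (P *v f x) \<partial>M) = trace (P ** (\<chi> i j. \<integral>x. f x $ i * f x $ j \<partial>M))"
proof -
  have eq: "f x \<bullet> (P *v f x) = (\<Sum>i\<in>UNIV. \<Sum>j\<in>UNIV. P $ i $ j * (f x $ i * f x $ j))" for x
    by (simp add: inner_vec_def matrix_vector_mult_def sum_distrib_left mult_ac)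
  show "integrable M (\<lambda>x. f x \<bullet> (P *v f x))"
    unfolding eq by (intro Bochner_Integration.integrable_sum integrable_mult_right assms)
  show "(\<integral>x. f x \<bullet> (P *v f x) \<partial>M) = trace (P ** (\<chi> i j. \<integral>x. f x $ i * f x $ j \<partial>M))"
    unfolding eq using assms
    by (simp add: Bochner_Integration.integral_sum trace_def matrix_matrix_mult_def mult.commute)
qed

lemma integrable_vec_nth_mult:
  fixes f :: "'a \<Rightarrow> real^'n"
  assumes [measurable]: "f \<in> borel_measurable M" and f: "integrable M (\<lambda>x. (norm (f x))\<^sup>2)"
  shows "integrable M (\<lambda>x. f x $ i * f x $ j)"
proof -
  have sq: "integrable M (\<lambda>x. (norm (f x $ k))\<^sup>2)" for k
  proof (rule Bochner_Integration.integrable_bound[OF f])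
    have "(norm (f x $ k))\<^sup>2 \<le> (norm (f x))\<^sup>2" for x
      by (rule power_mono[OF Finite_Cartesian_Product.norm_nth_le norm_ge_zero])
    then show "AE x in M. norm ((norm (f x $ k))\<^sup>2) \<le> norm ((norm (f x))\<^sup>2)" by simp
  qed measurable
  show ?thesis using integrable_inner_L2[OF _ _ sq sq, of i j] by simp
qed

lemma integrable_vec_nth:
  fixes f :: "'a \<Rightarrow> real^'n"
  shows "integrable M f \<Longrightarrow> integrable M (\<lambda>x. f x $ i)"
  by (rule integrable_bounded_linear[OF bounded_linear_vec_nth])

section \<open>Conditionally Gaussian vectors\<close>

locale conditional_gaussian = cond_law M "\<lambda>\<omega>. (S \<omega>, W \<omega>)" Y K
  for M :: "'w measure" and S :: "'w \<Rightarrow> real^'s" and W :: "'w \<Rightarrow> real^'d" and Y :: "'w \<Rightarrow> real^'y" and K +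
  assumes gauss: "AE \<omega> in M. gaussian_measure (K (Y \<omega>))"
    and S_sq: "integrable M (\<lambda>\<omega>. (norm (S \<omega>))\<^sup>2)"
begin

lemma S[measurable]: "S \<in> borel_measurable M" and W[measurable]: "W \<in> borel_measurable M"
  using borel_measurable_fst_snd[OF X] by simp_all

definition cond_mean :: "real^'y \<Rightarrow> real^'s" where "cond_mean y = fst (mean_vec (K y))"

definition cond_cov :: "real^'y \<Rightarrow> real^'s^'s" where "cond_cov y = cov_fst (K y)"

lemma cond_mean_measurable[measurable]: "cond_mean \<in> borel_measurable borel"
  unfolding cond_mean_def by (intro borel_measurable_fst_snd mean_vec_K_measurable)

lemma cond_cov_measurable[measurable]: "cond_cov \<in> borel_measurable borel"
  by (intro borel_measurable_vecI) (simp add: cond_cov_def cov_fst_def functional_cov_K_measurable)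

lemma fst_measurable_borel[measurable]: "fst \<in> borel_measurable (borel :: ((real^'s) \<times> (real^'d)) measure)"
  "snd \<in> borel_measurable (borel :: ((real^'s) \<times> (real^'d)) measure)"
  unfolding borel_prod[symmetric] by measurable

lemma inner_Pair_0_centered: "(p, 0) \<bullet> (z - mean_vec (K y)) = p \<bullet> (fst z - cond_mean y)"
  by (simp add: inner_prod_def cond_mean_def)

context
  fixes y assumes g: "gaussian_measure (K y)"
begin

interpretation Ky: gaussian "K y" by unfold_locales (rule g)

lemma fibre_cov:
  "integrable (K y) (\<lambda>z. (p \<bullet> (fst z - cond_mean y)) * (q \<bullet> (fst z - cond_mean y)))"
  "(\<integral>z. (p \<bullet> (fst z - cond_mean y)) * (q \<bullet> (fst z - cond_mean y)) \<partial>K y) = p \<bullet> (cond_cov y *v q)"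
  using Ky.integrable_centered_mult[of "(p, 0)" "(q, 0)"] Ky.functional_cov_mean_vec[of "(p, 0)" "(q, 0)"]
  by (simp_all only: inner_Pair_0_centered cond_cov_def cov_fst_inner[OF g])

lemma fibre_mean:
  "integrable (K y) (\<lambda>z. p \<bullet> (fst z - cond_mean y))" "(\<integral>z. p \<bullet> (fst z - cond_mean y) \<partial>K y) = 0"
  using Ky.integrable_centered[of "(p, 0)"] Ky.integral_centered[of "(p, 0)"]
  by (simp_all only: inner_Pair_0_centered)

lemma fibre_char: "(CLINT z|K y. iexp (p \<bullet> (fst z - cond_mean y))) = exp (- of_real (p \<bullet> (cond_cov y *v p) / 2))"
  using Ky.char_centered[of "(p, 0)"] by (simp only: inner_Pair_0_centered cond_cov_def cov_fst_inner[OF g])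

lemma fibre_quadratic:
  "integrable (K y) (\<lambda>z. (fst z - cond_mean y) \<bullet> (P *v (fst z - cond_mean y)))"
  "(\<integral>z. (fst z - cond_mean y) \<bullet> (P *v (fst z - cond_mean y)) \<partial>K y) = trace (P ** cond_cov y)"
proof -
  have *: "axis i 1 \<bullet> x = x $ i" for x :: "real^'s" and i by (simp add: inner_axis')
  have i: "integrable (K y) (\<lambda>z. (fst z - cond_mean y) $ i * (fst z - cond_mean y) $ j)" for i j
    using fibre_cov(1)[of "axis i 1" "axis j 1"] by (simp only: *)
  have e: "(\<chi> i j. \<integral>z. (fst z - cond_mean y) $ i * (fst z - cond_mean y) $ j \<partial>K y) = cond_cov y"
    using fibre_cov(2)[of "axis _ 1" "axis _ 1"]
    by (simp add: vec_eq_iff inner_axis' matrix_vector_mul_component inner_axis)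
  show "integrable (K y) (\<lambda>z. (fst z - cond_mean y) \<bullet> (P *v (fst z - cond_mean y)))"
    by (rule integral_quadratic_form(1)[OF i])
  show "(\<integral>z. (fst z - cond_mean y) \<bullet> (P *v (fst z - cond_mean y)) \<partial>K y) = trace (P ** cond_cov y)"
    unfolding integral_quadratic_form(2)[OF i] e ..
qed

lemma psd_cond_cov: "psd_matrix (cond_cov y)"
  unfolding cond_cov_def by (rule psd_cov_fst[OF g])

end

lemma functional_cov_transport:
  assumes g: "gaussian_measure (K y)" and p: "psd_matrix P" and B: "P ** cond_cov y ** P = B"
  shows "functional_cov (K y) (P *v e, 0) (P *v e, 0) = e \<bullet> (B *v e)"
  unfolding cov_fst_inner[OF g, symmetric] cond_cov_def[symmetric] B[symmetric]
  by (simp add: psd_matrix_inner[OF p] flip: matrix_vector_mul_assoc)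

text \<open>Jensen's inequality in the fibre: the fibre variance is nonnegative, so the squared
  conditional mean is at most the fibre mean of the squared norm of \<open>S\<close>, which is
  integrable by disintegration.\<close>

lemma cond_mean_sq: "integrable M (\<lambda>\<omega>. (norm (cond_mean (Y \<omega>)))\<^sup>2)"
proof (rule Bochner_Integration.integrable_bound)
  let ?f = "\<lambda>z::(real^'y) \<times> (real^'s) \<times> (real^'d). (norm (fst (snd z)))\<^sup>2"
  have f: "?f \<in> borel_measurable (borel \<Otimes>\<^sub>M borel)" by measurable
  have i: "integrable M (\<lambda>\<omega>. ?f (Y \<omega>, S \<omega>, W \<omega>))" using S_sq by simp
  show "integrable M (\<lambda>\<omega>. \<integral>x. ?f (Y \<omega>, x) \<partial>K (Y \<omega>))" by (rule integral_disintegration(2)[OF f i])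
  show "AE \<omega> in M. norm ((norm (cond_mean (Y \<omega>)))\<^sup>2) \<le> norm (\<integral>x. ?f (Y \<omega>, x) \<partial>K (Y \<omega>))"
    using gauss integral_disintegration(1)[OF f i]
  proof eventually_elim
    case (elim \<omega>)
    let ?y = "Y \<omega>"
    interpret Ky: gaussian "K ?y" by unfold_locales (rule elim)
    have "0 \<le> (\<integral>z. (fst z - cond_mean ?y) \<bullet> (mat 1 *v (fst z - cond_mean ?y)) \<partial>K ?y)" by simp
    also have "\<dots> = (\<integral>z. (norm (fst z))\<^sup>2 - 2 * (cond_mean ?y \<bullet> (fst z - cond_mean ?y)) - (norm (cond_mean ?y))\<^sup>2 \<partial>K ?y)"
      by (intro Bochner_Integration.integral_cong refl)
        (simp add: power2_norm_eq_inner inner_diff inner_commute)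
    also have "\<dots> = (\<integral>z. (norm (fst z))\<^sup>2 \<partial>K ?y) - (norm (cond_mean ?y))\<^sup>2"
      using elim fibre_mean[OF elim(1)] Ky.prob_space[unfolded Ky.space_N] by simp
    finally show ?case by simp
  qed
qed simp

section \<open>Measurable families of transport matrices and the transported vector\<close>

definition S0 :: "'w \<Rightarrow> real^'s" where "S0 \<omega> = S \<omega> - cond_mean (Y \<omega>)"

lemma S0_measurable[measurable]: "S0 \<in> borel_measurable M"
  unfolding S0_def by measurable

lemma S0_sq: "integrable M (\<lambda>\<omega>. (norm (S0 \<omega>))\<^sup>2)"
  unfolding S0_def by (intro integrable_norm_sq_diff S_sq cond_mean_sq) auto

text \<open>The inverse \<open>G\<close> is kept as data beside \<open>A\<close>, because its
  measurability and its trace enter the estimates. The matrix identities are demanded only almost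
  surely, since \<open>K y\<close> need not be Gaussian for every \<open>y\<close>.\<close>

definition transport_family :: "real^'s^'s \<Rightarrow> (real^'y \<Rightarrow> real^'s^'s) \<Rightarrow> (real^'y \<Rightarrow> real^'s^'s) \<Rightarrow> bool" where
  "transport_family B A G \<longleftrightarrow> A \<in> borel_measurable borel \<and> G \<in> borel_measurable borel \<and>
    (AE \<omega> in M. psd_matrix (A (Y \<omega>)) \<and> A (Y \<omega>) ** cond_cov (Y \<omega>) ** A (Y \<omega>) = B \<and> A (Y \<omega>) ** G (Y \<omega>) = mat 1)"

text \<open>The selection is a Borel function of the covariance matrix; composed with
  \<open>cond_cov\<close> it becomes measurable in \<open>y\<close>, as admissibility of the
  competitor requires.\<close>

lemma transport_family_exists:
  assumes nonsing: "AE \<omega> in M. invertible (cond_cov (Y \<omega>))" and "psd_matrix B" "invertible B"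
  obtains A G where "transport_family B A G"
proof -
  obtain T G where TG: "T \<in> borel_measurable borel" "G \<in> borel_measurable borel"
    "\<And>A. psd_matrix A \<Longrightarrow> invertible A \<Longrightarrow> psd_matrix (T A) \<and> T A ** A ** T A = B \<and> T A ** G A = mat 1"
    using borel_transport_selection[OF assms(2,3)] by blast
  have "AE \<omega> in M. psd_matrix (T (cond_cov (Y \<omega>))) \<and> T (cond_cov (Y \<omega>)) ** cond_cov (Y \<omega>) ** T (cond_cov (Y \<omega>)) = B \<and>
      T (cond_cov (Y \<omega>)) ** G (cond_cov (Y \<omega>)) = mat 1"
    using gauss nonsing
  proof eventually_elim
    case (elim \<omega>)
    then show ?case using TG(3)[OF psd_cond_cov[OF elim(1)]] by blast
  qed
  then have "transport_family B (\<lambda>y. T (cond_cov y)) (\<lambda>y. G (cond_cov y))"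
    unfolding transport_family_def using TG(1,2) by auto
  then show thesis by (rule that)
qed

context
  fixes B A G assumes tf: "transport_family B A G"
begin

lemma A_measurable[measurable]: "A \<in> borel_measurable borel"
  and G_measurable[measurable]: "G \<in> borel_measurable borel"
  using tf by (auto simp: transport_family_def)

lemma transport_AE:
  "AE \<omega> in M. gaussian_measure (K (Y \<omega>)) \<and> psd_matrix (A (Y \<omega>)) \<and>
    A (Y \<omega>) ** cond_cov (Y \<omega>) ** A (Y \<omega>) = B \<and> A (Y \<omega>) ** G (Y \<omega>) = mat 1"
  using tf gauss by (auto simp: transport_family_def)

text \<open>In a good fibre the transform is
  \<open>iexp (u \<bullet> \<mu>) * exp (- (u \<bullet> B u) / 2)\<close>, with no trace of
  \<open>y\<close>; by uniqueness the conditional law is the same in all good fibres.\<close>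

lemma transport_indep: "indep_rv M (\<lambda>\<omega>. \<mu> + A (Y \<omega>) *v S0 \<omega>) Y"
proof -
  define H where "H = (\<lambda>(y, z::(real^'s) \<times> (real^'d)). \<mu> + A y *v (fst z - cond_mean y))"
  have H[measurable]: "H \<in> borel_measurable (borel \<Otimes>\<^sub>M borel)"
    unfolding H_def by measurable
  define good where "good y \<longleftrightarrow> gaussian_measure (K y) \<and> psd_matrix (A y) \<and> A y ** cond_cov y ** A y = B" for y
  have HK: "(\<lambda>z. H (y, z)) \<in> borel_measurable (K y)" for y
    using H by (simp cong: measurable_cong_sets)
  have char: "(CLINT x|distr (K y) borel (\<lambda>z. H (y, z)). iexp (u \<bullet> x)) =
      iexp (u \<bullet> \<mu>) * exp (- of_real (u \<bullet> (B *v u) / 2))" if "good y" for y u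
  proof -
    from that have g: "gaussian_measure (K y)" and p: "psd_matrix (A y)" and AB: "A y ** cond_cov y ** A y = B"
      by (auto simp: good_def)
    have "(CLINT x|distr (K y) borel (\<lambda>z. H (y, z)). iexp (u \<bullet> x)) = (CLINT z|K y. iexp (u \<bullet> H (y, z)))"
      by (rule integral_distr[OF HK]) simp
    also have "\<dots> = (CLINT z|K y. iexp (u \<bullet> \<mu>) * iexp ((A y *v u) \<bullet> (fst z - cond_mean y)))"
      by (intro Bochner_Integration.integral_cong refl)
        (simp only: H_def prod.case inner_add_right psd_matrix_inner[OF p] of_real_add distrib_left exp_add)
    also have "\<dots> = iexp (u \<bullet> \<mu>) * exp (- of_real ((A y *v u) \<bullet> (cond_cov y *v (A y *v u)) / 2))"
      by (simp only: integral_mult_right_zero fibre_char[OF g])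
    also have "(A y *v u) \<bullet> (cond_cov y *v (A y *v u)) = u \<bullet> (B *v u)"
      unfolding AB[symmetric] by (simp add: psd_matrix_inner[OF p] flip: matrix_vector_mul_assoc)
    finally show ?thesis .
  qed
  have good: "AE \<omega> in M. good (Y \<omega>)" using transport_AE by (auto simp: good_def)
  \<comment> \<open>An almost sure property holds somewhere, so one good fibre can supply the
    reference law.\<close>
  from eventually_happens[OF this] ae_filter_bot obtain y0 where y0: "good y0" by auto
  from good have "AE \<omega> in M. distr (K (Y \<omega>)) borel (\<lambda>z. H (Y \<omega>, z)) = distr (K y0) borel (\<lambda>z. H (y0, z))"
  proof eventually_elim
    case (elim \<omega>)
    show ?case
      by (intro finite_measure_eqI_char finite_measure.finite_measure_distr prob_space.finite_measure
          prob_space_K HK sets_distr) (simp only: char[OF elim] char[OF y0])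
  qed
  from indep_rv_of_constant_kernel_law[OF H this]
  show ?thesis by (simp add: H_def S0_def)
qed

text \<open>In each good fibre the mean is
  \<open>tr (A A \<Sigma>) = tr (A \<Sigma> A) = tr B\<close>. Nonnegative integrals are used first,
  so that integrability comes out together with the value.\<close>

lemma transport_sq:
  "integrable M (\<lambda>\<omega>. (norm (A (Y \<omega>) *v S0 \<omega>))\<^sup>2)" "(\<integral>\<omega>. (norm (A (Y \<omega>) *v S0 \<omega>))\<^sup>2 \<partial>M) = trace B"
proof -
  define f where "f = (\<lambda>(y, z::(real^'s) \<times> (real^'d)). (norm (A y *v (fst z - cond_mean y)))\<^sup>2)"
  have f[measurable]: "f \<in> borel_measurable (borel \<Otimes>\<^sub>M borel)"
    unfolding f_def by measurable
  have inner: "AE \<omega> in M. (\<integral>\<^sup>+z. ennreal (f (Y \<omega>, z)) \<partial>K (Y \<omega>)) = ennreal (trace B)"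
    using transport_AE
  proof eventually_elim
    case (elim \<omega>)
    let ?y = "Y \<omega>"
    have g: "gaussian_measure (K ?y)" and p: "psd_matrix (A ?y)" and AB: "A ?y ** cond_cov ?y ** A ?y = B"
      using elim by auto
    have f_eq: "f (?y, z) = (fst z - cond_mean ?y) \<bullet> ((A ?y ** A ?y) *v (fst z - cond_mean ?y))" for z
      by (simp add: f_def power2_norm_eq_inner psd_matrix_square_inner[OF p])
    have "(\<integral>\<^sup>+z. ennreal (f (?y, z)) \<partial>K ?y) = ennreal (\<integral>z. f (?y, z) \<partial>K ?y)"
      using fibre_quadratic(1)[OF g, of "A ?y ** A ?y"]
      by (intro nn_integral_eq_integral) (auto simp: f_eq[symmetric], simp add: f_def)
    also have "(\<integral>z. f (?y, z) \<partial>K ?y) = trace B"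
      unfolding f_eq fibre_quadratic(2)[OF g] AB[symmetric]
      by (metis matrix_mul_assoc trace_mul_sym)
    finally show ?case .
  qed
  have nn: "(\<integral>\<^sup>+\<omega>. ennreal (f (Y \<omega>, (S \<omega>, W \<omega>))) \<partial>M) = ennreal (trace B)"
    using nn_integral_disintegration[of "\<lambda>z. ennreal (f z)"] nn_integral_cong_AE[OF inner]
    by (simp add: emeasure_space_1)
  \<comment> \<open>Needed to read a real value off \<open>ennreal (trace B)\<close>, which
    truncates negative numbers to 0.\<close>
  moreover have "0 \<le> trace B"
  proof -
    obtain \<omega> where "gaussian_measure (K (Y \<omega>))" "psd_matrix (A (Y \<omega>))" "A (Y \<omega>) ** cond_cov (Y \<omega>) ** A (Y \<omega>) = B"
      using eventually_happens'[OF ae_filter_bot transport_AE] by blast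
    then show ?thesis
      using psd_matrix_conj[OF psd_cond_cov, of "Y \<omega>" "A (Y \<omega>)"] psd_matrix_trace_nonneg[of B]
      by (simp add: psd_matrix_def)
  qed
  ultimately have "has_bochner_integral M (\<lambda>\<omega>. f (Y \<omega>, (S \<omega>, W \<omega>))) (trace B)"
    by (intro has_bochner_integral_nn_integral) (auto simp: f_def)
  then show "integrable M (\<lambda>\<omega>. (norm (A (Y \<omega>) *v S0 \<omega>))\<^sup>2)" "(\<integral>\<omega>. (norm (A (Y \<omega>) *v S0 \<omega>))\<^sup>2 \<partial>M) = trace B"
    by (simp_all add: f_def S0_def has_bochner_integral_iff)
qed

text \<open>\<open>S0\<close> has conditional mean 0, so subtracting any square-integrable function
  of \<open>Y\<close> from \<open>S\<close> leaves the correlation with \<open>A S0\<close>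
  unchanged. It is applied with the constant \<open>\<mu>\<close> and with
  \<open>cond_mean\<close>.\<close>

lemma transport_inner:
  assumes c[measurable]: "c \<in> borel_measurable borel" and c_sq: "integrable M (\<lambda>\<omega>. (norm (c (Y \<omega>)))\<^sup>2)"
  shows "integrable M (\<lambda>\<omega>. (S \<omega> - c (Y \<omega>)) \<bullet> (A (Y \<omega>) *v S0 \<omega>))"
    and "integrable M (\<lambda>\<omega>. trace (A (Y \<omega>) ** cond_cov (Y \<omega>)))"
    and "(\<integral>\<omega>. (S \<omega> - c (Y \<omega>)) \<bullet> (A (Y \<omega>) *v S0 \<omega>) \<partial>M) = (\<integral>\<omega>. trace (A (Y \<omega>) ** cond_cov (Y \<omega>)) \<partial>M)"
proof -
  define f where "f = (\<lambda>(y, z::(real^'s) \<times> (real^'d)). (fst z - c y) \<bullet> (A y *v (fst z - cond_mean y)))"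
  have f[measurable]: "f \<in> borel_measurable (borel \<Otimes>\<^sub>M borel)"
    unfolding f_def by measurable
  show i: "integrable M (\<lambda>\<omega>. (S \<omega> - c (Y \<omega>)) \<bullet> (A (Y \<omega>) *v S0 \<omega>))"
    by (intro integrable_inner_L2 integrable_norm_sq_diff transport_sq S_sq c_sq) measurable
  then have fi: "integrable M (\<lambda>\<omega>. f (Y \<omega>, (S \<omega>, W \<omega>)))" by (simp add: f_def S0_def)
  note dis = integral_disintegration[OF f fi]
  have inner: "AE \<omega> in M. (\<integral>z. f (Y \<omega>, z) \<partial>K (Y \<omega>)) = trace (A (Y \<omega>) ** cond_cov (Y \<omega>))"
    using transport_AE
  proof eventually_elim
    case (elim \<omega>)
    let ?y = "Y \<omega>"
    have g: "gaussian_measure (K ?y)" and p: "psd_matrix (A ?y)" using elim by auto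
    have "f (?y, z) = (fst z - cond_mean ?y) \<bullet> (A ?y *v (fst z - cond_mean ?y)) + (A ?y *v (cond_mean ?y - c ?y)) \<bullet> (fst z - cond_mean ?y)" for z
      unfolding psd_matrix_inner[OF p] by (simp add: f_def inner_add_left[symmetric])
    then show ?case
      using fibre_quadratic[OF g] fibre_mean[OF g] by simp
  qed
  show "integrable M (\<lambda>\<omega>. trace (A (Y \<omega>) ** cond_cov (Y \<omega>)))"
    by (rule integrable_cong_AE_imp[OF dis(2)]) (use inner in auto)
  have "(\<integral>\<omega>. f (Y \<omega>, (S \<omega>, W \<omega>)) \<partial>M) = (\<integral>\<omega>. trace (A (Y \<omega>) ** cond_cov (Y \<omega>)) \<partial>M)"
    unfolding dis(3) using inner dis(2) by (intro integral_cong_AE) auto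
  then show "(\<integral>\<omega>. (S \<omega> - c (Y \<omega>)) \<bullet> (A (Y \<omega>) *v S0 \<omega>) \<partial>M) = (\<integral>\<omega>. trace (A (Y \<omega>) ** cond_cov (Y \<omega>)) \<partial>M)"
    by (simp add: f_def S0_def)
qed

end

context
  fixes A :: "real^'y \<Rightarrow> real^'s^'s" and e :: "real^'s" and u :: "real^'d"
begin

text \<open>Written as a sum over fixed functionals because measurability in \<open>y\<close> is
  available for \<open>functional_cov (K y) p q\<close> with \<open>p\<close> and \<open>q\<close>
  not depending on \<open>y\<close>. In Gaussian fibres it is the covariance of
  \<open>e \<bullet> A S\<close> and \<open>u \<bullet> W\<close>.\<close>

definition cross_cov :: "real^'y \<Rightarrow> real" where
  "cross_cov y = (\<Sum>i\<in>UNIV. (A y *v e) $ i * functional_cov (K y) (axis i 1, 0) (0, u))"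

lemma cross_cov_eq:
  assumes "gaussian_measure (K y)"
  shows "cross_cov y = functional_cov (K y) (A y *v e, 0) (0, u)"
proof -
  interpret Ky: gaussian "K y" by unfold_locales fact
  show ?thesis
    unfolding cross_cov_def Pair_0_expansion[of "A y *v e"] Ky.functional_cov_sum_left[OF finite] ..
qed

end

text \<open>The conditional means inside the product are first replaced by their version
  \<open>cond_mean (Y \<omega>)\<close>; the conditional expectation of the resulting product is
  then an integral over the fibre.\<close>

lemma cond_cov_matrix_AE: "AE \<omega> in M. cond_cov_matrix M S Y \<omega> = cond_cov (Y \<omega>)"
proof -
  have S_i: "integrable M (\<lambda>\<omega>. S \<omega> $ i)" for i
    by (rule integrable_vec_nth[OF integrable_L2_imp_L1[OF S S_sq]])
  have mean: "AE \<omega> in M. cond_exp M Y (\<lambda>\<omega>. S \<omega> $ i) \<omega> = cond_mean (Y \<omega>) $ i" for i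
  proof -
    have "AE \<omega> in M. cond_exp M Y (\<lambda>\<omega>. S \<omega> $ i) \<omega> = (\<integral>z. fst z $ i \<partial>K (Y \<omega>))"
      using cond_exp_eq_kernel_integral[of "\<lambda>z. fst (snd z) $ i"] S_i[of i] by simp
    then show ?thesis using gauss
    proof eventually_elim
      case (elim \<omega>)
      interpret Ky: gaussian "K (Y \<omega>)" by unfold_locales (rule elim)
      have "cond_mean (Y \<omega>) $ i = (axis i 1, 0) \<bullet> mean_vec (K (Y \<omega>))"
        by (simp add: cond_mean_def inner_prod_def inner_axis')
      also have "\<dots> = (\<integral>z. fst z $ i \<partial>K (Y \<omega>))"
        unfolding Ky.inner_mean_vec
        by (intro Bochner_Integration.integral_cong refl) (simp add: inner_prod_def inner_axis')
      finally show ?case using elim by simp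
    qed
  qed
  have "AE \<omega> in M. cond_exp M Y (\<lambda>x. (S x $ i - cond_exp M Y (\<lambda>x. S x $ i) x) *
      (S x $ j - cond_exp M Y (\<lambda>x. S x $ j) x)) \<omega> = cond_cov (Y \<omega>) $ i $ j" for i j
  proof -
    have int: "integrable M (\<lambda>\<omega>. S0 \<omega> $ i * S0 \<omega> $ j)"
      by (rule integrable_vec_nth_mult[OF S0_measurable S0_sq])
    have [measurable]: "cond_exp M Y h \<in> borel_measurable M" for h
      unfolding cond_exp_def by (rule borel_measurable_cond_exp2)
    have "AE \<omega> in M. cond_exp M Y (\<lambda>x. (S x $ i - cond_exp M Y (\<lambda>x. S x $ i) x) *
        (S x $ j - cond_exp M Y (\<lambda>x. S x $ j) x)) \<omega> = cond_exp M Y (\<lambda>\<omega>. S0 \<omega> $ i * S0 \<omega> $ j) \<omega>"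
      unfolding cond_exp_def[of M Y "\<lambda>x. _ x * _ x"]
    proof (rule gen.real_cond_exp_cong)
      show "AE x in M. (S x $ i - cond_exp M Y (\<lambda>x. S x $ i) x) * (S x $ j - cond_exp M Y (\<lambda>x. S x $ j) x) =
        S0 x $ i * S0 x $ j"
        using mean[of i] mean[of j] by eventually_elim (simp add: S0_def)
    qed measurable
    moreover have "AE \<omega> in M. cond_exp M Y (\<lambda>\<omega>. S0 \<omega> $ i * S0 \<omega> $ j) \<omega> =
        (\<integral>z. (fst z - cond_mean (Y \<omega>)) $ i * (fst z - cond_mean (Y \<omega>)) $ j \<partial>K (Y \<omega>))"
      using cond_exp_eq_kernel_integral[of "\<lambda>z. (fst (snd z) - cond_mean (fst z)) $ i * (fst (snd z) - cond_mean (fst z)) $ j"] int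
      by (simp add: S0_def)
    ultimately show ?thesis using gauss
    proof eventually_elim
      case (elim \<omega>)
      have "(\<integral>z. (fst z - cond_mean (Y \<omega>)) $ i * (fst z - cond_mean (Y \<omega>)) $ j \<partial>K (Y \<omega>)) = cond_cov (Y \<omega>) $ i $ j"
        using fibre_cov(2)[OF elim(3), of "axis i 1" "axis j 1"]
        by (simp add: inner_axis' matrix_vector_mul_component inner_axis)
      with elim show ?case by simp
    qed
  qed
  then have "AE \<omega> in M. \<forall>i j. cond_exp M Y (\<lambda>x. (S x $ i - cond_exp M Y (\<lambda>x. S x $ i) x) *
      (S x $ j - cond_exp M Y (\<lambda>x. S x $ j) x)) \<omega> = cond_cov (Y \<omega>) $ i $ j"
    unfolding AE_all_countable by blast
  then show ?thesis by eventually_elim (simp add: cond_cov_matrix_def vec_eq_iff)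
qed

text \<open>Conditional expectations are fibre integrals, and a decoupled Gaussian fibre is a
  product measure, on which the integral of \<open>g\<close> times \<open>h\<close> factors.\<close>

lemma cond_indep_of_decoupled:
  assumes "AE \<omega> in M. \<forall>p u. functional_cov (K (Y \<omega>)) (p, 0) (0, u) = 0"
  shows "cond_indep_given M W S Y"
  unfolding cond_indep_given_def
proof (intro ballI impI)
  fix g :: "real^'d \<Rightarrow> real" and h :: "real^'s \<Rightarrow> real"
  assume [measurable]: "g \<in> borel_measurable borel" "h \<in> borel_measurable borel"
    and bounded: "bounded (range g)" "bounded (range h)"
  from bounded obtain c d where g: "\<And>x. norm (g x) \<le> c" and h: "\<And>x. norm (h x) \<le> d"
    unfolding bounded_iff by blast
  have gh: "norm (g x * h y) \<le> c * d" for x y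
    unfolding norm_mult by (intro mult_mono g h order_trans[OF norm_ge_zero g] norm_ge_zero)
  have int: "integrable M (\<lambda>\<omega>. g (W \<omega>) * h (S \<omega>))" "integrable M (\<lambda>\<omega>. g (W \<omega>))" "integrable M (\<lambda>\<omega>. h (S \<omega>))"
    by (rule integrable_const_bound[OF AE_I2[OF gh]] integrable_const_bound[OF AE_I2[OF g]]
        integrable_const_bound[OF AE_I2[OF h]], measurable)+
  have "AE \<omega> in M. cond_exp M Y (\<lambda>\<omega>. g (W \<omega>) * h (S \<omega>)) \<omega> = (\<integral>z. g (snd z) * h (fst z) \<partial>K (Y \<omega>))"
    "AE \<omega> in M. cond_exp M Y (\<lambda>\<omega>. g (W \<omega>)) \<omega> = (\<integral>z. g (snd z) \<partial>K (Y \<omega>))"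
    "AE \<omega> in M. cond_exp M Y (\<lambda>\<omega>. h (S \<omega>)) \<omega> = (\<integral>z. h (fst z) \<partial>K (Y \<omega>))"
    using cond_exp_eq_kernel_integral[of "\<lambda>z. g (snd (snd z)) * h (fst (snd z))"]
      cond_exp_eq_kernel_integral[of "\<lambda>z. g (snd (snd z))"] cond_exp_eq_kernel_integral[of "\<lambda>z. h (fst (snd z))"] int
    by simp_all
  then show "AE \<omega> in M. cond_exp M Y (\<lambda>\<omega>. g (W \<omega>) * h (S \<omega>)) \<omega> =
      cond_exp M Y (\<lambda>\<omega>. g (W \<omega>)) \<omega> * cond_exp M Y (\<lambda>\<omega>. h (S \<omega>)) \<omega>"
    using assms gauss
  proof eventually_elim
    case (elim \<omega>)
    let ?N = "K (Y \<omega>)"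
    interpret Ky: gaussian ?N by unfold_locales (rule elim)
    have fst_snd[measurable]: "fst \<in> borel_measurable ?N" "snd \<in> borel_measurable ?N"
      by (simp_all cong: measurable_cong_sets)
    interpret D1: prob_space "distr ?N borel fst" by (rule Ky.prob_space_distr[OF fst_snd(1)])
    interpret D2: prob_space "distr ?N borel snd" by (rule Ky.prob_space_distr[OF fst_snd(2)])
    have prod: "?N = distr ?N borel fst \<Otimes>\<^sub>M distr ?N borel snd"
      by (rule gaussian_decoupled_product[OF elim(5)]) (use elim(4) in blast)
    have "(\<integral>z. h (fst z) * g (snd z) \<partial>?N) = (\<integral>z. h (fst z) * g (snd z) \<partial>(distr ?N borel fst \<Otimes>\<^sub>M distr ?N borel snd))"
      by (rule arg_cong[OF prod, of "\<lambda>L. \<integral>z. h (fst z) * g (snd z) \<partial>L"])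
    also have "\<dots> = (\<integral>x. h x \<partial>distr ?N borel fst) * (\<integral>x. g x \<partial>distr ?N borel snd)"
      by (rule integral_pair_measure_mult(2)[OF D1.prob_space_axioms D2.prob_space_axioms])
        (rule D1.integrable_const_bound[OF AE_I2[OF h]] D2.integrable_const_bound[OF AE_I2[OF g]], simp)+
    also have "\<dots> = (\<integral>z. h (fst z) \<partial>?N) * (\<integral>z. g (snd z) \<partial>?N)"
      by (simp add: integral_distr)
    finally show ?case using elim by (simp add: mult.commute)
  qed
qed

end

section \<open>The barycenter problem\<close>

locale gaussian_barycenter = conditional_gaussian M S W Y K
  for M :: "'w measure" and S :: "'w \<Rightarrow> real^'s" and W :: "'w \<Rightarrow> real^'d" and Y :: "'w \<Rightarrow> real^'y" and K +
  fixes T :: "(real^'s) \<times> (real^'y) \<Rightarrow> real^'s"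
  assumes nonsing: "AE \<omega> in M. invertible (cond_cov (Y \<omega>))" and solves: "solves_ot_barycenter M S Y T"
begin

definition U :: "'w \<Rightarrow> real^'s" where "U \<omega> = T (S \<omega>, Y \<omega>)"

lemma T_measurable[measurable]: "T \<in> borel_measurable (borel \<Otimes>\<^sub>M borel)"
  and U_indep: "indep_rv M U Y"
  using solves unfolding solves_ot_barycenter_def is_arg_min_def barycenter_admissible_def U_def[abs_def] borel_prod
  by auto

lemma cost_le: "barycenter_admissible M S Y T' \<Longrightarrow> barycenter_cost M S Y T \<le> barycenter_cost M S Y T'"
  using solves unfolding solves_ot_barycenter_def is_arg_min_def by (auto simp: not_less)

lemma U_measurable[measurable]: "U \<in> borel_measurable M"
  unfolding U_def by measurable

text \<open>The zero vector is independent of \<open>Y\<close> and has finite cost, so the minimal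
  cost is finite. Admissibility by itself does not give \<open>U\<close> a second moment.\<close>

lemma diff_U_sq: "integrable M (\<lambda>\<omega>. (norm (S \<omega> - U \<omega>))\<^sup>2)"
proof -
  have "indep_rv M (\<lambda>_. 0 :: real^'s) Y"
  proof (subst indep_rv_iff_prob[OF prob_space_axioms], simp, simp, intro ballI)
    show "prob {\<omega>\<in>space M. 0 \<in> A \<and> Y \<omega> \<in> B} = prob {\<omega>\<in>space M. 0 \<in> A} * prob {\<omega>\<in>space M. Y \<omega> \<in> B}"
      for A :: "(real^'s) set" and B
      by (cases "0 \<in> A") (simp_all add: prob_space)
  qed
  then have "barycenter_cost M S Y T \<le> barycenter_cost M S Y (\<lambda>_. 0)"
    by (intro cost_le) (simp add: barycenter_admissible_def)
  also have "\<dots> = ennreal (\<integral>\<omega>. (norm (S \<omega>))\<^sup>2 \<partial>M)"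
    unfolding barycenter_cost_def using S_sq by (simp add: nn_integral_eq_integral)
  finally have "(\<integral>\<^sup>+\<omega>. ennreal ((norm (S \<omega> - U \<omega>))\<^sup>2) \<partial>M) < \<infinity>"
    by (simp add: barycenter_cost_def U_def le_less_trans)
  then show ?thesis by (intro integrableI_bounded) auto
qed

lemma U_sq: "integrable M (\<lambda>\<omega>. (norm (U \<omega>))\<^sup>2)"
proof -
  have "integrable M (\<lambda>\<omega>. (norm (S \<omega> - (S \<omega> - U \<omega>)))\<^sup>2)"
    by (intro integrable_norm_sq_diff S_sq diff_U_sq) auto
  then show ?thesis by simp
qed

lemma integrable_U: "integrable M U"
  by (rule integrable_L2_imp_L1[OF U_measurable U_sq])

section \<open>Moments of the optimal vector and the optimality estimate\<close>

definition \<mu> :: "real^'s" where "\<mu> = (\<integral>\<omega>. U \<omega> \<partial>M)"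

definition U0 :: "'w \<Rightarrow> real^'s" where "U0 \<omega> = U \<omega> - \<mu>"

definition U_cov :: "real^'s^'s" where "U_cov = (\<chi> i j. \<integral>\<omega>. U0 \<omega> $ i * U0 \<omega> $ j \<partial>M)"

lemma U0_measurable[measurable]: "U0 \<in> borel_measurable M"
  unfolding U0_def by measurable

lemma integrable_norm_sq_const: "integrable M (\<lambda>\<omega>. (norm (c :: 'b::real_normed_vector))\<^sup>2)"
  by simp

lemma U0_sq: "integrable M (\<lambda>\<omega>. (norm (U0 \<omega>))\<^sup>2)"
  unfolding U0_def by (intro integrable_norm_sq_diff U_sq integrable_norm_sq_const) auto

lemma integral_U0: "(\<integral>\<omega>. U0 \<omega> $ i \<partial>M) = 0"
proof -
  have "(\<integral>\<omega>. axis i 1 \<bullet> U0 \<omega> \<partial>M) = axis i 1 \<bullet> (\<integral>\<omega>. U0 \<omega> \<partial>M)"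
    unfolding U0_def by (rule integral_inner_right) (use integrable_U in auto)
  also have "(\<integral>\<omega>. U0 \<omega> \<partial>M) = 0"
    unfolding U0_def using integrable_U by (simp add: \<mu>_def prob_space)
  finally show ?thesis by (simp add: inner_axis')
qed

lemma U0_products: "integrable M (\<lambda>\<omega>. U0 \<omega> $ i * U0 \<omega> $ j)"
  by (rule integrable_vec_nth_mult[OF U0_measurable U0_sq])

lemma U0_quadratic:
  "integrable M (\<lambda>\<omega>. U0 \<omega> \<bullet> (P *v U0 \<omega>))" "(\<integral>\<omega>. U0 \<omega> \<bullet> (P *v U0 \<omega>) \<partial>M) = trace (P ** U_cov)"
  using integral_quadratic_form[OF U0_products] by (simp_all add: U_cov_def)

lemma integral_U0_sq: "(\<integral>\<omega>. (norm (U0 \<omega>))\<^sup>2 \<partial>M) = trace U_cov"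
  using U0_quadratic(2)[of "mat 1"] by (simp add: power2_norm_eq_inner)

lemma psd_U_cov: "psd_matrix U_cov"
proof -
  have "x \<bullet> (U_cov *v x) = (\<integral>\<omega>. (x \<bullet> U0 \<omega>)\<^sup>2 \<partial>M)" for x
  proof -
    have "(x \<bullet> U0 \<omega>)\<^sup>2 = (\<Sum>i\<in>UNIV. \<Sum>j\<in>UNIV. x $ i * x $ j * (U0 \<omega> $ i * U0 \<omega> $ j))" for \<omega>
      by (simp add: power2_eq_square inner_vec_def sum_product mult_ac)
    then show ?thesis
      using U0_products by (simp add: Bochner_Integration.integral_sum U_cov_def inner_vec_def matrix_vector_mult_def sum_distrib_left mult_ac)
  qed
  moreover have "transpose U_cov = U_cov" by (simp add: U_cov_def transpose_def vec_eq_iff mult.commute)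
  ultimately show ?thesis by (simp add: psd_matrix_def)
qed

text \<open>Coordinate by coordinate the mean is a product with the factor
  \<open>E (U0 $ i) = 0\<close>. Hence functions of \<open>Y\<close> may be subtracted from
  \<open>S\<close> in the correlation with \<open>U0\<close>.\<close>

lemma inner_independent_U0:
  assumes c[measurable]: "c \<in> borel_measurable borel" and c_sq: "integrable M (\<lambda>\<omega>. (norm (c (Y \<omega>)))\<^sup>2)"
  shows "(\<integral>\<omega>. c (Y \<omega>) \<bullet> U0 \<omega> \<partial>M) = 0"
proof -
  have iU: "integrable M (\<lambda>\<omega>. (U \<omega> - \<mu>) $ i)" for i
    using integrable_vec_nth[OF integrable_L2_imp_L1[OF U0_measurable U0_sq]] by (simp only: U0_def)
  have ic: "integrable M (\<lambda>\<omega>. c (Y \<omega>) $ i)" for i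
    by (rule integrable_vec_nth[OF integrable_L2_imp_L1[OF _ c_sq]]) measurable
  have p: "integrable M (\<lambda>\<omega>. (U \<omega> - \<mu>) $ i * c (Y \<omega>) $ i)"
    "(\<integral>\<omega>. (U \<omega> - \<mu>) $ i * c (Y \<omega>) $ i \<partial>M) = 0" for i
    using indep_rv_integral_mult[OF prob_space_axioms U_measurable Y U_indep,
        of "\<lambda>u. (u - \<mu>) $ i" "\<lambda>y. c y $ i"] iU[of i] ic[of i] integral_U0[of i]
    by (simp_all add: U0_def)
  have "(\<integral>\<omega>. c (Y \<omega>) \<bullet> U0 \<omega> \<partial>M) = (\<integral>\<omega>. (\<Sum>i\<in>UNIV. (U \<omega> - \<mu>) $ i * c (Y \<omega>) $ i) \<partial>M)"
    by (simp add: inner_vec_def U0_def mult.commute)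
  also have "\<dots> = 0" by (subst Bochner_Integration.integral_sum) (simp_all only: p sum.neutral_const)
  finally show ?thesis .
qed

text \<open>The defect in Young's inequality for \<open>S0\<close> and \<open>U0\<close> with weight \<open>A\<close>, where \<open>G\<close> is the inverse of \<open>A\<close>.\<close>

definition gap :: "(real^'y \<Rightarrow> real^'s^'s) \<Rightarrow> (real^'y \<Rightarrow> real^'s^'s) \<Rightarrow> 'w \<Rightarrow> real" where
  "gap A G \<omega> = (S0 \<omega> - G (Y \<omega>) *v U0 \<omega>) \<bullet> (A (Y \<omega>) *v (S0 \<omega> - G (Y \<omega>) *v U0 \<omega>))"

text \<open>With \<open>q = tr (A \<Sigma>)\<close> the mean defect is
  \<open>2 E q - 2 E (S0 \<bullet> U0) - \<eta> E (tr G)\<close>. Optimality against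
  \<open>\<mu> + A S0\<close> bounds the first two terms by the excess of \<open>tr B\<close> over
  \<open>tr U_cov\<close>, which is \<open>\<eta> * CARD('s)\<close>.\<close>

lemma transport_gap:
  assumes \<eta>: "0 \<le> \<eta>" and tf: "transport_family (U_cov + \<eta> *\<^sub>R mat 1) A G"
  shows "integrable M (gap A G)"
    and "integrable M (\<lambda>\<omega>. \<eta> * trace (G (Y \<omega>)))"
    and "(\<integral>\<omega>. gap A G \<omega> \<partial>M) + (\<integral>\<omega>. \<eta> * trace (G (Y \<omega>)) \<partial>M) \<le> \<eta> * real CARD('s)"
proof -
  let ?B = "U_cov + \<eta> *\<^sub>R mat 1"
  note [measurable] = A_measurable[OF tf] G_measurable[OF tf]
  define q where "q \<omega> = trace (A (Y \<omega>) ** cond_cov (Y \<omega>))" for \<omega>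
  define V where "V \<omega> = A (Y \<omega>) *v S0 \<omega>" for \<omega>
  define h where "h \<omega> = U0 \<omega> \<bullet> (G (Y \<omega>) *v U0 \<omega>)" for \<omega>
  have V[measurable]: "V \<in> borel_measurable M" unfolding V_def by measurable
  have h[measurable]: "h \<in> borel_measurable M" unfolding h_def by measurable
  have V_sq: "integrable M (\<lambda>\<omega>. (norm (V \<omega>))\<^sup>2)" "(\<integral>\<omega>. (norm (V \<omega>))\<^sup>2 \<partial>M) = trace ?B"
    using transport_sq[OF tf] by (simp_all add: V_def)
  have q: "integrable M q" "(\<integral>\<omega>. (S \<omega> - \<mu>) \<bullet> V \<omega> \<partial>M) = (\<integral>\<omega>. q \<omega> \<partial>M)"
    "integrable M (\<lambda>\<omega>. S0 \<omega> \<bullet> V \<omega>)" "(\<integral>\<omega>. S0 \<omega> \<bullet> V \<omega> \<partial>M) = (\<integral>\<omega>. q \<omega> \<partial>M)"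
    using transport_inner[OF tf, of "\<lambda>_. \<mu>"] transport_inner[OF tf, of cond_mean] cond_mean_sq
    by (simp_all add: q_def[abs_def] V_def S0_def)
  \<comment> \<open>From \<open>A \<Sigma> A = B\<close> follows \<open>G B = \<Sigma> A\<close>,
    hence \<open>tr (G B) = q\<close>; the contribution of the summand \<open>\<eta> I\<close> of
    \<open>B\<close> is then subtracted.\<close>
  have trG: "AE \<omega> in M. trace (G (Y \<omega>) ** U_cov) = q \<omega> - \<eta> * trace (G (Y \<omega>)) \<and> 0 \<le> trace (G (Y \<omega>)) \<and>
      psd_matrix (G (Y \<omega>))"
    using transport_AE[OF tf]
  proof eventually_elim
    case (elim \<omega>)
    let ?A = "A (Y \<omega>)" and ?G = "G (Y \<omega>)" and ?S = "cond_cov (Y \<omega>)"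
    have AB: "?A ** ?S ** ?A = ?B" and p: "psd_matrix ?A" and AG: "?A ** ?G = mat 1" using elim by auto
    have "trace (?G ** ?B) = trace ((?G ** ?A) ** ?S ** ?A)"
      unfolding AB[symmetric] by (simp add: matrix_mul_assoc)
    also have "\<dots> = q \<omega>"
      unfolding psd_matrix_inverse(2)[OF p AG] q_def matrix_mul_lid by (rule trace_mul_sym)
    finally have "trace (?G ** ?B) = q \<omega>" .
    moreover have "?G ** ?B = ?G ** U_cov + \<eta> *\<^sub>R ?G"
      by (simp only: matrix_add_ldistrib matrix_scaleR_right matrix_mul_rid)
    ultimately show ?case
      using psd_matrix_inverse(1)[OF p AG] psd_matrix_trace_nonneg by (simp add: trace_add trace_scaleR)
  qed
  \<comment> \<open>Independence lets \<open>U\<close> be averaged with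
    \<open>G (Y \<omega>)\<close> fixed, which turns the quadratic form into
    \<open>tr (G U_cov)\<close>. Integrability of \<open>h\<close> is not yet known, hence
    nonnegative integrals.\<close>
  have h_inner: "(\<integral>\<^sup>+\<omega>. ennreal (h \<omega>) \<partial>M) = (\<integral>\<^sup>+\<omega>. ennreal (q \<omega> - \<eta> * trace (G (Y \<omega>))) \<partial>M)"
    and q_nonneg: "AE \<omega> in M. 0 \<le> q \<omega> - \<eta> * trace (G (Y \<omega>))"
  proof -
    have *: "AE \<omega> in M. (\<integral>\<^sup>+\<omega>'. ennreal ((U \<omega>' - \<mu>) \<bullet> (G (Y \<omega>) *v (U \<omega>' - \<mu>))) \<partial>M) =
        ennreal (q \<omega> - \<eta> * trace (G (Y \<omega>))) \<and> 0 \<le> q \<omega> - \<eta> * trace (G (Y \<omega>))"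
      using trG
    proof eventually_elim
      case (elim \<omega>)
      have pos: "0 \<le> U0 \<omega>' \<bullet> (G (Y \<omega>) *v U0 \<omega>')" for \<omega>'
        using elim by (simp add: psd_matrix_nonneg)
      then have "0 \<le> (\<integral>\<omega>'. U0 \<omega>' \<bullet> (G (Y \<omega>) *v U0 \<omega>') \<partial>M)"
        by (intro Bochner_Integration.integral_nonneg)
      moreover have "(\<integral>\<^sup>+\<omega>'. ennreal (U0 \<omega>' \<bullet> (G (Y \<omega>) *v U0 \<omega>')) \<partial>M) =
          ennreal (\<integral>\<omega>'. U0 \<omega>' \<bullet> (G (Y \<omega>) *v U0 \<omega>') \<partial>M)"
        using pos by (intro nn_integral_eq_integral U0_quadratic(1)) auto
      ultimately show ?case
        unfolding U0_def[symmetric] U0_quadratic(2) using elim by simp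
    qed
    then show "AE \<omega> in M. 0 \<le> q \<omega> - \<eta> * trace (G (Y \<omega>))" by auto
    have "(\<integral>\<^sup>+\<omega>. ennreal (h \<omega>) \<partial>M) =
        (\<integral>\<^sup>+\<omega>. (\<integral>\<^sup>+\<omega>'. ennreal ((U \<omega>' - \<mu>) \<bullet> (G (Y \<omega>) *v (U \<omega>' - \<mu>))) \<partial>M) \<partial>M)"
      using indep_rv_nn_integral[OF prob_space_axioms U_measurable Y U_indep,
          of "\<lambda>(u, y). ennreal ((u - \<mu>) \<bullet> (G y *v (u - \<mu>)))"]
      by (simp add: h_def U0_def)
    also have "\<dots> = (\<integral>\<^sup>+\<omega>. ennreal (q \<omega> - \<eta> * trace (G (Y \<omega>))) \<partial>M)"
      using * by (intro nn_integral_cong_AE) auto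
    finally show "(\<integral>\<^sup>+\<omega>. ennreal (h \<omega>) \<partial>M) = (\<integral>\<^sup>+\<omega>. ennreal (q \<omega> - \<eta> * trace (G (Y \<omega>))) \<partial>M)" .
  qed
  \<comment> \<open>As \<open>q - \<eta> tr G\<close> is a mean of nonnegative numbers,
    \<open>\<eta> tr G\<close> lies between 0 and the integrable \<open>q\<close>.\<close>
  show \<eta>G: "integrable M (\<lambda>\<omega>. \<eta> * trace (G (Y \<omega>)))"
  proof (rule Bochner_Integration.integrable_bound[OF q(1)])
    show "AE \<omega> in M. norm (\<eta> * trace (G (Y \<omega>))) \<le> norm (q \<omega>)"
      using trG q_nonneg by eventually_elim (use \<eta> in \<open>auto simp: abs_mult\<close>)
  qed measurable
  have h_pos: "AE \<omega> in M. 0 \<le> h \<omega>"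
    using trG by eventually_elim (simp add: h_def psd_matrix_nonneg)
  have "(\<integral>\<^sup>+\<omega>. ennreal (h \<omega>) \<partial>M) = ennreal (\<integral>\<omega>. q \<omega> - \<eta> * trace (G (Y \<omega>)) \<partial>M)"
    unfolding h_inner using q(1) \<eta>G q_nonneg by (intro nn_integral_eq_integral) auto
  then have "has_bochner_integral M h (\<integral>\<omega>. q \<omega> - \<eta> * trace (G (Y \<omega>)) \<partial>M)"
    using h_pos q_nonneg by (intro has_bochner_integral_nn_integral) (auto intro: integral_nonneg_AE)
  then have hi: "integrable M h" "(\<integral>\<omega>. h \<omega> \<partial>M) = (\<integral>\<omega>. q \<omega> \<partial>M) - (\<integral>\<omega>. \<eta> * trace (G (Y \<omega>)) \<partial>M)"
    using q(1) \<eta>G by (simp_all add: has_bochner_integral_iff)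
  have SU: "integrable M (\<lambda>\<omega>. S0 \<omega> \<bullet> U0 \<omega>)" "integrable M (\<lambda>\<omega>. (S \<omega> - \<mu>) \<bullet> U0 \<omega>)"
      "integrable M (\<lambda>\<omega>. (S \<omega> - \<mu>) \<bullet> V \<omega>)" "integrable M (\<lambda>\<omega>. (cond_mean (Y \<omega>) - \<mu>) \<bullet> U0 \<omega>)"
      "integrable M (\<lambda>\<omega>. (norm (S \<omega> - \<mu>))\<^sup>2)"
    by (intro integrable_inner_L2 integrable_norm_sq_diff S0_sq U0_sq S_sq V_sq cond_mean_sq integrable_norm_sq_const; measurable)+
  have "(\<integral>\<omega>. (cond_mean (Y \<omega>) - \<mu>) \<bullet> U0 \<omega> \<partial>M) = 0"
    by (rule inner_independent_U0[of "\<lambda>y. cond_mean y - \<mu>"]) (auto intro!: integrable_norm_sq_diff cond_mean_sq)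
  moreover have "S0 \<omega> \<bullet> U0 \<omega> = (S \<omega> - \<mu>) \<bullet> U0 \<omega> - (cond_mean (Y \<omega>) - \<mu>) \<bullet> U0 \<omega>" for \<omega>
    by (simp add: S0_def inner_diff_left)
  ultimately have S0U0: "(\<integral>\<omega>. S0 \<omega> \<bullet> U0 \<omega> \<partial>M) = (\<integral>\<omega>. (S \<omega> - \<mu>) \<bullet> U0 \<omega> \<partial>M)"
    using SU by simp
  \<comment> \<open>Both vectors have the form \<open>\<mu> + Z\<close>, so their costs differ only
    in the correlation with \<open>S - \<mu>\<close> and in the second moment of \<open>Z\<close>.
    Nonnegativity is recorded so that \<open>ennreal\<close> values can be compared as
    reals.\<close>
  have cost: "(\<integral>\<^sup>+\<omega>. ennreal ((norm (S \<omega> - (\<mu> + Z \<omega>)))\<^sup>2) \<partial>M) =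
      ennreal ((\<integral>\<omega>. (norm (S \<omega> - \<mu>))\<^sup>2 \<partial>M) - 2 * (\<integral>\<omega>. (S \<omega> - \<mu>) \<bullet> Z \<omega> \<partial>M) + (\<integral>\<omega>. (norm (Z \<omega>))\<^sup>2 \<partial>M)) \<and>
      0 \<le> (\<integral>\<omega>. (norm (S \<omega> - \<mu>))\<^sup>2 \<partial>M) - 2 * (\<integral>\<omega>. (S \<omega> - \<mu>) \<bullet> Z \<omega> \<partial>M) + (\<integral>\<omega>. (norm (Z \<omega>))\<^sup>2 \<partial>M)"
    if "integrable M (\<lambda>\<omega>. (S \<omega> - \<mu>) \<bullet> Z \<omega>)" "integrable M (\<lambda>\<omega>. (norm (Z \<omega>))\<^sup>2)" for Z :: "'w \<Rightarrow> real^'s"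
  proof -
    have e: "(norm (S \<omega> - (\<mu> + Z \<omega>)))\<^sup>2 = (norm (S \<omega> - \<mu>))\<^sup>2 - 2 * ((S \<omega> - \<mu>) \<bullet> Z \<omega>) + (norm (Z \<omega>))\<^sup>2" for \<omega>
      by (simp add: power2_norm_eq_inner inner_diff inner_add inner_commute algebra_simps)
    have i: "integrable M (\<lambda>\<omega>. (norm (S \<omega> - (\<mu> + Z \<omega>)))\<^sup>2)"
      unfolding e using that SU by simp
    have "(\<integral>\<omega>. (norm (S \<omega> - (\<mu> + Z \<omega>)))\<^sup>2 \<partial>M) =
      (\<integral>\<omega>. (norm (S \<omega> - \<mu>))\<^sup>2 \<partial>M) - 2 * (\<integral>\<omega>. (S \<omega> - \<mu>) \<bullet> Z \<omega> \<partial>M) + (\<integral>\<omega>. (norm (Z \<omega>))\<^sup>2 \<partial>M)"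
      unfolding e using that SU by simp
    moreover have "0 \<le> (\<integral>\<omega>. (norm (S \<omega> - (\<mu> + Z \<omega>)))\<^sup>2 \<partial>M)" by simp
    ultimately show ?thesis using nn_integral_eq_integral[OF i] by simp
  qed
  let ?T = "\<lambda>(s, y). \<mu> + A y *v (s - cond_mean y)"
  have "barycenter_admissible M S Y ?T"
    unfolding barycenter_admissible_def
  proof
    show "?T \<in> borel_measurable borel" unfolding borel_prod[symmetric] by measurable
    show "indep_rv M (\<lambda>\<omega>. ?T (S \<omega>, Y \<omega>)) Y"
      using transport_indep[OF tf, of \<mu>] by (simp add: S0_def)
  qed
  from cost_le[OF this]
  have "(\<integral>\<^sup>+\<omega>. ennreal ((norm (S \<omega> - (\<mu> + U0 \<omega>)))\<^sup>2) \<partial>M) \<le> (\<integral>\<^sup>+\<omega>. ennreal ((norm (S \<omega> - (\<mu> + V \<omega>)))\<^sup>2) \<partial>M)"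
    by (simp add: barycenter_cost_def U0_def U_def V_def S0_def)
  then have "- 2 * (\<integral>\<omega>. (S \<omega> - \<mu>) \<bullet> U0 \<omega> \<partial>M) + trace U_cov \<le> - 2 * (\<integral>\<omega>. q \<omega> \<partial>M) + trace ?B"
    using cost[of U0] cost[of V] SU V_sq U0_sq by (simp add: q(2) integral_U0_sq)
  then have le: "- 2 * (\<integral>\<omega>. S0 \<omega> \<bullet> U0 \<omega> \<partial>M) \<le> - 2 * (\<integral>\<omega>. q \<omega> \<partial>M) + \<eta> * real CARD('s)"
    unfolding S0U0 by (simp add: trace_add trace_scaleR trace_mat_1)
  \<comment> \<open>Completing the square: the cross term \<open>(G U0) \<bullet> (A S0)\<close>
    reduces to \<open>U0 \<bullet> S0\<close> because \<open>A G\<close> is the identity.\<close>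
  have gap: "AE \<omega> in M. S0 \<omega> \<bullet> V \<omega> - 2 * (S0 \<omega> \<bullet> U0 \<omega>) + h \<omega> = gap A G \<omega>"
    using transport_AE[OF tf]
  proof eventually_elim
    case (elim \<omega>)
    let ?A = "A (Y \<omega>)" and ?G = "G (Y \<omega>)"
    have p: "psd_matrix ?A" and AG: "?A *v (?G *v U0 \<omega>) = U0 \<omega>"
      using elim by (auto simp: matrix_vector_mul_assoc)
    have "(?G *v U0 \<omega>) \<bullet> (?A *v S0 \<omega>) = U0 \<omega> \<bullet> S0 \<omega>"
      using psd_matrix_inner[OF p, of "?G *v U0 \<omega>" "S0 \<omega>"] AG by simp
    then show ?case
      by (simp add: gap_def V_def h_def matrix_vector_mult_diff_distrib AG inner_diff inner_commute)
  qed
  have gi: "integrable M (\<lambda>\<omega>. S0 \<omega> \<bullet> V \<omega> - 2 * (S0 \<omega> \<bullet> U0 \<omega>) + h \<omega>)"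
    using q SU hi by simp
  have gm: "gap A G \<in> borel_measurable M" unfolding gap_def by measurable
  show "integrable M (gap A G)" by (rule integrable_cong_AE_imp[OF gi gm gap])
  have "(\<integral>\<omega>. gap A G \<omega> \<partial>M) = (\<integral>\<omega>. S0 \<omega> \<bullet> V \<omega> - 2 * (S0 \<omega> \<bullet> U0 \<omega>) + h \<omega> \<partial>M)"
    using gap gm gi by (intro integral_cong_AE) auto
  also have "\<dots> = (\<integral>\<omega>. q \<omega> \<partial>M) - 2 * (\<integral>\<omega>. S0 \<omega> \<bullet> U0 \<omega> \<partial>M) + ((\<integral>\<omega>. q \<omega> \<partial>M) - (\<integral>\<omega>. \<eta> * trace (G (Y \<omega>)) \<partial>M))"
    using q SU hi by simp
  finally show "(\<integral>\<omega>. gap A G \<omega> \<partial>M) + (\<integral>\<omega>. \<eta> * trace (G (Y \<omega>)) \<partial>M) \<le> \<eta> * real CARD('s)"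
    using le by simp
qed

lemma gap_nonneg:
  assumes "transport_family B A G"
  shows "AE \<omega> in M. 0 \<le> gap A G \<omega>"
  using transport_AE[OF assms] by eventually_elim (simp add: gap_def psd_matrix_nonneg)

lemma U_cov_regularized:
  assumes "\<eta> > 0"
  shows "psd_matrix (U_cov + \<eta> *\<^sub>R mat 1)" "invertible (U_cov + \<eta> *\<^sub>R mat 1)"
proof -
  have e: "x \<bullet> ((U_cov + \<eta> *\<^sub>R mat 1) *v x) = x \<bullet> (U_cov *v x) + \<eta> * (x \<bullet> x)" for x
    by (simp add: matrix_vector_mult_add_rdistrib scaleR_matrix_vector_assoc[symmetric] inner_add_right)
  have "transpose (U_cov + \<eta> *\<^sub>R mat 1) = U_cov + \<eta> *\<^sub>R mat 1"
    by (auto simp: vec_eq_iff transpose_def mat_def U_cov_def mult.commute)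
  then show "psd_matrix (U_cov + \<eta> *\<^sub>R mat 1)"
    using assms psd_matrix_nonneg[OF psd_U_cov] unfolding psd_matrix_def e by simp
  show "invertible (U_cov + \<eta> *\<^sub>R mat 1)"
    using assms psd_matrix_nonneg[OF psd_U_cov]
    by (intro invertible_of_positive_definite) (simp add: e add_nonneg_pos)
qed

text \<open>Once the nonnegative mean defect is discarded, both sides of the estimate carry a factor
  \<open>\<eta>\<close>, so the resulting bound is free of \<open>\<eta>\<close>.\<close>

lemma regularized_trace_bound:
  assumes \<eta>: "\<eta> > 0" and tf: "transport_family (U_cov + \<eta> *\<^sub>R mat 1) A G"
  shows "(\<integral>\<^sup>+\<omega>. ennreal (trace (G (Y \<omega>))) \<partial>M) \<le> ennreal (real CARD('s))"
proof -
  note gap = transport_gap[OF less_imp_le[OF \<eta>] tf]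
  have i: "integrable M (\<lambda>\<omega>. trace (G (Y \<omega>)))" using gap(2) \<eta> by simp
  have "0 \<le> (\<integral>\<omega>. gap A G \<omega> \<partial>M)" using gap_nonneg[OF tf] by (rule integral_nonneg_AE)
  then have "\<eta> * (\<integral>\<omega>. trace (G (Y \<omega>)) \<partial>M) \<le> \<eta> * real CARD('s)" using gap(3) by simp
  then have "(\<integral>\<omega>. trace (G (Y \<omega>)) \<partial>M) \<le> real CARD('s)" using \<eta> by simp
  moreover have "AE \<omega> in M. 0 \<le> trace (G (Y \<omega>))"
    using transport_AE[OF tf] by eventually_elim (metis psd_matrix_inverse(1) psd_matrix_trace_nonneg)
  ultimately show ?thesis using i by (simp add: nn_integral_eq_integral ennreal_leI)
qed

text \<open>If \<open>U_cov\<close> had a kernel vector, the inverse transport matrices for \<open>U_cov + \<eta> I\<close> would blow up as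
  \<open>\<eta> \<rightarrow> 0\<close>, although their mean trace stays bounded.\<close>

lemma U_cov_invertible: "invertible U_cov"
proof (rule ccontr)
  assume "\<not> invertible U_cov"
  then obtain x where x: "U_cov *v x = 0" "x \<noteq> 0"
    unfolding invertible_left_inverse matrix_left_invertible_ker by blast
  define v where "v = x /\<^sub>R norm x"
  have v: "norm v = 1" "U_cov *v v = 0"
    using x by (simp_all add: v_def matrix_vector_mult_scaleR)
  \<comment> \<open>The regularisation is \<open>\<eta> = (e n)\<^sup>2 = 1 / (n + 1)\<close>, which
    is also the value of the regularised form at \<open>v\<close>; \<open>e n\<close> is thus the
    parameter in the lower bound for the trace.\<close>
  define e where "e n = 1 / sqrt (real (Suc n))" for n
  have e0: "e n > 0" for n by (simp add: e_def)
  have "\<forall>n. \<exists>AG. transport_family (U_cov + (e n)\<^sup>2 *\<^sub>R mat 1) (fst AG) (snd AG)"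
  proof
    fix n
    obtain A G where "transport_family (U_cov + (e n)\<^sup>2 *\<^sub>R mat 1) A G"
      using transport_family_exists[OF nonsing U_cov_regularized] e0[of n] zero_less_power by blast
    then show "\<exists>AG. transport_family (U_cov + (e n)\<^sup>2 *\<^sub>R mat 1) (fst AG) (snd AG)" by auto
  qed
  from choice[OF this] obtain AG where AG: "\<And>n. transport_family (U_cov + (e n)\<^sup>2 *\<^sub>R mat 1) (fst (AG n)) (snd (AG n))"
    by blast
  define t where "t n \<omega> = ennreal (trace (snd (AG n) (Y \<omega>)))" for n \<omega>
  have t[measurable]: "t n \<in> borel_measurable M" for n
    using G_measurable[OF AG[of n]] unfolding t_def by measurable
  have bound: "(\<integral>\<^sup>+\<omega>. t n \<omega> \<partial>M) \<le> ennreal (real CARD('s))" for n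
    unfolding t_def using regularized_trace_bound[OF _ AG[of n]] e0[of n] by simp
  have "AE \<omega> in M. \<forall>n. gaussian_measure (K (Y \<omega>)) \<and> psd_matrix (fst (AG n) (Y \<omega>)) \<and>
      fst (AG n) (Y \<omega>) ** cond_cov (Y \<omega>) ** fst (AG n) (Y \<omega>) = U_cov + (e n)\<^sup>2 *\<^sub>R mat 1 \<and>
      fst (AG n) (Y \<omega>) ** snd (AG n) (Y \<omega>) = mat 1"
    unfolding AE_all_countable using transport_AE[OF AG] by blast
  then have "AE \<omega> in M. liminf (\<lambda>n. t n \<omega>) = \<infinity>"
    using nonsing
  proof eventually_elim
    case (elim \<omega>)
    then have g: "gaussian_measure (K (Y \<omega>))" by blast
    obtain c where c: "c > 0" "\<And>T G B v e. psd_matrix T \<Longrightarrow> T ** cond_cov (Y \<omega>) ** T = B \<Longrightarrow> T ** G = mat 1 \<Longrightarrow>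
      norm v = 1 \<Longrightarrow> v \<bullet> (B *v v) \<le> e\<^sup>2 \<Longrightarrow> e > 0 \<Longrightarrow> 1 / (c * e) \<le> trace G"
      using transport_inverse_trace_lower_bound[OF psd_cond_cov[OF g] elim(2)] by blast
    \<comment> \<open>The constant \<open>c\<close> depends on \<open>\<omega>\<close> but not on
      \<open>n\<close>, so the traces diverge at the rate \<open>1 / e n\<close>.\<close>
    have low: "sqrt (real (Suc n)) / c \<le> trace (snd (AG n) (Y \<omega>))" for n
    proof -
      have "v \<bullet> ((U_cov + (e n)\<^sup>2 *\<^sub>R mat 1) *v v) = (e n)\<^sup>2"
        using v by (simp add: matrix_vector_mult_add_rdistrib scaleR_matrix_vector_assoc[symmetric] norm_eq_1)
      then have "1 / (c * e n) \<le> trace (snd (AG n) (Y \<omega>))"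
        using c(2)[of "fst (AG n) (Y \<omega>)" "U_cov + (e n)\<^sup>2 *\<^sub>R mat 1" "snd (AG n) (Y \<omega>)" v "e n"] elim(1) v(1) e0[of n]
        by simp
      then show ?thesis by (simp add: e_def)
    qed
    have large: "of_nat N \<le> liminf (\<lambda>n. t n \<omega>)" for N
    proof (rule Liminf_bounded)
      have "\<forall>\<^sub>F n in sequentially. real N \<le> sqrt (real (Suc n)) / c"
      proof (rule eventually_sequentiallyI)
        fix n assume "nat \<lceil>(c * real N)\<^sup>2\<rceil> \<le> n"
        then have "(c * real N)\<^sup>2 \<le> real (Suc n)" by linarith
        then have "c * real N \<le> sqrt (real (Suc n))" by (rule real_le_rsqrt)
        then show "real N \<le> sqrt (real (Suc n)) / c"
          using c(1) by (simp add: pos_le_divide_eq mult.commute)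
      qed
      then show "\<forall>\<^sub>F n in sequentially. of_nat N \<le> t n \<omega>"
        unfolding t_def ennreal_of_nat_eq_real_of_nat
        by eventually_elim (intro ennreal_leI order_trans[OF _ low])
    qed
    show ?case
    proof (rule ccontr)
      assume "liminf (\<lambda>n. t n \<omega>) \<noteq> \<infinity>"
      then obtain N where "liminf (\<lambda>n. t n \<omega>) < of_nat N"
        using ennreal_Ex_less_of_nat[of "liminf (\<lambda>n. t n \<omega>)"] by (auto simp: less_top)
      with large[of N] show False by simp
    qed
  qed
  \<comment> \<open>Fatou's lemma: the divergence is only pointwise in \<open>\<omega>\<close>, with
    no uniform rate.\<close>
  then have "\<infinity> = (\<integral>\<^sup>+\<omega>. liminf (\<lambda>n. t n \<omega>) \<partial>M)"
    by (subst nn_integral_cong_AE[where v = "\<lambda>_. \<infinity>"]) (auto simp: emeasure_space_1)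
  also have "\<dots> \<le> liminf (\<lambda>n. \<integral>\<^sup>+\<omega>. t n \<omega> \<partial>M)" by (rule nn_integral_liminf) measurable
  also have "\<dots> \<le> ennreal (real CARD('s))"
    by (intro Liminf_le always_eventually allI bound) simp
  finally show False by (simp add: top_unique)
qed

lemma U0_eq_transport:
  assumes tf: "transport_family U_cov A G"
  shows "AE \<omega> in M. U0 \<omega> = A (Y \<omega>) *v S0 \<omega>"
proof -
  have "transport_family (U_cov + 0 *\<^sub>R mat 1) A G" using tf by simp
  note gap = transport_gap[OF order_refl this]
  have "(\<integral>\<omega>. gap A G \<omega> \<partial>M) = 0"
    using gap(3) integral_nonneg_AE[OF gap_nonneg[OF tf]] by simp
  then have "AE \<omega> in M. gap A G \<omega> = 0"
    using integral_nonneg_eq_0_iff_AE[OF gap(1) gap_nonneg[OF tf]] by simp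
  then show ?thesis using transport_AE[OF tf]
  proof eventually_elim
    case (elim \<omega>)
    \<comment> \<open>A vanishing semidefinite form puts its argument into the kernel of
      \<open>A\<close>, and \<open>A G = mat 1\<close> then recovers \<open>U0\<close>.\<close>
    then have "A (Y \<omega>) *v (S0 \<omega> - G (Y \<omega>) *v U0 \<omega>) = 0"
      by (intro psd_matrix_eq_0) (auto simp: gap_def)
    moreover have "A (Y \<omega>) *v (G (Y \<omega>) *v U0 \<omega>) = U0 \<omega>"
      using elim by (simp add: matrix_vector_mul_assoc)
    ultimately show ?case by (simp add: matrix_vector_mult_diff_distrib)
  qed
qed

section \<open>Cross covariance of the optimal vector and \<open>W\<close>\<close>

context
  fixes A G assumes tf: "transport_family U_cov A G"
begin

text \<open>With \<open>A S0\<close> in place of \<open>U0\<close> the exponent is, in each fibre, a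
  functional along \<open>x (A e, 0) + t (0, u)\<close>, whose Gaussian transform is explicit. Of
  the three variance terms the one in \<open>x\<^sup>2\<close> is the same in all good fibres, so it
  can later be divided out.\<close>

lemma cross_cov_char:
  fixes e :: "real^'s" and u :: "real^'d"
  shows "(CLINT \<omega>|M. iexp (t * (u \<bullet> W \<omega>) + x * (e \<bullet> U0 \<omega>))) =
    (CLINT \<omega>|M. iexp (t * (\<integral>z. (0, u) \<bullet> z \<partial>K (Y \<omega>))) * exp (- of_real
      ((x\<^sup>2 * (e \<bullet> (U_cov *v e)) + 2 * x * t * cross_cov A e u (Y \<omega>) + t\<^sup>2 * functional_cov (K (Y \<omega>)) (0, u) (0, u)) / 2)))"
proof -
  note [measurable] = A_measurable[OF tf] G_measurable[OF tf]
  define f where "f = (\<lambda>(y, z::(real^'s) \<times> (real^'d)). iexp (t * (u \<bullet> snd z) + x * (e \<bullet> (A y *v (fst z - cond_mean y)))))"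
  have f[measurable]: "f \<in> borel_measurable (borel \<Otimes>\<^sub>M borel)"
    unfolding f_def by measurable
  have "(CLINT \<omega>|M. iexp (t * (u \<bullet> W \<omega>) + x * (e \<bullet> U0 \<omega>))) = (CLINT \<omega>|M. f (Y \<omega>, (S \<omega>, W \<omega>)))"
  proof (rule integral_cong_AE)
    show "AE \<omega> in M. iexp (t * (u \<bullet> W \<omega>) + x * (e \<bullet> U0 \<omega>)) = f (Y \<omega>, (S \<omega>, W \<omega>))"
      using U0_eq_transport[OF tf] by eventually_elim (simp add: f_def S0_def)
  qed measurable
  also have "\<dots> = (CLINT \<omega>|M. (CLINT z|K (Y \<omega>). f (Y \<omega>, z)))"
    by (rule bounded_integral_disintegration_complex(2)[of f 1]) (auto simp: f_def)
  also have "\<dots> = (CLINT \<omega>|M. iexp (t * (\<integral>z. (0, u) \<bullet> z \<partial>K (Y \<omega>))) * exp (- of_real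
      ((x\<^sup>2 * (e \<bullet> (U_cov *v e)) + 2 * x * t * cross_cov A e u (Y \<omega>) + t\<^sup>2 * functional_cov (K (Y \<omega>)) (0, u) (0, u)) / 2)))"
  proof (rule integral_cong_AE)
    show "AE \<omega> in M. (CLINT z|K (Y \<omega>). f (Y \<omega>, z)) = iexp (t * (\<integral>z. (0, u) \<bullet> z \<partial>K (Y \<omega>))) * exp (- of_real
      ((x\<^sup>2 * (e \<bullet> (U_cov *v e)) + 2 * x * t * cross_cov A e u (Y \<omega>) + t\<^sup>2 * functional_cov (K (Y \<omega>)) (0, u) (0, u)) / 2))"
      using transport_AE[OF tf]
    proof eventually_elim
      case (elim \<omega>)
      let ?y = "Y \<omega>"
      have g: "gaussian_measure (K ?y)" and p: "psd_matrix (A ?y)" and AB: "A ?y ** cond_cov ?y ** A ?y = U_cov"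
        using elim by auto
      interpret Ky: gaussian "K ?y" by unfold_locales (rule g)
      let ?a = "(A ?y *v e, 0) :: (real^'s) \<times> (real^'d)" and ?b = "(0, u) :: (real^'s) \<times> (real^'d)"
      \<comment> \<open>Symmetry of \<open>A\<close> moves it onto \<open>e\<close>; after centring,
        only the conditional mean of \<open>u \<bullet> W\<close> is left over, as \<open>S0\<close>
        has none.\<close>
      have lin: "t * (u \<bullet> snd z) + x * (e \<bullet> (A ?y *v (fst z - cond_mean ?y))) =
          t * (\<integral>z. ?b \<bullet> z \<partial>K ?y) + (x *\<^sub>R ?a + t *\<^sub>R ?b) \<bullet> (z - mean_vec (K ?y))" for z
        unfolding Ky.inner_mean_vec[symmetric] psd_matrix_inner[OF p, symmetric]
        by (simp add: inner_prod_def cond_mean_def inner_add_left inner_diff_right algebra_simps)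
      have "(CLINT z|K ?y. f (?y, z)) = (CLINT z|K ?y. iexp (t * (\<integral>z. ?b \<bullet> z \<partial>K ?y)) *
          iexp ((x *\<^sub>R ?a + t *\<^sub>R ?b) \<bullet> (z - mean_vec (K ?y))))"
        unfolding f_def prod.case lin by (simp only: of_real_add distrib_left exp_add)
      also have "\<dots> = iexp (t * (\<integral>z. ?b \<bullet> z \<partial>K ?y)) *
          exp (- of_real (functional_cov (K ?y) (x *\<^sub>R ?a + t *\<^sub>R ?b) (x *\<^sub>R ?a + t *\<^sub>R ?b) / 2))"
        by (simp only: integral_mult_right_zero Ky.char_centered)
      also have "functional_cov (K ?y) ?a ?a = e \<bullet> (U_cov *v e)"
        by (rule functional_cov_transport[OF g p AB])
      then have "functional_cov (K ?y) (x *\<^sub>R ?a + t *\<^sub>R ?b) (x *\<^sub>R ?a + t *\<^sub>R ?b) =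
          x\<^sup>2 * (e \<bullet> (U_cov *v e)) + 2 * x * t * cross_cov A e u ?y + t\<^sup>2 * functional_cov (K ?y) ?b ?b"
        unfolding Ky.functional_cov_scaled_pair cross_cov_eq[OF g] by simp
      finally show ?case .
    qed
  qed (unfold cross_cov_def, measurable)
  finally show ?thesis .
qed

text \<open>The form is the fibre variance of \<open>x (e \<bullet> U0) + t (u \<bullet> W)\<close>.
  It keeps the Gaussian factor at most 1, which secures integrability of the exponentials for all
  real \<open>x\<close>.\<close>

lemma cross_cov_quadratic_nonneg:
  "AE \<omega> in M. 0 \<le> x\<^sup>2 * (e \<bullet> (U_cov *v e)) + 2 * x * t * cross_cov A e u (Y \<omega>) +
    t\<^sup>2 * functional_cov (K (Y \<omega>)) (0, u) (0, u)"
  using transport_AE[OF tf]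
proof eventually_elim
  case (elim \<omega>)
  let ?y = "Y \<omega>"
  have g: "gaussian_measure (K ?y)" and p: "psd_matrix (A ?y)" and AB: "A ?y ** cond_cov ?y ** A ?y = U_cov"
    using elim by auto
  interpret Ky: gaussian "K ?y" by unfold_locales (rule g)
  have "functional_cov (K ?y) (A ?y *v e, 0) (A ?y *v e, 0) = e \<bullet> (U_cov *v e)"
    by (rule functional_cov_transport[OF g p AB])
  then show ?case
    using functional_cov_nonneg[of "K ?y" "x *\<^sub>R (A ?y *v e, 0) + t *\<^sub>R (0, u)"]
    unfolding Ky.functional_cov_scaled_pair cross_cov_eq[OF g] by simp
qed

lemma cross_cov_measurable: "cross_cov A e u \<in> borel_measurable borel"
proof -
  note [measurable] = A_measurable[OF tf]
  show ?thesis unfolding cross_cov_def[abs_def] by measurable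
qed

context
  assumes W_U: "indep_rv M W U"
begin

lemma cross_cov_eq_0:
  fixes e :: "real^'s" and u :: "real^'d"
  shows "AE \<omega> in M. cross_cov A e u (Y \<omega>) = 0"
proof (rule AE_eq_0_of_char)
  note [measurable] = cross_cov_measurable
  define n where "n \<omega> = (\<integral>z. (0, u) \<bullet> z \<partial>K (Y \<omega>))" for \<omega>
  define \<gamma> where "\<gamma> \<omega> = functional_cov (K (Y \<omega>)) (0, u) (0, u)" for \<omega>
  define \<beta> where "\<beta> \<omega> = cross_cov A e u (Y \<omega>)" for \<omega>
  define v where "v = e \<bullet> (U_cov *v e)"
  define c where "c t = (CLINT \<omega>|M. iexp (t * (u \<bullet> W \<omega>)))" for t
  define f where "f t \<omega> = iexp (t * n \<omega>) * of_real (exp (- (t\<^sup>2 * \<gamma> \<omega> / 2)))" for t \<omega>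
  have [measurable]: "n \<in> borel_measurable M"
  proof -
    have "(\<lambda>y. \<integral>z. (0, u) \<bullet> z \<partial>K y) \<in> borel_measurable borel"
      using kernel_integral_borel[of "\<lambda>z. (0, u) \<bullet> snd z"] by simp
    then show ?thesis unfolding n_def by (rule measurable_compose[OF Y])
  qed
  have [measurable]: "\<gamma> \<in> borel_measurable M" unfolding \<gamma>_def by measurable
  have [measurable]: "\<beta> \<in> borel_measurable M" unfolding \<beta>_def by measurable
  have [measurable]: "f t \<in> borel_measurable M" for t unfolding f_def by measurable
  have char: "(CLINT \<omega>|M. iexp (t * (u \<bullet> W \<omega>) + x * (e \<bullet> U0 \<omega>))) =
    (CLINT \<omega>|M. iexp (t * n \<omega>) * of_real (exp (- ((x\<^sup>2 * v + 2 * x * t * \<beta> \<omega> + t\<^sup>2 * \<gamma> \<omega>) / 2))))" for t x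
    using cross_cov_char[of t u x e]
    by (simp only: n_def \<gamma>_def \<beta>_def v_def exp_of_real[symmetric] of_real_minus)
  \<comment> \<open>At \<open>t = 0\<close> the fibre formula shows that
    \<open>e \<bullet> U0\<close> has the transform \<open>exp (- x\<^sup>2 v / 2)\<close>; the
    factor \<open>c t\<close> coming from \<open>W\<close> never has to be computed.\<close>
  have factor: "(CLINT \<omega>|M. iexp (t * (u \<bullet> W \<omega>) + x * (e \<bullet> U0 \<omega>))) = c t * of_real (exp (- (x\<^sup>2 * v / 2)))" for t x
  proof -
    have "(CLINT \<omega>|M. iexp (t * (u \<bullet> W \<omega>) + x * (e \<bullet> U0 \<omega>))) =
        (CLINT \<omega>|M. iexp (t * (u \<bullet> W \<omega>)) * iexp (x * (e \<bullet> (U \<omega> - \<mu>))))"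
      by (simp only: U0_def of_real_add distrib_left exp_add)
    also have "\<dots> = (CLINT \<omega>|M. iexp (t * (u \<bullet> W \<omega>))) * (CLINT \<omega>|M. iexp (x * (e \<bullet> (U \<omega> - \<mu>))))"
      by (rule indep_rv_integral_mult(2)[OF prob_space_axioms W U_measurable W_U,
            of "\<lambda>w. iexp (t * (u \<bullet> w))" "\<lambda>w. iexp (x * (e \<bullet> (w - \<mu>)))"])
        (auto intro!: integrable_iexp_real[where f = "\<lambda>\<omega>. t * (u \<bullet> W \<omega>)", simplified]
          integrable_iexp_real[where f = "\<lambda>\<omega>. x * (e \<bullet> (U \<omega> - \<mu>))", simplified])
    also have "(CLINT \<omega>|M. iexp (x * (e \<bullet> (U \<omega> - \<mu>)))) = (CLINT \<omega>|M. of_real (exp (- (x\<^sup>2 * v / 2))))"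
      using char[of 0 x] by (simp add: U0_def)
    finally show ?thesis by (simp add: c_def prob_space)
  qed
  \<comment> \<open>Multiplication by \<open>exp (x\<^sup>2 v / 2)\<close> removes the term
    quadratic in \<open>x\<close> and leaves an exponential linear in \<open>x\<close>, the shape
    that the continuation to imaginary \<open>x\<close> requires.\<close>
  have eq: "f t \<omega> * of_real (exp (x * (- t * \<beta> \<omega>))) = of_real (exp (x\<^sup>2 * v / 2)) *
      (iexp (t * n \<omega>) * of_real (exp (- ((x\<^sup>2 * v + 2 * x * t * \<beta> \<omega> + t\<^sup>2 * \<gamma> \<omega>) / 2))))" for t x \<omega>
  proof -
    have "exp (- (t\<^sup>2 * \<gamma> \<omega> / 2)) * exp (x * (- t * \<beta> \<omega>)) =
        exp (x\<^sup>2 * v / 2) * exp (- ((x\<^sup>2 * v + 2 * x * t * \<beta> \<omega> + t\<^sup>2 * \<gamma> \<omega>) / 2))"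
      unfolding exp_add[symmetric] by (simp add: field_simps)
    note e = arg_cong[OF this, of complex_of_real, unfolded of_real_mult[of "exp _" "exp _"]]
    show ?thesis unfolding f_def mult.assoc e by (simp only: mult.left_commute)
  qed
  have imag: "(CLINT \<omega>|M. f t \<omega> * iexp (x * (- t * \<beta> \<omega>))) = c t" for t x
  proof (rule integral_exp_constant_imaginary)
    fix x
    have "integrable M (\<lambda>\<omega>. iexp (t * n \<omega>) *
        of_real (exp (- ((x\<^sup>2 * v + 2 * x * t * \<beta> \<omega> + t\<^sup>2 * \<gamma> \<omega>) / 2))))"
    proof (rule integrable_const_bound[where B = 1])
      show "AE \<omega> in M. norm (iexp (t * n \<omega>) *
          of_real (exp (- ((x\<^sup>2 * v + 2 * x * t * \<beta> \<omega> + t\<^sup>2 * \<gamma> \<omega>) / 2)))) \<le> 1"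
        using cross_cov_quadratic_nonneg[of x e t u]
        by eventually_elim (simp add: norm_mult v_def \<beta>_def \<gamma>_def)
    qed measurable
    then show "integrable M (\<lambda>\<omega>. f t \<omega> * of_real (exp (x * (- t * \<beta> \<omega>))))"
      unfolding eq by (rule integrable_mult_right)
    have "(CLINT \<omega>|M. f t \<omega> * of_real (exp (x * (- t * \<beta> \<omega>)))) =
        of_real (exp (x\<^sup>2 * v / 2)) * (c t * of_real (exp (- (x\<^sup>2 * v / 2))))"
      unfolding eq integral_mult_right_zero char[symmetric] factor ..
    also have "\<dots> = c t * of_real (exp (x\<^sup>2 * v / 2) * exp (- (x\<^sup>2 * v / 2)))" by (simp add: mult_ac)
    also have "exp (x\<^sup>2 * v / 2) * exp (- (x\<^sup>2 * v / 2)) = 1" by (simp flip: exp_add)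
    finally show "(CLINT \<omega>|M. f t \<omega> * of_real (exp (x * (- t * \<beta> \<omega>)))) = c t" by simp
  qed measurable
  fix r
  define t where "t k = 1 / real (Suc k)" for k
  have t0: "t k \<noteq> 0" for k by (simp add: t_def)
  have t_lim: "t \<longlonglongrightarrow> 0" unfolding t_def by (rule LIMSEQ_inverse_real_of_nat[unfolded inverse_eq_divide])
  \<comment> \<open>The same sequence gets two limits: one from continuity of the transform of
    \<open>u \<bullet> W\<close> at 0, the other from the continued identity with
    \<open>f (t k)\<close> tending to 1.\<close>
  have "(\<lambda>k. c (t k)) \<longlonglongrightarrow> (CLINT \<omega>|M. 1)"
    unfolding c_def
  proof (rule integral_dominated_convergence[where w = "\<lambda>_. 1"])
    show "AE \<omega> in M. (\<lambda>k. iexp (t k * (u \<bullet> W \<omega>))) \<longlonglongrightarrow> 1"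
    proof (intro AE_I2)
      fix \<omega>
      have "(\<lambda>k. iexp (t k * (u \<bullet> W \<omega>))) \<longlonglongrightarrow> iexp (0 * (u \<bullet> W \<omega>))"
        by (intro tendsto_intros t_lim)
      then show "(\<lambda>k. iexp (t k * (u \<bullet> W \<omega>))) \<longlonglongrightarrow> 1" by simp
    qed
  qed (simp_all add: norm_exp_i_times[of "_ * _", unfolded of_real_mult])
  moreover have "(\<lambda>k. c (t k)) \<longlonglongrightarrow> (CLINT \<omega>|M. iexp (r * \<beta> \<omega>))"
  proof -
    \<comment> \<open>The continued identity is used at \<open>x = - r / t k\<close>, which cancels
      the factor \<open>- t k\<close> in front of \<open>\<beta>\<close>; this is why
      \<open>t k \<noteq> 0\<close> was recorded.\<close>
    have "c (t k) = (CLINT \<omega>|M. f (t k) \<omega> * iexp (r * \<beta> \<omega>))" for k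
      using imag[of "t k" "- r / t k"] t0[of k] by simp
    moreover have "(\<lambda>k. CLINT \<omega>|M. f (t k) \<omega> * iexp (r * \<beta> \<omega>)) \<longlonglongrightarrow> (CLINT \<omega>|M. iexp (r * \<beta> \<omega>))"
    proof (rule integral_dominated_convergence[where w = "\<lambda>_. 1"])
      show "AE \<omega> in M. (\<lambda>k. f (t k) \<omega> * iexp (r * \<beta> \<omega>)) \<longlonglongrightarrow> iexp (r * \<beta> \<omega>)"
      proof (intro AE_I2)
        fix \<omega>
        have "(\<lambda>k. f (t k) \<omega> * iexp (r * \<beta> \<omega>)) \<longlonglongrightarrow>
          (iexp (0 * n \<omega>) * of_real (exp (- (0\<^sup>2 * \<gamma> \<omega> / 2)))) * iexp (r * \<beta> \<omega>)"
          unfolding f_def by (intro tendsto_intros t_lim) simp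
        then show "(\<lambda>k. f (t k) \<omega> * iexp (r * \<beta> \<omega>)) \<longlonglongrightarrow> iexp (r * \<beta> \<omega>)" by simp
      qed
      show "AE \<omega> in M. norm (f (t k) \<omega> * iexp (r * \<beta> \<omega>)) \<le> 1" for k
        by (intro AE_I2) (simp add: norm_mult f_def \<gamma>_def functional_cov_nonneg)
    qed simp_all
    ultimately show ?thesis by simp
  qed
  ultimately have "(CLINT \<omega>|M. iexp (r * \<beta> \<omega>)) = (CLINT \<omega>|M. 1)"
    using LIMSEQ_unique by blast
  then show "(CLINT \<omega>|M. iexp (r * cross_cov A e u (Y \<omega>))) = 1"
    by (simp add: \<beta>_def prob_space)
qed (rule measurable_compose[OF Y cross_cov_measurable])

text \<open>The null set of \<open>cross_cov_eq_0\<close> depends on \<open>e\<close> and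
  \<open>u\<close>, so it is invoked only for finitely many basis vectors. Bilinearity covers the
  other vectors, and invertibility of \<open>A\<close> writes every \<open>a\<close> as
  \<open>A b\<close>.\<close>

lemma decoupled: "AE \<omega> in M. \<forall>p u. functional_cov (K (Y \<omega>)) (p, 0) (0, u) = 0"
proof -
  have "AE \<omega> in M. \<forall>i j. cross_cov A (axis i 1) (axis j 1) (Y \<omega>) = 0"
    unfolding AE_all_countable using cross_cov_eq_0 by blast
  then show ?thesis using transport_AE[OF tf]
  proof eventually_elim
    case (elim \<omega>)
    let ?y = "Y \<omega>"
    have g: "gaussian_measure (K ?y)" and p: "psd_matrix (A ?y)" and AG: "A ?y ** G ?y = mat 1"
      using elim by auto
    interpret Ky: gaussian "K ?y" by unfold_locales (rule g)
    show ?case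
    proof (intro allI)
      fix a :: "real^'s" and u :: "real^'d"
      define b where "b = G ?y *v a"
      have a: "a = A ?y *v b" using AG by (simp add: b_def matrix_vector_mul_assoc)
      have "(a, 0::real^'d) = (\<Sum>i\<in>UNIV. b $ i *\<^sub>R (A ?y *v axis i 1, 0))"
      proof -
        have "A ?y *v b = A ?y *v (\<Sum>i\<in>UNIV. b $ i *\<^sub>R axis i 1)"
          using basis_expansion[of b] by (simp add: scalar_mult_eq_scaleR)
        also have "\<dots> = (\<Sum>i\<in>UNIV. b $ i *\<^sub>R (A ?y *v axis i 1))"
          by (simp add: matrix_vector_mult_scaleR linear_sum[of "(*v) (A ?y)"])
        finally show ?thesis by (simp add: a prod_eq_iff fst_sum snd_sum)
      qed
      moreover have "(0::real^'s, u) = (\<Sum>j\<in>UNIV. u $ j *\<^sub>R (0, axis j 1))"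
        using basis_expansion[of u] by (simp add: prod_eq_iff fst_sum snd_sum scalar_mult_eq_scaleR)
      moreover have "functional_cov (K ?y) (A ?y *v axis i 1, 0) (0, axis j 1) = 0" for i j
        using elim(1) by (simp add: cross_cov_eq[OF g])
      ultimately show "functional_cov (K ?y) (a, 0) (0, u) = 0"
        by (simp only: Ky.functional_cov_sum_left[OF finite] Ky.functional_cov_sum_right[OF finite]
            mult_zero_right sum.neutral_const)
    qed
  qed
qed

end

end

end

theorem lemma5:
  fixes M :: "'w measure"
    and S :: "'w \<Rightarrow> real ^ 's"
    and Y :: "'w \<Rightarrow> real ^ 'y"
    and W :: "'w \<Rightarrow> real ^ 'd"
    and T :: "(real ^ 's) \<times> (real ^ 'y) \<Rightarrow> real ^ 's"
  assumes "prob_space M"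
    and "S \<in> borel_measurable M"
    and "Y \<in> borel_measurable M"
    and "W \<in> borel_measurable M"
    and "integrable M (\<lambda>\<omega>. (norm (S \<omega>))\<^sup>2)"
    and "cond_gaussian M (\<lambda>\<omega>. (S \<omega>, W \<omega>)) Y"
    and "AE \<omega> in M. invertible (cond_cov_matrix M S Y \<omega>)"
    and "solves_ot_barycenter M S Y T"
    and "indep_rv M W (\<lambda>\<omega>. T (S \<omega>, Y \<omega>))"
  shows "cond_indep_given M W S Y"
proof -
  obtain K where K: "regular_cond_distr M (\<lambda>\<omega>. (S \<omega>, W \<omega>)) Y K" "AE \<omega> in M. gaussian_measure (K (Y \<omega>))"
    using assms(6) by (auto simp: cond_gaussian_def)
  interpret prob_space M by fact
  interpret C: conditional_gaussian M S W Y K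
    using assms(2-5) K by unfold_locales (auto simp: borel_prod[symmetric])
  \<comment> \<open>The hypothesis concerns the matrix of conditional expectations, the locale the
    covariance of the kernel; the two agree almost surely.\<close>
  have "AE \<omega> in M. invertible (C.cond_cov (Y \<omega>))"
    using assms(7) C.cond_cov_matrix_AE by eventually_elim simp
  then interpret B: gaussian_barycenter M S W Y K T
    using assms(8) by unfold_locales
  obtain A G where tf: "C.transport_family B.U_cov A G"
    using C.transport_family_exists[OF B.nonsing B.psd_U_cov B.U_cov_invertible] by blast
  have "indep_rv M W B.U"
    using assms(9) by (simp add: B.U_def[abs_def])
  from C.cond_indep_of_decoupled[OF B.decoupled[OF tf this]] show ?thesis .
qed

end
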